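(* Let $M$ be a real hypersurface in $M_n(c)$ ($n>2$, $c=\pm1$). There is a real constant $k$ such that $$\langle(\nabla_XR_{\xi})Y-(\nabla_YR_{\xi})X,W\rangle=k\big(2\eta(W)\langle\phi X,Y\rangle+\eta(Y)\langle\phi X,W\rangle-\eta(X)\langle\phi Y,W\rangle\big)$$ for all $X,Y,W\in\Gamma(TM)$ if and only if one of the following holds: (i) $M$ is a totally $\eta$-umbilical real hypersurface; (ii) $c=-1$ and, for a suitable choice of the unit normal between $N$ and $-N$, $M$ is an arbitrary Hopf hypersurface with $\alpha=1$, in which case the identity holds with $k=1$ (for that choice of normal). Furthermore, whenever the identity holds, $k\neq0$.
   Context: $M_n(c)$ is the $n$-dimensional (complex dimension) non-flat complex space form of constant holomorphic sectional curvature $4c$, with complex structure $J$; throughout $c=\pm1$, $n>2$ and everything is $C^\infty$. For $c>0$ it is the complex projective space $CP^n$, for $c<0$ the complex hyperbolic space $CH^n$. A real hypersurface $M$ in $M_n(c)$ is a connected hypersurface of real codimension one, without boundary; only local properties are studied, so $M$ is not distinguished from its open subsets. $N$ is a (locally defined) unit normal field, $\langle\,,\rangle$ the induced metric, $\nabla$ its Levi-Civita connection, $A$ the shape operator ($AX=-\bar\nabla_XN$ with $\bar\nabla$ the ambient Levi-Civita connection). Define $\phi,\xi,\eta$ on $M$ by $JX=\phi X+\eta(X)N$, $JN=-\xi$, $\eta(X)=\langle X,\xi\rangle$ for $X\in\Gamma(TM)$, and $\alpha=\langle A\xi,\xi\rangle$. $D$ is the distribution of vectors orthogonal to $\xi$.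 The curvature tensor of $M$ is $R(X,Y)Z=\nabla_X\nabla_YZ-\nabla_Y\nabla_XZ-\nabla_{[X,Y]}Z$, and the structure Jacobi operator is $R_\xi(Y)=R(Y,\xi)\xi$. $M$ is Hopf if $A\xi=\alpha\xi$ (it is known that $\alpha$ is then constant). $M$ is totally $\eta$-umbilical if there is a function $\lambda$ with $AX=\lambda X$ for all $X\in\Gamma(D)$ (it is known that $\lambda$ is then constant). Replacing $N$ by $-N$ replaces $\xi,\eta,\alpha,k$ by their negatives and leaves $\phi$ and $R_\xi$ unchanged. *)

theory Defs
  imports "HOL-Analysis.Analysis"
begin

section \<open>Submanifolds of Euclidean spaces\<close>

primrec Ck_on :: "nat \<Rightarrow> 'a::euclidean_space set \<Rightarrow> ('a \<Rightarrow> 'b::euclidean_space) \<Rightarrow> bool" where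
  "Ck_on 0 U f \<longleftrightarrow> continuous_on U f"
| "Ck_on (Suc k) U f \<longleftrightarrow>
     (\<exists>f'. (\<forall>x\<in>U. (f has_derivative f' x) (at x)) \<and> (\<forall>v. Ck_on k U (\<lambda>x. f' x v)))"

text \<open>Only used for open \<open>U\<close>.\<close>

definition smooth_on :: "'a::euclidean_space set \<Rightarrow> ('a \<Rightarrow> 'b::euclidean_space) \<Rightarrow> bool" where
  "smooth_on U f \<longleftrightarrow> (\<forall>k. Ck_on k U f)"

text \<open>Embedded \<open>m\<close>-dimensional submanifolds, described by slice charts
  \<open>f : U \<rightarrow> V\<close> (diffeomorphisms with inverse \<open>g\<close>) that flatten \<open>S\<close> to a linear subspace.\<close>

definition smooth_submanifold :: "nat \<Rightarrow> 'a::euclidean_space set \<Rightarrow> bool" where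
  "smooth_submanifold m S \<longleftrightarrow>
     (\<forall>p\<in>S. \<exists>U (V::'a set) f g L. open U \<and> open V \<and> p \<in> U \<and> homeomorphism U V f g \<and>
        smooth_on U f \<and> smooth_on V g \<and> subspace L \<and> dim L = m \<and> f ` (U \<inter> S) = V \<inter> L)"

definition tangent_space :: "'a::euclidean_space set \<Rightarrow> 'a \<Rightarrow> 'a set" where
  "tangent_space S p = {v. \<exists>e>0. \<exists>\<gamma>::real \<Rightarrow> 'a. smooth_on {-e<..<e} \<gamma> \<and> \<gamma> ` {-e<..<e} \<subseteq> S \<and>
     \<gamma> 0 = p \<and> (\<gamma> has_vector_derivative v) (at 0)}"

text \<open>Smooth maps on a submanifold are those that locally extend to smooth maps on open sets.
  Functions, vector fields and operators on them are total functions on the surrounding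
  Euclidean space; only their values on the submanifold matter.\<close>

definition smooth_map :: "'a::euclidean_space set \<Rightarrow> ('a \<Rightarrow> 'b::euclidean_space) \<Rightarrow> bool" where
  "smooth_map S f \<longleftrightarrow>
     (\<forall>p\<in>S. \<exists>U F. open U \<and> p \<in> U \<and> smooth_on U F \<and> (\<forall>x\<in>S \<inter> U. F x = f x))"

definition vector_fields :: "'a::euclidean_space set \<Rightarrow> ('a \<Rightarrow> 'a) set" where
  "vector_fields S = {X. smooth_map S X \<and> (\<forall>p\<in>S. X p \<in> tangent_space S p)}"

text \<open>The derivative within \<open>S\<close> is determined only on vectors tangent to \<open>S\<close>;
  it is never applied to other vectors.\<close>

definition deriv_along ::
  "'a::euclidean_space set \<Rightarrow> ('a \<Rightarrow> 'a) \<Rightarrow> ('a \<Rightarrow> 'b::euclidean_space) \<Rightarrow> 'a \<Rightarrow> 'b" where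
  "deriv_along S X f p = frechet_derivative f (at p within S) (X p)"

definition lie_bracket ::
  "'a::euclidean_space set \<Rightarrow> ('a \<Rightarrow> 'a) \<Rightarrow> ('a \<Rightarrow> 'a) \<Rightarrow> 'a \<Rightarrow> 'a" where
  "lie_bracket S X Y p = deriv_along S X Y p - deriv_along S Y X p"

type_synonym 'a connection = "('a \<Rightarrow> 'a) \<Rightarrow> ('a \<Rightarrow> 'a) \<Rightarrow> 'a \<Rightarrow> 'a"

definition connection_on :: "'a::euclidean_space set \<Rightarrow> 'a connection \<Rightarrow> bool" where
  "connection_on S D \<longleftrightarrow>
     (\<forall>X\<in>vector_fields S. \<forall>Y\<in>vector_fields S. D X Y \<in> vector_fields S) \<and>
     (\<forall>X\<in>vector_fields S. \<forall>Y\<in>vector_fields S. \<forall>Z\<in>vector_fields S. \<forall>p\<in>S.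
        D (\<lambda>q. X q + Y q) Z p = D X Z p + D Y Z p \<and>
        D X (\<lambda>q. Y q + Z q) p = D X Y p + D X Z p) \<and>
     (\<forall>f::'a \<Rightarrow> real. smooth_map S f \<longrightarrow>
        (\<forall>X\<in>vector_fields S. \<forall>Y\<in>vector_fields S. \<forall>p\<in>S.
           D (\<lambda>q. f q *\<^sub>R X q) Y p = f p *\<^sub>R D X Y p \<and>
           D X (\<lambda>q. f q *\<^sub>R Y q) p = deriv_along S X f p *\<^sub>R Y p + f p *\<^sub>R D X Y p))"

text \<open>The Riemannian metrics that occur are restrictions to tangent spaces of a fixed bilinear
  form \<open>B\<close> on the surrounding space. Connections are local operators, so the axioms are
  imposed for the vector fields over every open subset \<open>S \<inter> U\<close>.\<close>

definition levi_civita ::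
  "'a::euclidean_space set \<Rightarrow> ('a \<Rightarrow> 'a \<Rightarrow> real) \<Rightarrow> 'a connection \<Rightarrow> bool" where
  "levi_civita S B D \<longleftrightarrow>
     (\<forall>U. open U \<longrightarrow> connection_on (S \<inter> U) D \<and>
        (\<forall>X\<in>vector_fields (S \<inter> U). \<forall>Y\<in>vector_fields (S \<inter> U). \<forall>p\<in>S \<inter> U.
           D X Y p - D Y X p = lie_bracket (S \<inter> U) X Y p) \<and>
        (\<forall>X\<in>vector_fields (S \<inter> U). \<forall>Y\<in>vector_fields (S \<inter> U). \<forall>Z\<in>vector_fields (S \<inter> U).
           \<forall>p\<in>S \<inter> U.
           deriv_along (S \<inter> U) X (\<lambda>q. B (Y q) (Z q)) p = B (D X Y p) (Z p) + B (Y p) (D X Z p)))"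

definition curvature ::
  "'a::euclidean_space set \<Rightarrow> 'a connection \<Rightarrow> ('a \<Rightarrow> 'a) \<Rightarrow> ('a \<Rightarrow> 'a) \<Rightarrow> ('a \<Rightarrow> 'a) \<Rightarrow> 'a \<Rightarrow> 'a" where
  "curvature S D X Y Z p = D X (D Y Z) p - D Y (D X Z) p - D (lie_bracket S X Y) Z p"


section \<open>The complex space forms of holomorphic sectional curvature \<open>4c\<close>, \<open>c = \<plusminus>1\<close>\<close>

text \<open>With \<open>n = CARD('n)\<close>, the space \<open>\<complex>\<^sup>n\<^sup>+\<^sup>1\<close> is \<open>complex ^ ('n option)\<close>. It carries the Hermitian
  form \<open>c z\<^sub>0 w\<^sub>0\<^sup>* + z\<^sub>1 w\<^sub>1\<^sup>* + \<dots> + z\<^sub>n w\<^sub>n\<^sup>*\<close>, the coordinate \<open>0\<close> being \<open>None\<close>.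
  The total space of the Hopf fibration is \<open>{z. herm c z z = c}\<close>: the unit sphere for \<open>c = 1\<close>,
  the anti-de Sitter space for \<open>c = -1\<close>. The point of \<open>CP\<^sup>n\<close> or \<open>CH\<^sup>n\<close> given by the line through
  \<open>z\<close> is represented by the orthogonal projection \<open>w \<mapsto> c (herm c w z) z\<close> onto that line.\<close>

type_synonym 'n cvec = "complex ^ ('n option)"
type_synonym 'n cmat = "complex ^ ('n option) ^ ('n option)"

definition signature :: "real \<Rightarrow> 'n option \<Rightarrow> complex" where
  "signature c a = (if a = None then of_real c else 1)"

definition herm :: "real \<Rightarrow> 'n::finite cvec \<Rightarrow> 'n cvec \<Rightarrow> complex" where
  "herm c z w = (\<Sum>a\<in>UNIV. signature c a * (z $ a) * cnj (w $ a))"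

definition hopf_map :: "real \<Rightarrow> 'n::finite cvec \<Rightarrow> 'n cmat" where
  "hopf_map c z = (\<chi> a b. of_real c * (z $ a) * signature c b * cnj (z $ b))"

definition complex_space_form :: "real \<Rightarrow> 'n::finite cmat set" where
  "complex_space_form c = hopf_map c ` {z. herm c z z = of_real c}"

text \<open>Metric and complex structure at the point \<open>P\<close>; see \<open>csf_metric_hopf_differential\<close> and
  \<open>csf_J_hopf_differential\<close> below: the Hopf map is a Riemannian submersion onto this metric,
  and the complex structure is induced by multiplication with \<open>\<i>\<close> on horizontal vectors.\<close>

definition csf_metric :: "real \<Rightarrow> 'n::finite cmat \<Rightarrow> 'n cmat \<Rightarrow> real" where
  "csf_metric c X Y = c / 2 * Re (trace (X ** Y))"

definition csf_J :: "'n::finite cmat \<Rightarrow> 'n cmat \<Rightarrow> 'n cmat" where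
  "csf_J P X = (\<chi> a b. \<i> * ((X ** P) $ a $ b - (P ** X) $ a $ b))"

definition hopf_differential :: "real \<Rightarrow> 'n::finite cvec \<Rightarrow> 'n cvec \<Rightarrow> 'n cmat" where
  "hopf_differential c z u =
     (\<chi> a b. of_real c * signature c b * (u $ a * cnj (z $ b) + z $ a * cnj (u $ b)))"


lemma csf_metric_hopf_differential:
  assumes "c = 1 \<or> c = -1" "herm c z z = of_real c" "herm c u z = 0" "herm c v z = 0"
  shows "csf_metric c (hopf_differential c z u) (hopf_differential c z v) = Re (herm c u v)"
proof -
  have comm: "herm c w w' = cnj (herm c w' w)" for w w' :: "'a cvec"
    by (auto simp: herm_def signature_def mult_ac intro!: sum.cong)
  have split: "(\<Sum>a\<in>UNIV. \<Sum>b\<in>UNIV. signature c a * w $ a * cnj (w' $ a) *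
        (signature c b * x $ b * cnj (x' $ b))) = herm c w w' * herm c x x'"
    for w w' x x' :: "'a cvec"
    unfolding herm_def sum_product ..
  have cc: "complex_of_real c * complex_of_real c = 1"
    using assms(1) by auto
  have "trace (hopf_differential c z u ** hopf_differential c z v) =
    (\<Sum>a\<in>UNIV. \<Sum>b\<in>UNIV. (complex_of_real c * complex_of_real c) * (
      signature c a * u $ a * cnj (z $ a) * (signature c b * v $ b * cnj (z $ b)) +
      signature c a * u $ a * cnj (v $ a) * (signature c b * z $ b * cnj (z $ b)) +
      signature c a * z $ a * cnj (z $ a) * (signature c b * v $ b * cnj (u $ b)) +
      signature c a * z $ a * cnj (v $ a) * (signature c b * z $ b * cnj (u $ b))))"
    unfolding trace_def matrix_matrix_mult_def hopf_differential_def
    by (intro sum.cong refl) (simp, intro sum.cong refl, simp add: algebra_simps)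
  also have "\<dots> = of_real c * (herm c u v + herm c v u)"
    unfolding cc mult_1_left sum.distrib split
    using assms comm[of z u] comm[of z v] by (simp add: algebra_simps)
  finally have tr: "trace (hopf_differential c z u ** hopf_differential c z v) =
    of_real c * (herm c u v + herm c v u)" .
  have "Re (herm c v u) = Re (herm c u v)"
    by (subst comm) simp
  then show ?thesis
    using assms(1) unfolding csf_metric_def tr by auto
qed

lemma has_derivative_hopf_map:
  "(hopf_map c has_derivative hopf_differential c z) (at z)"
proof -
  have vec: "(f has_derivative f') (at z)"
    if "\<And>i. ((\<lambda>x. f x $ i) has_derivative (\<lambda>x. f' x $ i)) (at z)"
    for f f' :: "'a cvec \<Rightarrow> 'b::euclidean_space ^ ('a option)"
  proof (subst has_derivative_componentwise_within, rule ballI)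
    fix w :: "'b ^ ('a option)"
    assume "w \<in> Basis"
    then obtain i v where w: "w = axis i v"
      by (auto simp: Basis_vec_def)
    show "((\<lambda>x. f x \<bullet> w) has_derivative (\<lambda>x. f' x \<bullet> w)) (at z)"
      unfolding w inner_axis by (rule has_derivative_inner_left[OF that])
  qed
  have nth: "((\<lambda>x::'a cvec. x $ i) has_derivative (\<lambda>u. u $ i)) (at z)" for i
    by (rule bounded_linear.has_derivative[OF bounded_linear_vec_nth has_derivative_ident])
  have cnj: "((\<lambda>x::'a cvec. cnj (x $ i)) has_derivative (\<lambda>u. cnj (u $ i))) (at z)" for i
    by (rule bounded_linear.has_derivative[OF bounded_linear_cnj nth])
  show ?thesis
    unfolding hopf_map_def hopf_differential_def
    by (intro vec) (auto intro!: derivative_eq_intros nth cnj simp: algebra_simps)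
qed

lemma csf_J_hopf_differential:
  assumes "c = 1 \<or> c = -1" "herm c z z = of_real c" "herm c u z = 0"
  shows "csf_J (hopf_map c z) (hopf_differential c z u) =
    hopf_differential c z (\<chi> a. \<i> * (u $ a))"
proof -
  have comm: "herm c z u = 0"
  proof -
    have "herm c z u = cnj (herm c u z)"
      by (auto simp: herm_def signature_def mult_ac intro!: sum.cong)
    then show ?thesis using assms(3) by simp
  qed
  have cc: "complex_of_real c * complex_of_real c = 1"
    using assms(1) by auto
  have "(hopf_differential c z u ** hopf_map c z) $ a $ b =
      of_real c * of_real c * (signature c b * cnj (z $ b)) *
      (u $ a * herm c z z + z $ a * herm c z u)" for a b
    unfolding matrix_matrix_mult_def hopf_differential_def hopf_map_def herm_def
    by (simp add: sum_distrib_left sum.distrib[symmetric] algebra_simps)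
  moreover have "(hopf_map c z ** hopf_differential c z u) $ a $ b =
      of_real c * of_real c * (signature c b * z $ a) *
      (cnj (z $ b) * herm c u z + cnj (u $ b) * herm c z z)" for a b
    unfolding matrix_matrix_mult_def hopf_differential_def hopf_map_def herm_def
    by (simp add: sum_distrib_left sum.distrib[symmetric] algebra_simps)
  ultimately show ?thesis
    unfolding csf_J_def cc comm assms(2,3)
    by (simp add: vec_eq_iff hopf_differential_def algebra_simps)
qed

section \<open>Real hypersurfaces\<close>

definition real_hypersurface :: "real \<Rightarrow> 'n::finite cmat set \<Rightarrow> bool" where
  "real_hypersurface c M \<longleftrightarrow> M \<subseteq> complex_space_form c \<and>
     smooth_submanifold (2 * CARD('n) - 1) M \<and> connected M \<and> M \<noteq> {}"

definition unit_normal :: "real \<Rightarrow> 'n::finite cmat set \<Rightarrow> ('n cmat \<Rightarrow> 'n cmat) \<Rightarrow> bool" where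
  "unit_normal c M N \<longleftrightarrow> smooth_map M N \<and>
     (\<forall>p\<in>M. N p \<in> tangent_space (complex_space_form c) p \<and> csf_metric c (N p) (N p) = 1 \<and>
        (\<forall>v\<in>tangent_space M p. csf_metric c (N p) v = 0))"

text \<open>\<open>AX = - Db\<^sub>X N\<close> for the ambient connection \<open>Db\<close>. As \<open>N\<close> is only given along \<open>M\<close>, the right-hand
  side is evaluated on arbitrary local extensions \<open>V\<close>, \<open>W\<close> of \<open>X p\<close> and \<open>N\<close> to the ambient space.\<close>

definition shape_operator ::
  "real \<Rightarrow> 'n::finite cmat connection \<Rightarrow> 'n cmat set \<Rightarrow> ('n cmat \<Rightarrow> 'n cmat) \<Rightarrow>
   ('n cmat \<Rightarrow> 'n cmat) \<Rightarrow> 'n cmat \<Rightarrow> 'n cmat" where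
  "shape_operator c Db M N X p =
     (THE w. \<forall>U V W. open U \<and> p \<in> U \<and>
        V \<in> vector_fields (complex_space_form c \<inter> U) \<and>
        W \<in> vector_fields (complex_space_form c \<inter> U) \<and>
        V p = X p \<and> (\<forall>q\<in>M \<inter> U. W q = N q) \<longrightarrow> w = - Db V W p)"

definition structure_xi :: "('n::finite cmat \<Rightarrow> 'n cmat) \<Rightarrow> 'n cmat \<Rightarrow> 'n cmat" where
  "structure_xi N p = - csf_J p (N p)"

definition structure_eta ::
  "real \<Rightarrow> ('n::finite cmat \<Rightarrow> 'n cmat) \<Rightarrow> ('n cmat \<Rightarrow> 'n cmat) \<Rightarrow> 'n cmat \<Rightarrow> real" where
  "structure_eta c N X p = csf_metric c (X p) (structure_xi N p)"

definition structure_phi ::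
  "real \<Rightarrow> ('n::finite cmat \<Rightarrow> 'n cmat) \<Rightarrow> ('n cmat \<Rightarrow> 'n cmat) \<Rightarrow> 'n cmat \<Rightarrow> 'n cmat" where
  "structure_phi c N X p = csf_J p (X p) - structure_eta c N X p *\<^sub>R N p"

definition structure_alpha ::
  "real \<Rightarrow> 'n::finite cmat connection \<Rightarrow> 'n cmat set \<Rightarrow> ('n cmat \<Rightarrow> 'n cmat) \<Rightarrow> 'n cmat \<Rightarrow> real" where
  "structure_alpha c Db M N p =
     csf_metric c (shape_operator c Db M N (structure_xi N) p) (structure_xi N p)"

definition hopf_hypersurface ::
  "real \<Rightarrow> 'n::finite cmat connection \<Rightarrow> 'n cmat set \<Rightarrow> ('n cmat \<Rightarrow> 'n cmat) \<Rightarrow> bool" where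
  "hopf_hypersurface c Db M N \<longleftrightarrow>
     (\<forall>p\<in>M. shape_operator c Db M N (structure_xi N) p =
        structure_alpha c Db M N p *\<^sub>R structure_xi N p)"

definition totally_eta_umbilical ::
  "real \<Rightarrow> 'n::finite cmat connection \<Rightarrow> 'n cmat set \<Rightarrow> ('n cmat \<Rightarrow> 'n cmat) \<Rightarrow> bool" where
  "totally_eta_umbilical c Db M N \<longleftrightarrow>
     (\<exists>l::'n cmat \<Rightarrow> real. \<forall>X\<in>vector_fields M.
        (\<forall>p\<in>M. csf_metric c (X p) (structure_xi N p) = 0) \<longrightarrow>
        (\<forall>p\<in>M. shape_operator c Db M N X p = l p *\<^sub>R X p))"

definition structure_jacobi ::
  "'n::finite cmat connection \<Rightarrow> 'n cmat set \<Rightarrow> ('n cmat \<Rightarrow> 'n cmat) \<Rightarrow>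
   ('n cmat \<Rightarrow> 'n cmat) \<Rightarrow> 'n cmat \<Rightarrow> 'n cmat" where
  "structure_jacobi D M N Y = curvature M D Y (structure_xi N) (structure_xi N)"

definition nabla_structure_jacobi ::
  "'n::finite cmat connection \<Rightarrow> 'n cmat set \<Rightarrow> ('n cmat \<Rightarrow> 'n cmat) \<Rightarrow>
   ('n cmat \<Rightarrow> 'n cmat) \<Rightarrow> ('n cmat \<Rightarrow> 'n cmat) \<Rightarrow> 'n cmat \<Rightarrow> 'n cmat" where
  "nabla_structure_jacobi D M N X Y p =
     D X (structure_jacobi D M N Y) p - structure_jacobi D M N (D X Y) p"

definition jacobi_codazzi_identity ::
  "real \<Rightarrow> 'n::finite cmat connection \<Rightarrow> 'n cmat set \<Rightarrow> ('n cmat \<Rightarrow> 'n cmat) \<Rightarrow> real \<Rightarrow> bool" where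
  "jacobi_codazzi_identity c D M N k \<longleftrightarrow>
     (\<forall>X\<in>vector_fields M. \<forall>Y\<in>vector_fields M. \<forall>W\<in>vector_fields M. \<forall>p\<in>M.
        csf_metric c (nabla_structure_jacobi D M N X Y p - nabla_structure_jacobi D M N Y X p) (W p) =
        k * (2 * structure_eta c N W p * csf_metric c (structure_phi c N X p) (Y p)
             + structure_eta c N Y p * csf_metric c (structure_phi c N X p) (W p)
             - structure_eta c N X p * csf_metric c (structure_phi c N Y p) (W p)))"

end

theory Submission
  imports Defs
begin

text \<open>In the matrix model the Levi-Civita connections are orthogonal projections of the flat
  derivative, so for \<open>\<xi>\<close>, \<open>\<phi>\<close> and the shape operator \<open>A\<close> one gets \<open>\<nabla>\<xi> = \<phi>A\<close>, the formula for \<open>\<nabla>\<phi>\<close>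
  and the Codazzi equation by differentiating explicit matrix expressions; these determine
  \<open>R\<^sub>\<xi>\<close> and \<open>\<nabla>R\<^sub>\<xi>\<close> in terms of \<open>A\<close> and \<open>\<nabla>A\<close>.

  Let \<open>u = A\<xi> - \<alpha>\<xi>\<close>, \<open>v = \<phi>u\<close>, \<open>h = \<langle>u,u\<rangle>\<close>. The \<open>\<xi>\<close>-component of the identity says
  \<open>R\<^sub>\<xi>\<phi>A + A\<phi>R\<^sub>\<xi> = -2k\<phi>\<close>, whence \<open>R\<^sub>\<xi>v = 0\<close> and \<open>R\<^sub>\<xi>u = 2kc\<alpha>u\<close> everywhere. Where \<open>u \<noteq> 0\<close>, the
  components of the identity orthogonal to \<open>\<xi>, u, v\<close> (here \<open>n > 2\<close> enters) together with the derivative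
  of \<open>R\<^sub>\<xi>u = 2kc\<alpha>u\<close> give a cubic equation for \<open>\<alpha>\<close>, so \<open>\<alpha>\<close> is locally constant there. If \<open>k \<noteq> 0\<close>,
  then \<open>5 + 2c\<alpha>\<^sup>2 = 0\<close>, and a relation between \<open>h\<close> and \<open>\<alpha>\<close> contradicts the cubic; if \<open>k = 0\<close>,
  then the gradient of \<open>h\<close> is a nonzero multiple of \<open>v\<close>, and \<open>d(dh)(\<xi>,u) = 0\<close> yields \<open>h = -3\<close>.

  So \<open>M\<close> is Hopf, and the identity becomes \<open>(c + \<alpha>\<^sup>2)\<phi>A + (\<xi>\<alpha>)A = -(k + c\<alpha>)\<phi>\<close> on \<open>D\<close>. This
  forces \<open>\<xi>\<alpha> = 0\<close>, and then either \<open>\<alpha>\<^sup>2 = -c\<close> or \<open>M\<close> is totally \<open>\<eta>\<close>-umbilical. In both cases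
  \<open>k\<alpha>\<^sup>3 + 3kc\<alpha> + k\<^sup>2 = c\<close>, so \<open>k \<noteq> 0\<close> and \<open>\<alpha>\<close> is constant.\<close>

section \<open>Smooth maps\<close>

text \<open>The number \<open>k\<close> is the same at all points. This is why a cubic satisfied by
  \<alpha> gives local constancy: a nonzero polynomial with constant coefficients has finitely many
  roots, and \<alpha> is continuous. On the non-Hopf set,
  \<open>a *\<^sub>R A v = - c *\<^sub>R v\<close> makes \<alpha> nonzero wherever u is, so A can be
  solved for on u and v and preserves the complement W of \<xi>, u, v. The unknown \<nabla>A enters
  there only through terms that the Codazzi equation removes after antisymmetrising. In the Hopf
  case the second cubic eliminates the principal curvature l on D between (c + \<alpha>^2) l = -(k +
  c \<alpha>) and l^2 = \<alpha> l + c. When c + \<alpha>^2 = 0 the first equation no longer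
  restricts l, which is why A stays arbitrary in (ii). The converse has its own obstacle: the
  umbilicity function comes without any regularity. It is a root of t^2 - \<alpha> t - c and is
  continuous as a quotient of smooth functions, while \<alpha> is constant because D is not
  integrable.\<close>

lemma Ck_on_SucD: "Ck_on (Suc k) U f \<Longrightarrow> Ck_on k U f"
proof (induction k arbitrary: f)
  case 0
  then show ?case
    by (auto intro!: continuous_at_imp_continuous_on) (metis has_derivative_continuous)
next
  case (Suc k)
  then obtain f' where f': "\<forall>x\<in>U. (f has_derivative f' x) (at x)"
      "\<forall>v. Ck_on (Suc k) U (\<lambda>x. f' x v)"
    by (auto simp only: Ck_on.simps)
  then have "\<forall>v. Ck_on k U (\<lambda>x. f' x v)" using Suc.IH by blast
  with f'(1) show ?case by auto
qed

lemma Ck_on_cong: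
  assumes "open U" "\<And>x. x \<in> U \<Longrightarrow> f x = g x"
  shows "Ck_on k U f \<Longrightarrow> Ck_on k U g"
proof (cases k)
  case 0
  then show "Ck_on k U f \<Longrightarrow> Ck_on k U g"
    using assms by (auto cong: continuous_on_cong)
next
  case (Suc j)
  assume "Ck_on k U f"
  then obtain f' where f': "\<forall>x\<in>U. (f has_derivative f' x) (at x)"
      "\<forall>v. Ck_on j U (\<lambda>x. f' x v)"
    using Suc by auto
  have "\<forall>x\<in>U. (g has_derivative f' x) (at x)"
    using f'(1) assms by (auto intro: has_derivative_transform_within_open)
  then show ?thesis using f'(2) Suc by auto
qed

lemma Ck_on_subset: "Ck_on k U f \<Longrightarrow> V \<subseteq> U \<Longrightarrow> Ck_on k V f"
proof (induction k arbitrary: f)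
  case 0 then show ?case using continuous_on_subset by auto
next
  case (Suc k) then show ?case by (simp; meson subsetD)
qed

lemma Ck_on_const: "Ck_on k U (\<lambda>x. a)"
proof (induction k arbitrary: a)
  case (Suc k)
  then show ?case by (auto intro!: exI[of _ "\<lambda>x v. 0"])
qed simp

lemma Ck_on_add: "Ck_on k U f \<Longrightarrow> Ck_on k U g \<Longrightarrow> Ck_on k U (\<lambda>x. f x + g x)"
proof (induction k arbitrary: f g)
  case 0 then show ?case by (auto intro: continuous_intros)
next
  case (Suc k)
  then obtain f' g' where "\<forall>x\<in>U. (f has_derivative f' x) (at x)" "\<forall>v. Ck_on k U (\<lambda>x. f' x v)"
    "\<forall>x\<in>U. (g has_derivative g' x) (at x)" "\<forall>v. Ck_on k U (\<lambda>x. g' x v)"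
    by auto
  with Suc.IH show ?case
    by (auto intro!: exI[of _ "\<lambda>x v. f' x v + g' x v"] has_derivative_add)
qed

lemma Ck_on_linear: "bounded_linear l \<Longrightarrow> Ck_on k U f \<Longrightarrow> Ck_on k U (\<lambda>x. l (f x))"
proof (induction k arbitrary: f)
  case 0 then show ?case by (auto intro: bounded_linear.continuous_on)
next
  case (Suc k)
  then obtain f' where "\<forall>x\<in>U. (f has_derivative f' x) (at x)" "\<forall>v. Ck_on k U (\<lambda>x. f' x v)"
    by auto
  then have "\<forall>x\<in>U. ((\<lambda>x. l (f x)) has_derivative (\<lambda>v. l (f' x v))) (at x)"
    "\<forall>v. Ck_on k U (\<lambda>x. l (f' x v))"
    using Suc.IH Suc.prems(1) bounded_linear.has_derivative by blast+
  then show ?case by auto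
qed

lemma Ck_on_bilinear:
  assumes "bounded_bilinear b"
  shows "Ck_on k U f \<Longrightarrow> Ck_on k U g \<Longrightarrow> Ck_on k U (\<lambda>x. b (f x) (g x))"
proof (induction k arbitrary: f g)
  case 0 then show ?case using assms by (auto intro: bounded_bilinear.continuous_on)
next
  case (Suc k)
  then obtain f' g' where *: "\<forall>x\<in>U. (f has_derivative f' x) (at x)" "\<forall>v. Ck_on k U (\<lambda>x. f' x v)"
    "\<forall>x\<in>U. (g has_derivative g' x) (at x)" "\<forall>v. Ck_on k U (\<lambda>x. g' x v)"
    by auto
  have "Ck_on k U f" "Ck_on k U g" using Suc.prems Ck_on_SucD by blast+
  with Suc.IH * show ?case
    by (auto intro!: exI[of _ "\<lambda>x v. b (f x) (g' x v) + b (f' x v) (g x)"] Ck_on_add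
        bounded_bilinear.FDERIV[OF assms])
qed

lemma Ck_on_ident: "Ck_on k U (\<lambda>x. x)"
  by (cases k) (auto intro!: exI[of _ "\<lambda>x v. v"] Ck_on_const)

text \<open>Stated for affine inner maps because the curves that realise tangent vectors in a chart
  are images of line segments.\<close>

lemma Ck_on_affine:
  assumes "bounded_linear l" "\<And>t. t \<in> W \<Longrightarrow> a + l t \<in> U"
  shows "Ck_on k U g \<Longrightarrow> Ck_on k W (\<lambda>t. g (a + l t))"
proof (induction k arbitrary: g)
  case 0
  have "continuous_on W (\<lambda>t. a + l t)"
    by (intro continuous_intros bounded_linear.continuous_on[OF assms(1)])
  then show ?case using 0 assms(2) by (auto intro: continuous_on_compose2)
next
  case (Suc k)
  then obtain g' where g': "\<forall>x\<in>U. (g has_derivative g' x) (at x)" "\<forall>v. Ck_on k U (\<lambda>x. g' x v)"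
    by auto
  have "((\<lambda>t. g (a + l t)) has_derivative (\<lambda>v. g' (a + l t) (l v))) (at t)" if "t \<in> W" for t
    by (rule has_derivative_compose[of "\<lambda>t. a + l t" l t UNIV g "g' (a + l t)"])
      (use g'(1) assms(2) that in \<open>auto intro!: derivative_eq_intros bounded_linear.has_derivative[OF assms(1)]\<close>)
  then show ?case
    using g'(2) Suc.IH by (auto intro!: exI[of _ "\<lambda>t v. g' (a + l t) (l v)"])
qed

lemma Ck_on_inverse:
  fixes f :: "'a::euclidean_space \<Rightarrow> real"
  assumes "\<And>x. x \<in> U \<Longrightarrow> f x \<noteq> 0"
  shows "Ck_on k U f \<Longrightarrow> Ck_on k U (\<lambda>x. inverse (f x))"
proof (induction k)
  case 0 then show ?case using assms by (auto intro: continuous_intros)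
next
  case (Suc k)
  then obtain f' where f': "\<forall>x\<in>U. (f has_derivative f' x) (at x)" "\<forall>v. Ck_on k U (\<lambda>x. f' x v)"
    by auto
  have "Ck_on k U (\<lambda>x. inverse (f x))" using Suc Ck_on_SucD by blast
  then have "Ck_on k U (\<lambda>x. - (inverse (f x) * f' x v * inverse (f x)))" for v
    by (intro Ck_on_linear[OF bounded_linear_minus[OF bounded_linear_ident]]
        Ck_on_bilinear[OF bounded_bilinear_mult]) (use f' in auto)
  moreover have "\<forall>x\<in>U. ((\<lambda>x. inverse (f x)) has_derivative
      (\<lambda>v. - (inverse (f x) * f' x v * inverse (f x)))) (at x)"
    using f'(1) assms by (auto intro!: has_derivative_inverse)
  ultimately show ?case unfolding Ck_on.simps
    by (intro exI[of _ "\<lambda>x v. - (inverse (f x) * f' x v * inverse (f x))"]) blast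
qed

lemma smooth_on_cong:
  "smooth_on U f \<Longrightarrow> open U \<Longrightarrow> (\<And>x. x \<in> U \<Longrightarrow> f x = g x) \<Longrightarrow> smooth_on U g"
  unfolding smooth_on_def using Ck_on_cong by blast

lemma smooth_on_subset: "smooth_on U f \<Longrightarrow> V \<subseteq> U \<Longrightarrow> smooth_on V f"
  unfolding smooth_on_def using Ck_on_subset by blast

lemma smooth_on_const: "smooth_on U (\<lambda>x. a)"
  unfolding smooth_on_def using Ck_on_const by blast

lemma smooth_on_ident: "smooth_on U (\<lambda>x. x)"
  unfolding smooth_on_def using Ck_on_ident by blast

lemma smooth_on_add: "smooth_on U f \<Longrightarrow> smooth_on U g \<Longrightarrow> smooth_on U (\<lambda>x. f x + g x)"
  unfolding smooth_on_def using Ck_on_add by blast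

lemma smooth_on_linear: "bounded_linear l \<Longrightarrow> smooth_on U f \<Longrightarrow> smooth_on U (\<lambda>x. l (f x))"
  unfolding smooth_on_def using Ck_on_linear by blast

lemma smooth_on_bilinear:
  "bounded_bilinear b \<Longrightarrow> smooth_on U f \<Longrightarrow> smooth_on U g \<Longrightarrow> smooth_on U (\<lambda>x. b (f x) (g x))"
  unfolding smooth_on_def using Ck_on_bilinear by blast

lemma smooth_on_inverse:
  fixes f :: "'a::euclidean_space \<Rightarrow> real"
  shows "smooth_on U f \<Longrightarrow> (\<And>x. x \<in> U \<Longrightarrow> f x \<noteq> 0) \<Longrightarrow> smooth_on U (\<lambda>x. inverse (f x))"
  unfolding smooth_on_def using Ck_on_inverse by blast

lemma smooth_on_affine:
  "smooth_on U g \<Longrightarrow> bounded_linear l \<Longrightarrow> (\<And>t. t \<in> W \<Longrightarrow> a + l t \<in> U) \<Longrightarrow>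
    smooth_on W (\<lambda>t. g (a + l t))"
  unfolding smooth_on_def using Ck_on_affine by blast

lemma smooth_on_sum: "(\<And>i. i \<in> I \<Longrightarrow> smooth_on U (f i)) \<Longrightarrow> smooth_on U (\<lambda>x. \<Sum>i\<in>I. f i x)"
  by (induction I rule: infinite_finite_induct) (auto intro: smooth_on_const smooth_on_add)

section \<open>Derivatives of smooth maps and the symmetry of second derivatives\<close>

lemma smooth_on_has_derivative:
  assumes "smooth_on U f" "x \<in> U"
  shows "(f has_derivative frechet_derivative f (at x)) (at x)"
proof -
  have "Ck_on (Suc 0) U f" using assms by (simp add: smooth_on_def del: Ck_on.simps)
  then show ?thesis using assms(2) frechet_derivative_at by fastforce
qed

lemma smooth_on_continuous_on: "smooth_on U f \<Longrightarrow> continuous_on U f"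
  unfolding smooth_on_def by (metis Ck_on.simps(1))

lemma smooth_on_frechet_derivative:
  assumes "open U" "smooth_on U f"
  shows "smooth_on U (\<lambda>x. frechet_derivative f (at x) v)"
  unfolding smooth_on_def
proof
  fix k
  have "Ck_on (Suc k) U f" using assms by (simp add: smooth_on_def del: Ck_on.simps)
  then obtain f' where f': "\<forall>x\<in>U. (f has_derivative f' x) (at x)" "Ck_on k U (\<lambda>x. f' x v)"
    by auto
  show "Ck_on k U (\<lambda>x. frechet_derivative f (at x) v)"
  proof (rule Ck_on_cong[OF assms(1) _ f'(2)])
    fix x assume "x \<in> U"
    then show "f' x v = frechet_derivative f (at x) v"
      using f'(1) frechet_derivative_at by (metis (no_types))
  qed
qed

text \<open>Turns a linear operator evaluated on a varying vector into a finite sum of coordinate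
  functions times values at fixed vectors; smoothness and product rules for such evaluations are
  obtained from this expansion.\<close>

lemma linear_basis_expansion:
  fixes v :: "'a::euclidean_space"
  shows "linear l \<Longrightarrow> l v = (\<Sum>b\<in>Basis. (v \<bullet> b) *\<^sub>R l b)"
  by (subst euclidean_representation[symmetric, of v])
    (simp only: linear_sum linear_cmul o_def)

lemma smooth_on_frechet_derivative_field:
  fixes f :: "'a::euclidean_space \<Rightarrow> 'b::euclidean_space"
  assumes "open U" "smooth_on U f" "smooth_on U X"
  shows "smooth_on U (\<lambda>x. frechet_derivative f (at x) (X x))"
proof -
  have "smooth_on U (\<lambda>x. \<Sum>b\<in>Basis. (X x \<bullet> b) *\<^sub>R frechet_derivative f (at x) b)"
    by (intro smooth_on_sum smooth_on_bilinear[OF bounded_bilinear_scaleR]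
        smooth_on_linear[OF bounded_linear_inner_left] smooth_on_frechet_derivative assms)
  then show ?thesis
    by (rule smooth_on_cong[OF _ assms(1)])
      (metis linear_basis_expansion assms(2) smooth_on_has_derivative has_derivative_linear)
qed

text \<open>The second difference of \<open>f\<close> over a small parallelogram is symmetric in
  \<open>v\<close> and \<open>w\<close>. Two applications of the mean value theorem turn it into
  \<open>h * h\<close> times a second derivative at a nearby point, and continuity of second
  derivatives does the rest.\<close>

lemma symmetric_second_derivative_real:
  fixes f :: "'a::euclidean_space \<Rightarrow> real"
  assumes "open U" "p \<in> U" "smooth_on U f"
  defines "df \<equiv> \<lambda>x. frechet_derivative f (at x)"
  shows "frechet_derivative (\<lambda>x. df x v) (at p) w = frechet_derivative (\<lambda>x. df x w) (at p) v"
proof -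
  define dd where "dd v w x = frechet_derivative (\<lambda>x. df x v) (at x) w" for v w x
  have sm: "smooth_on U (\<lambda>x. df x v)" for v
    unfolding df_def using assms smooth_on_frechet_derivative by blast
  then have smd: "smooth_on U (dd v w)" for v w
    unfolding dd_def using assms smooth_on_frechet_derivative by blast
  obtain e where e: "e > 0" "ball p e \<subseteq> U" using assms openE by blast
  \<comment> \<open>The parallelogram scaled by \<open>h\<close> lies within distance
    \<open>h * K\<close> of \<open>p\<close>; the summand 1 keeps \<open>K\<close> positive when
    both vectors vanish.\<close>
  define K where "K = norm v + norm w + 1"
  have K: "K > 0" unfolding K_def by (simp add: add_nonneg_pos)
  have key: "\<exists>s t. 0 < s \<and> s < h \<and> 0 < t \<and> t < h \<and>
      f (p + h *\<^sub>R v + h *\<^sub>R w) - f (p + h *\<^sub>R v) - f (p + h *\<^sub>R w) + f p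
      = h * h * dd v w (p + s *\<^sub>R v + t *\<^sub>R w)"
    if h: "0 < h" "h * K < e" "norm v + norm w + 1 = K" for h v w
  proof -
    have inU: "p + s *\<^sub>R v + t *\<^sub>R w \<in> U" if "0 \<le> s" "s \<le> h" "0 \<le> t" "t \<le> h" for s t
    proof -
      have "norm (s *\<^sub>R v + t *\<^sub>R w) \<le> s * norm v + t * norm w"
        using that by (metis abs_of_nonneg norm_scaleR norm_triangle_ineq)
      also have "\<dots> \<le> h * norm v + h * norm w"
        using that by (intro add_mono mult_right_mono) auto
      also have "\<dots> = h * (norm v + norm w)" by (simp add: distrib_left)
      also have "\<dots> \<le> h * K" using h by (intro mult_left_mono) auto
      also have "\<dots> < e" by (rule h(2))
      finally have "dist p (p + s *\<^sub>R v + t *\<^sub>R w) < e"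
        using norm_minus_cancel[of "s *\<^sub>R v + t *\<^sub>R w"] by (simp add: dist_norm add.assoc)
      then show ?thesis using e(2) by auto
    qed
    \<comment> \<open>\<open>F\<close> is the increment in direction \<open>w\<close>. The mean
      value theorem is applied to it in direction \<open>v\<close>, and then to the resulting
      derivative \<open>G\<close> in direction \<open>w\<close>.\<close>
    define F where "F s = f (p + s *\<^sub>R v + h *\<^sub>R w) - f (p + s *\<^sub>R v)" for s
    have df: "(f has_derivative df x) (at x)" if "x \<in> U" for x
      unfolding df_def using smooth_on_has_derivative assms that by blast
    have d1: "((\<lambda>s. f (p + s *\<^sub>R v + t *\<^sub>R w)) has_derivative (\<lambda>x. df (p + s *\<^sub>R v + t *\<^sub>R w) (x *\<^sub>R v))) (at s)"
      if "0 \<le> s" "s \<le> h" "0 \<le> t" "t \<le> h" for s t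
      by (rule has_derivative_compose[of "\<lambda>s. p + s *\<^sub>R v + t *\<^sub>R w" "\<lambda>x. x *\<^sub>R v" s UNIV f "df (p + s *\<^sub>R v + t *\<^sub>R w)"])
        (use df inU that in \<open>auto intro!: derivative_eq_intros\<close>)
    have lin: "df x (a *\<^sub>R z) = a * df x z" if "x \<in> U" for x a z
      using df[OF that] by (metis has_derivative_linear linear_cmul real_scaleR_def)
    have F': "(F has_derivative (\<lambda>x. df (p + s *\<^sub>R v + h *\<^sub>R w) (x *\<^sub>R v) - df (p + s *\<^sub>R v) (x *\<^sub>R v))) (at s)"
      if "0 \<le> s" "s \<le> h" for s
      unfolding F_def using d1[OF that, of h] d1[OF that, of 0] h(1)
      by (auto intro!: has_derivative_diff)
    obtain s where s: "0 < s" "s < h" and s2: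
      "F h - F 0 = df (p + s *\<^sub>R v + h *\<^sub>R w) ((h - 0) *\<^sub>R v) - df (p + s *\<^sub>R v) ((h - 0) *\<^sub>R v)"
      using mvt_simple[OF h(1), of F "\<lambda>s x. df (p + s *\<^sub>R v + h *\<^sub>R w) (x *\<^sub>R v) - df (p + s *\<^sub>R v) (x *\<^sub>R v)"]
        has_derivative_at_withinI[OF F'] by auto
    have s3: "F h - F 0 = h * (df (p + s *\<^sub>R v + h *\<^sub>R w) v - df (p + s *\<^sub>R v) v)"
      using s2 lin inU[of s h] inU[of s 0] s h(1) by (simp add: algebra_simps)
    define G where "G t = df (p + s *\<^sub>R v + t *\<^sub>R w) v" for t
    have ddd: "((\<lambda>x. df x v) has_derivative (\<lambda>w. dd v w x)) (at x)" if "x \<in> U" for x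
      unfolding dd_def using smooth_on_has_derivative[OF sm that] by simp
    have G': "(G has_derivative (\<lambda>x. dd v (x *\<^sub>R w) (p + s *\<^sub>R v + t *\<^sub>R w))) (at t)"
      if "0 \<le> t" "t \<le> h" for t
      unfolding G_def
      by (rule has_derivative_compose[of "\<lambda>t. p + s *\<^sub>R v + t *\<^sub>R w" "\<lambda>x. x *\<^sub>R w" t UNIV "\<lambda>x. df x v"
            "\<lambda>z. dd v z (p + s *\<^sub>R v + t *\<^sub>R w)"])
        (use ddd inU that s in \<open>auto intro!: derivative_eq_intros\<close>)
    obtain t where t: "0 < t" "t < h" and t2: "G h - G 0 = dd v ((h - 0) *\<^sub>R w) (p + s *\<^sub>R v + t *\<^sub>R w)"
      using mvt_simple[OF h(1), of G "\<lambda>t x. dd v (x *\<^sub>R w) (p + s *\<^sub>R v + t *\<^sub>R w)"]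
        has_derivative_at_withinI[OF G'] by auto
    have "dd v (h *\<^sub>R w) x = h * dd v w x" if "x \<in> U" for x
      using has_derivative_linear[OF ddd[OF that]] linear_cmul by fastforce
    then have "G h - G 0 = h * dd v w (p + s *\<^sub>R v + t *\<^sub>R w)"
      using t2 inU[of s t] s t by simp
    then have "F h - F 0 = h * h * dd v w (p + s *\<^sub>R v + t *\<^sub>R w)"
      using s3 by (simp add: G_def)
    then show ?thesis using s t unfolding F_def by (auto simp: algebra_simps)
  qed
  have lim: "\<exists>d>0. \<forall>h s t. 0 < h \<and> h < d \<and> 0 < s \<and> s < h \<and> 0 < t \<and> t < h \<longrightarrow>
      \<bar>dd v w (p + s *\<^sub>R v + t *\<^sub>R w) - dd v w p\<bar> < r" if r: "r > 0" and K2: "norm v + norm w + 1 = K" for r v w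
  proof -
    have "isCont (dd v w) p"
      using smooth_on_continuous_on[OF smd] assms continuous_on_eq_continuous_at by blast
    then obtain d where d: "d > 0" "\<And>x. dist x p < d \<Longrightarrow> dist (dd v w x) (dd v w p) < r"
      unfolding continuous_at_eps_delta using r by meson
    show ?thesis
    proof (intro exI[of _ "d / K"] conjI allI impI)
      show "d / K > 0" using d K by simp
      fix h s t assume *: "0 < h \<and> h < d / K \<and> 0 < s \<and> s < h \<and> 0 < t \<and> t < h"
      have "norm (s *\<^sub>R v + t *\<^sub>R w) \<le> s * norm v + t * norm w"
        using * by (metis abs_of_nonneg norm_scaleR norm_triangle_ineq less_imp_le)
      also have "\<dots> \<le> h * norm v + h * norm w"
        using * by (intro add_mono mult_right_mono) auto
      also have "\<dots> = h * (norm v + norm w)" by (simp add: distrib_left)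
      also have "\<dots> \<le> h * K" using * K2 by (intro mult_left_mono) auto
      also have "\<dots> < d" using * K by (simp add: pos_less_divide_eq)
      finally have "dist (p + s *\<^sub>R v + t *\<^sub>R w) p < d" by (simp add: dist_norm add.assoc)
      from d(2)[OF this] show "\<bar>dd v w (p + s *\<^sub>R v + t *\<^sub>R w) - dd v w p\<bar> < r"
        by (simp add: dist_real_def)
    qed
  qed
  have "dd v w p = dd w v p"
  proof (rule ccontr)
    assume "dd v w p \<noteq> dd w v p"
    \<comment> \<open>Half of the supposed gap, so that two values within \<open>r\<close> of the
      two second derivatives cannot coincide.\<close>
    define r where "r = \<bar>dd v w p - dd w v p\<bar> / 2"
    have r: "r > 0" using \<open>dd v w p \<noteq> dd w v p\<close> r_def by simp
    obtain d1 where d1: "d1 > 0" "\<And>h s t. 0 < h \<and> h < d1 \<and> 0 < s \<and> s < h \<and> 0 < t \<and> t < h \<Longrightarrow>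
      \<bar>dd v w (p + s *\<^sub>R v + t *\<^sub>R w) - dd v w p\<bar> < r" using lim[OF r, of v w] K_def by auto
    obtain d2 where d2: "d2 > 0" "\<And>h s t. 0 < h \<and> h < d2 \<and> 0 < s \<and> s < h \<and> 0 < t \<and> t < h \<Longrightarrow>
      \<bar>dd w v (p + s *\<^sub>R w + t *\<^sub>R v) - dd w v p\<bar> < r" using lim[OF r, of w v] K_def by auto
    define m where "m = min (min d1 d2) (e / K)"
    define h where "h = m / 2"
    have m: "m > 0" "m \<le> d1" "m \<le> d2" "m \<le> e / K"
      unfolding m_def using d1(1) d2(1) e(1) K by auto
    moreover have "h < m" using m(1) by (simp add: h_def)
    ultimately have h: "0 < h" "h < d1" "h < d2" "h < e / K"
      by (auto simp: h_def[symmetric] intro: less_le_trans) (simp add: h_def)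
    then have hK: "h * K < e" using K by (simp add: pos_less_divide_eq)
    obtain s t where 1: "0 < s" "s < h" "0 < t" "t < h"
      "f (p + h *\<^sub>R v + h *\<^sub>R w) - f (p + h *\<^sub>R v) - f (p + h *\<^sub>R w) + f p
      = h * h * dd v w (p + s *\<^sub>R v + t *\<^sub>R w)" using key[OF h(1) hK, of v w] K_def by auto
    obtain s' t' where 2: "0 < s'" "s' < h" "0 < t'" "t' < h"
      "f (p + h *\<^sub>R w + h *\<^sub>R v) - f (p + h *\<^sub>R w) - f (p + h *\<^sub>R v) + f p
      = h * h * dd w v (p + s' *\<^sub>R w + t' *\<^sub>R v)" using key[OF h(1) hK, of w v] K_def by auto
    have "dd v w (p + s *\<^sub>R v + t *\<^sub>R w) = dd w v (p + s' *\<^sub>R w + t' *\<^sub>R v)"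
      using 1(5) 2(5) h(1) by (simp add: algebra_simps)
    moreover have "\<bar>dd v w (p + s *\<^sub>R v + t *\<^sub>R w) - dd v w p\<bar> < r" using d1(2) 1 h by blast
    moreover have "\<bar>dd w v (p + s' *\<^sub>R w + t' *\<^sub>R v) - dd w v p\<bar> < r" using d2(2) 2 h by blast
    ultimately show False unfolding r_def by (simp add: abs_if split: if_splits)
  qed
  then show ?thesis unfolding dd_def .
qed

lemma symmetric_second_derivative:
  fixes f :: "'a::euclidean_space \<Rightarrow> 'b::euclidean_space"
  assumes "open U" "p \<in> U" "smooth_on U f"
  defines "df \<equiv> \<lambda>x. frechet_derivative f (at x)"
  shows "frechet_derivative (\<lambda>x. df x v) (at p) w = frechet_derivative (\<lambda>x. df x w) (at p) v"
proof (rule euclidean_eqI)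
  fix b :: 'b assume "b \<in> Basis"
  have sm: "smooth_on U (\<lambda>x. df x v)" for v
    unfolding df_def using assms smooth_on_frechet_derivative by blast
  have smb: "smooth_on U (\<lambda>x. f x \<bullet> b)"
    by (intro smooth_on_linear[OF bounded_linear_inner_left] assms)
  have 1: "frechet_derivative (\<lambda>x. f x \<bullet> b) (at x) = (\<lambda>v. df x v \<bullet> b)" if "x \<in> U" for x
    using has_derivative_inner_left[OF smooth_on_has_derivative[OF assms(3) that], of b]
    unfolding df_def by (metis frechet_derivative_at)
  have 2: "frechet_derivative (\<lambda>x. frechet_derivative (\<lambda>x. f x \<bullet> b) (at x) v) (at p) w
      = frechet_derivative (\<lambda>x. df x v) (at p) w \<bullet> b" for v w
  proof -
    have "((\<lambda>x. df x v \<bullet> b) has_derivative (\<lambda>w. frechet_derivative (\<lambda>x. df x v) (at p) w \<bullet> b)) (at p)"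
      by (rule has_derivative_inner_left[OF smooth_on_has_derivative[OF sm assms(2)]])
    then have "((\<lambda>x. frechet_derivative (\<lambda>x. f x \<bullet> b) (at x) v) has_derivative
        (\<lambda>w. frechet_derivative (\<lambda>x. df x v) (at p) w \<bullet> b)) (at p)"
      by (rule has_derivative_transform_within_open[OF _ assms(1,2)]) (simp add: 1)
    then show ?thesis by (metis frechet_derivative_at)
  qed
  show "frechet_derivative (\<lambda>x. df x v) (at p) w \<bullet> b = frechet_derivative (\<lambda>x. df x w) (at p) v \<bullet> b"
    using symmetric_second_derivative_real[OF assms(1,2) smb, of v w] unfolding 2 .
qed

section \<open>Derivatives along tangent vectors\<close>

abbreviation deriv_within :: "'a::euclidean_space set \<Rightarrow> ('a \<Rightarrow> 'b::euclidean_space) \<Rightarrow> 'a \<Rightarrow> 'a \<Rightarrow> 'b"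
  where "deriv_within S f p \<equiv> frechet_derivative f (at p within S)"

text \<open>Derivatives within a thin set are not unique, and \<open>frechet_derivative\<close>
  merely selects one. Composition with a curve of velocity \<open>v\<close> reduces to the real
  line, where they are unique, so all choices agree on tangent vectors.\<close>

lemma has_derivative_tangent_unique:
  assumes "(f has_derivative f1) (at p within S)" "(f has_derivative f2) (at p within S)"
    and "v \<in> tangent_space S p"
  shows "f1 v = f2 v"
proof -
  obtain e :: real and \<gamma> where \<gamma>: "e > 0" "\<gamma> ` {-e<..<e} \<subseteq> S" "\<gamma> 0 = p"
    "(\<gamma> has_vector_derivative v) (at 0)"
    using assms(3) unfolding tangent_space_def by auto
  have *: "((\<lambda>t. f (\<gamma> t)) has_derivative (\<lambda>t. f' (t *\<^sub>R v))) (at 0)"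
    if "(f has_derivative f') (at p within S)" for f'
  proof -
    have "(\<gamma> has_derivative (\<lambda>t. t *\<^sub>R v)) (at 0 within {-e<..<e})"
      using \<gamma>(4) unfolding has_vector_derivative_def by (rule has_derivative_at_withinI)
    moreover have "(f has_derivative f') (at (\<gamma> 0) within \<gamma> ` {-e<..<e})"
      using has_derivative_subset[OF that \<gamma>(2)] \<gamma>(3) by simp
    ultimately have "((\<lambda>t. f (\<gamma> t)) has_derivative (\<lambda>t. f' (t *\<^sub>R v))) (at 0 within {-e<..<e})"
      by (rule has_derivative_in_compose)
    moreover have "at 0 within {-e<..<e} = at (0::real)"
      by (rule at_within_open) (use \<gamma>(1) in auto)
    ultimately show ?thesis by simp
  qed
  show ?thesis
    using has_derivative_unique[OF *[OF assms(1)] *[OF assms(2)]] by (metis scaleR_one)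
qed

lemma deriv_within_eq:
  assumes "(f has_derivative f') (at p within S)" "v \<in> tangent_space S p"
  shows "deriv_within S f p v = f' v"
  using assms has_derivative_tangent_unique frechet_derivative_works differentiable_def by metis

lemma smooth_mapE:
  assumes "smooth_map S f" "p \<in> S"
  obtains U F where "open U" "p \<in> U" "smooth_on U F" "\<And>x. x \<in> S \<Longrightarrow> x \<in> U \<Longrightarrow> F x = f x"
  using assms unfolding smooth_map_def by (meson IntI)

lemma smooth_mapI:
  assumes "\<And>p. p \<in> S \<Longrightarrow> \<exists>U F. open U \<and> p \<in> U \<and> smooth_on U F \<and> (\<forall>x\<in>S \<inter> U. F x = f x)"
  shows "smooth_map S f"
  using assms unfolding smooth_map_def by blast

lemma has_derivative_extension:
  assumes "open U" "p \<in> U" "p \<in> S" "(F has_derivative F') (at p)"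
    and "\<And>x. x \<in> S \<Longrightarrow> x \<in> U \<Longrightarrow> F x = f x"
  shows "(f has_derivative F') (at p within S)"
proof -
  obtain d where "d > 0" "ball p d \<subseteq> U" using assms(1,2) openE by blast
  then show ?thesis
    using has_derivative_transform_within[OF has_derivative_at_withinI[OF assms(4)], of d S f] assms(3,5)
    by (auto simp: dist_commute subset_iff)
qed

lemma deriv_within_extension:
  assumes "open U" "p \<in> U" "p \<in> S" "smooth_on U F"
    and "\<And>x. x \<in> S \<Longrightarrow> x \<in> U \<Longrightarrow> F x = f x" and "v \<in> tangent_space S p"
  shows "deriv_within S f p v = frechet_derivative F (at p) v"
  using deriv_within_eq[OF has_derivative_extension[OF assms(1-3) smooth_on_has_derivative[OF assms(4,2)] assms(5)] assms(6)] .

lemma smooth_map_has_derivative: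
  assumes "smooth_map S f" "p \<in> S"
  shows "(f has_derivative deriv_within S f p) (at p within S)"
proof -
  obtain U F where *: "open U" "p \<in> U" "smooth_on U F" "\<And>x. x \<in> S \<Longrightarrow> x \<in> U \<Longrightarrow> F x = f x"
    by (rule smooth_mapE[OF assms]) blast
  show ?thesis
    using has_derivative_extension[OF *(1,2) assms(2) smooth_on_has_derivative[OF *(3,2)] *(4)]
    by (metis frechet_derivative_works differentiable_def)
qed

section \<open>Calculus of smooth maps and their derivatives along a subset\<close>

lemma smooth_map_smooth_on: "smooth_on UNIV f \<Longrightarrow> smooth_map S f"
  by (rule smooth_mapI) (auto intro!: exI[of _ UNIV] exI[of _ f])

lemma smooth_map_const [intro]: "smooth_map S (\<lambda>q. a)"
  by (intro smooth_map_smooth_on smooth_on_const)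

lemma smooth_map_ident [intro]: "smooth_map S (\<lambda>q. q)"
  by (intro smooth_map_smooth_on smooth_on_ident)

lemma smooth_map_cong: "smooth_map S f \<Longrightarrow> (\<And>q. q \<in> S \<Longrightarrow> f q = g q) \<Longrightarrow> smooth_map S g"
proof (rule smooth_mapI)
  fix p assume *: "smooth_map S f" "\<And>q. q \<in> S \<Longrightarrow> f q = g q" "p \<in> S"
  then obtain U F where "open U" "p \<in> U" "smooth_on U F" "\<And>x. x \<in> S \<Longrightarrow> x \<in> U \<Longrightarrow> F x = f x"
    using smooth_mapE[of S f p] by blast
  with *(2) show "\<exists>U F. open U \<and> p \<in> U \<and> smooth_on U F \<and> (\<forall>x\<in>S \<inter> U. F x = g x)"
    by (intro exI[of _ U] exI[of _ F]) auto
qed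

lemma smooth_map_linear:
  assumes "bounded_linear l" "smooth_map S f"
  shows "smooth_map S (\<lambda>q. l (f q))"
proof (rule smooth_mapI)
  fix p assume "p \<in> S"
  then obtain U F where "open U" "p \<in> U" "smooth_on U F" "\<And>x. x \<in> S \<Longrightarrow> x \<in> U \<Longrightarrow> F x = f x"
    using smooth_mapE[OF assms(2)] by blast
  then show "\<exists>U F. open U \<and> p \<in> U \<and> smooth_on U F \<and> (\<forall>x\<in>S \<inter> U. F x = l (f x))"
    by (intro exI[of _ U] exI[of _ "\<lambda>q. l (F q)"]) (auto intro: smooth_on_linear assms)
qed

lemma smooth_map_bilinear:
  assumes "bounded_bilinear b" "smooth_map S f" "smooth_map S g"
  shows "smooth_map S (\<lambda>q. b (f q) (g q))"
proof (rule smooth_mapI)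
  fix p assume p: "p \<in> S"
  obtain U F where *: "open U" "p \<in> U" "smooth_on U F" "\<And>x. x \<in> S \<Longrightarrow> x \<in> U \<Longrightarrow> F x = f x"
    using smooth_mapE[OF assms(2) p] by blast
  obtain V G where "open V" "p \<in> V" "smooth_on V G" "\<And>x. x \<in> S \<Longrightarrow> x \<in> V \<Longrightarrow> G x = g x"
    using smooth_mapE[OF assms(3) p] by blast
  with * show "\<exists>U F. open U \<and> p \<in> U \<and> smooth_on U F \<and> (\<forall>x\<in>S \<inter> U. F x = b (f x) (g x))"
    by (intro exI[of _ "U \<inter> V"] exI[of _ "\<lambda>q. b (F q) (G q)"])
      (auto intro!: smooth_on_bilinear[OF assms(1)] intro: smooth_on_subset)
qed

lemma smooth_map_scaleR [intro]:
  "smooth_map S f \<Longrightarrow> smooth_map S g \<Longrightarrow> smooth_map S (\<lambda>q. f q *\<^sub>R g q)"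
  by (rule smooth_map_bilinear[OF bounded_bilinear_scaleR])

lemma smooth_map_mult [intro]:
  fixes f g :: "_ \<Rightarrow> real"
  shows "smooth_map S f \<Longrightarrow> smooth_map S g \<Longrightarrow> smooth_map S (\<lambda>q. f q * g q)"
  by (rule smooth_map_bilinear[OF bounded_bilinear_mult])

lemma smooth_map_add [intro]:
  assumes "smooth_map S f" "smooth_map S g"
  shows "smooth_map S (\<lambda>q. f q + g q)"
proof (rule smooth_mapI)
  fix p assume p: "p \<in> S"
  obtain U F where *: "open U" "p \<in> U" "smooth_on U F" "\<And>x. x \<in> S \<Longrightarrow> x \<in> U \<Longrightarrow> F x = f x"
    using smooth_mapE[OF assms(1) p] by blast
  obtain V G where "open V" "p \<in> V" "smooth_on V G" "\<And>x. x \<in> S \<Longrightarrow> x \<in> V \<Longrightarrow> G x = g x"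
    using smooth_mapE[OF assms(2) p] by blast
  with * show "\<exists>U F. open U \<and> p \<in> U \<and> smooth_on U F \<and> (\<forall>x\<in>S \<inter> U. F x = f x + g x)"
    by (intro exI[of _ "U \<inter> V"] exI[of _ "\<lambda>q. F q + G q"])
      (auto intro!: smooth_on_add intro: smooth_on_subset)
qed

lemma smooth_map_minus [intro]: "smooth_map S f \<Longrightarrow> smooth_map S (\<lambda>q. - f q)"
  by (rule smooth_map_linear[OF bounded_linear_minus[OF bounded_linear_ident]])

lemma smooth_map_diff [intro]:
  "smooth_map S f \<Longrightarrow> smooth_map S g \<Longrightarrow> smooth_map S (\<lambda>q. f q - g q)"
  using smooth_map_add[OF _ smooth_map_minus, of S f g] by simp

lemma smooth_map_sum:
  "(\<And>i. i \<in> I \<Longrightarrow> smooth_map S (f i)) \<Longrightarrow> smooth_map S (\<lambda>q. \<Sum>i\<in>I. f i q)"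
  by (induction I rule: infinite_finite_induct) (auto intro!: smooth_map_const smooth_map_add)

lemma smooth_map_continuous_on:
  assumes "smooth_map S f"
  shows "continuous_on S f"
  unfolding continuous_on_eq_continuous_within
  using has_derivative_continuous[OF smooth_map_has_derivative[OF assms]] by blast

lemma deriv_within_const: "v \<in> tangent_space S p \<Longrightarrow> deriv_within S (\<lambda>q. a) p v = 0"
  by (subst deriv_within_eq[OF has_derivative_const]) auto

lemma deriv_within_ident: "v \<in> tangent_space S p \<Longrightarrow> deriv_within S (\<lambda>q. q) p v = v"
  by (subst deriv_within_eq[OF has_derivative_ident]) auto

lemma deriv_within_bilinear:
  assumes "bounded_bilinear b" "smooth_map S f" "smooth_map S g" "p \<in> S" "v \<in> tangent_space S p"
  shows "deriv_within S (\<lambda>q. b (f q) (g q)) p v =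
    b (f p) (deriv_within S g p v) + b (deriv_within S f p v) (g p)"
  by (rule deriv_within_eq[OF bounded_bilinear.FDERIV[OF assms(1)], OF smooth_map_has_derivative smooth_map_has_derivative])
    (use assms in auto)

lemma deriv_within_linear:
  assumes "bounded_linear l" "smooth_map S f" "p \<in> S" "v \<in> tangent_space S p"
  shows "deriv_within S (\<lambda>q. l (f q)) p v = l (deriv_within S f p v)"
  by (rule deriv_within_eq[OF bounded_linear.has_derivative[OF assms(1)], OF smooth_map_has_derivative])
    (use assms in auto)

lemma deriv_within_add:
  assumes "smooth_map S f" "smooth_map S g" "p \<in> S" "v \<in> tangent_space S p"
  shows "deriv_within S (\<lambda>q. f q + g q) p v = deriv_within S f p v + deriv_within S g p v"
  by (rule deriv_within_eq[OF has_derivative_add, OF smooth_map_has_derivative smooth_map_has_derivative])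
    (use assms in auto)

lemma deriv_within_diff:
  assumes "smooth_map S f" "smooth_map S g" "p \<in> S" "v \<in> tangent_space S p"
  shows "deriv_within S (\<lambda>q. f q - g q) p v = deriv_within S f p v - deriv_within S g p v"
  by (rule deriv_within_eq[OF has_derivative_diff, OF smooth_map_has_derivative smooth_map_has_derivative])
    (use assms in auto)

lemma deriv_within_minus:
  assumes "smooth_map S f" "p \<in> S" "v \<in> tangent_space S p"
  shows "deriv_within S (\<lambda>q. - f q) p v = - deriv_within S f p v"
  by (rule deriv_within_eq[OF has_derivative_minus, OF smooth_map_has_derivative])
    (use assms in auto)

lemma deriv_within_sum:
  assumes "\<And>i. i \<in> I \<Longrightarrow> smooth_map S (f i)" "p \<in> S" "v \<in> tangent_space S p"
  shows "deriv_within S (\<lambda>q. \<Sum>i\<in>I. f i q) p v = (\<Sum>i\<in>I. deriv_within S (f i) p v)"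
  by (rule deriv_within_eq[OF has_derivative_sum, OF smooth_map_has_derivative])
    (use assms in auto)

lemma deriv_within_local_cong:
  assumes "smooth_map S f" "p \<in> S" "v \<in> tangent_space S p" "open U" "p \<in> U"
    "\<And>q. q \<in> S \<Longrightarrow> q \<in> U \<Longrightarrow> f q = g q"
  shows "deriv_within S g p v = deriv_within S f p v"
proof -
  obtain d where "d > 0" "ball p d \<subseteq> U" using assms(4,5) openE by blast
  then show ?thesis
    by (intro deriv_within_eq[OF has_derivative_transform_within[OF smooth_map_has_derivative[OF assms(1,2)], of d]])
      (use assms in \<open>auto simp: dist_commute subset_iff\<close>)
qed

lemma deriv_within_cong:
  assumes "smooth_map S f" "p \<in> S" "v \<in> tangent_space S p" "\<And>q. q \<in> S \<Longrightarrow> f q = g q"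
  shows "deriv_within S g p v = deriv_within S f p v"
  by (rule deriv_within_local_cong[of S f p v UNIV]) (use assms in auto)

lemma linear_deriv_within:
  "smooth_map S f \<Longrightarrow> p \<in> S \<Longrightarrow> linear (deriv_within S f p)"
  using smooth_map_has_derivative has_derivative_linear by blast

lemma vector_fieldsD: "X \<in> vector_fields S \<Longrightarrow> smooth_map S X"
  "X \<in> vector_fields S \<Longrightarrow> p \<in> S \<Longrightarrow> X p \<in> tangent_space S p"
  by (auto simp: vector_fields_def)

lemma smooth_map_deriv_within:
  assumes "smooth_map S f" "X \<in> vector_fields S"
  shows "smooth_map S (\<lambda>q. deriv_within S f q (X q))"
proof (rule smooth_mapI)
  fix p assume p: "p \<in> S"
  obtain U F where *: "open U" "p \<in> U" "smooth_on U F" "\<And>x. x \<in> S \<Longrightarrow> x \<in> U \<Longrightarrow> F x = f x"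
    using smooth_mapE[OF assms(1) p] by blast
  obtain V G where **: "open V" "p \<in> V" "smooth_on V G" "\<And>x. x \<in> S \<Longrightarrow> x \<in> V \<Longrightarrow> G x = X x"
    using smooth_mapE[OF vector_fieldsD(1)[OF assms(2)] p] by blast
  show "\<exists>U F. open U \<and> p \<in> U \<and> smooth_on U F \<and> (\<forall>x\<in>S \<inter> U. F x = deriv_within S f x (X x))"
  proof (intro exI[of _ "U \<inter> V"] exI[of _ "\<lambda>x. frechet_derivative F (at x) (G x)"] conjI ballI)
    show "smooth_on (U \<inter> V) (\<lambda>x. frechet_derivative F (at x) (G x))"
      using * ** by (intro smooth_on_frechet_derivative_field) (auto intro: smooth_on_subset)
    show "frechet_derivative F (at x) (G x) = deriv_within S f x (X x)" if "x \<in> S \<inter> (U \<inter> V)" for x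
    proof -
      have x: "x \<in> U" "x \<in> S" "x \<in> V" using that by auto
      show ?thesis
        using deriv_within_extension[OF *(1) x(1,2) *(3) *(4) vector_fieldsD(2)[OF assms(2) x(2)]]
          **(4)[OF x(2,3)] by simp
    qed
  qed (use * ** in auto)
qed

text \<open>On a smooth extension of \<open>f\<close> the second derivative is symmetric and
  cancels, which leaves the first derivative applied to the bracket. Tangency of the bracket is
  assumed because only then is \<open>deriv_within\<close> determined on it;
  \<open>lie_bracket_VF\<close> supplies it for hypersurfaces.\<close>

lemma deriv_within_commute:
  assumes f: "smooth_map S f" and X: "X \<in> vector_fields S" and Y: "Y \<in> vector_fields S" and p: "p \<in> S"
    and br: "lie_bracket S X Y p \<in> tangent_space S p"
  shows "deriv_within S (\<lambda>q. deriv_within S f q (Y q)) p (X p) -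
    deriv_within S (\<lambda>q. deriv_within S f q (X q)) p (Y p) = deriv_within S f p (lie_bracket S X Y p)"
proof -
  obtain U F where F: "open U" "p \<in> U" "smooth_on U F" "\<And>x. x \<in> S \<Longrightarrow> x \<in> U \<Longrightarrow> F x = f x"
    using smooth_mapE[OF f p] by blast
  define dF where "dF x = frechet_derivative F (at x)" for x
  have dFlin: "linear (dF x)" if "x \<in> U" for x
    using smooth_on_has_derivative[OF F(3) that] has_derivative_linear dF_def by metis
  \<comment> \<open>Product rule for the derivative of \<open>F\<close> evaluated on a field: once
    with the argument frozen at \<open>Y p\<close>, once with the field differentiated.\<close>
  have *: "deriv_within S (\<lambda>q. deriv_within S f q (Y q)) p v =
      frechet_derivative (\<lambda>x. dF x (Y p)) (at p) v + dF p (deriv_within S Y p v)"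
    if Y: "Y \<in> vector_fields S" and v: "v \<in> tangent_space S p" for Y v
  proof -
    obtain V G where G: "open V" "p \<in> V" "smooth_on V G" "\<And>x. x \<in> S \<Longrightarrow> x \<in> V \<Longrightarrow> G x = Y x"
      using smooth_mapE[OF vector_fieldsD(1)[OF Y] p] by blast
    have dFb: "smooth_on U (\<lambda>x. dF x b)" for b
      unfolding dF_def using smooth_on_frechet_derivative F by blast
    have exp: "dF x (G x) = (\<Sum>b\<in>Basis. (G x \<bullet> b) *\<^sub>R dF x b)" if "x \<in> U" for x
      using linear_basis_expansion dFlin that by blast
    have "((\<lambda>x. \<Sum>b\<in>Basis. (G x \<bullet> b) *\<^sub>R dF x b) has_derivative
       (\<lambda>w. \<Sum>b\<in>Basis. (G p \<bullet> b) *\<^sub>R frechet_derivative (\<lambda>x. dF x b) (at p) w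
          + (frechet_derivative G (at p) w \<bullet> b) *\<^sub>R dF p b)) (at p)"
      by (intro has_derivative_sum bounded_bilinear.FDERIV[OF bounded_bilinear_scaleR]
        has_derivative_inner_left smooth_on_has_derivative[OF G(3,2)] smooth_on_has_derivative[OF dFb F(2)])
    then have 1: "((\<lambda>q. deriv_within S f q (Y q)) has_derivative
       (\<lambda>w. \<Sum>b\<in>Basis. (G p \<bullet> b) *\<^sub>R frechet_derivative (\<lambda>x. dF x b) (at p) w
          + (frechet_derivative G (at p) w \<bullet> b) *\<^sub>R dF p b)) (at p within S)"
    proof (rule has_derivative_extension[of "U \<inter> V", rotated 3])
      show "(\<Sum>b\<in>Basis. (G x \<bullet> b) *\<^sub>R dF x b) = deriv_within S f x (Y x)" if "x \<in> S" "x \<in> U \<inter> V" for x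
      proof -
        have x: "x \<in> U" "x \<in> V" using that by auto
        show ?thesis
          using deriv_within_extension[OF F(1) x(1) that(1) F(3) F(4) vector_fieldsD(2)[OF Y that(1)]]
            G(4)[OF that(1) x(2)] exp[OF x(1)] by (simp add: dF_def)
      qed
    qed (use F G p in auto)
    have GY: "G p = Y p" using G p by auto
    have 2: "(\<Sum>b\<in>Basis. (Y p \<bullet> b) *\<^sub>R frechet_derivative (\<lambda>x. dF x b) (at p) v) =
        frechet_derivative (\<lambda>x. dF x (Y p)) (at p) v"
    proof -
      have "((\<lambda>x. \<Sum>b\<in>Basis. (Y p \<bullet> b) *\<^sub>R dF x b) has_derivative
        (\<lambda>w. \<Sum>b\<in>Basis. (Y p \<bullet> b) *\<^sub>R frechet_derivative (\<lambda>x. dF x b) (at p) w)) (at p)"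
        by (intro has_derivative_sum bounded_linear.has_derivative[OF bounded_linear_scaleR_right]
            smooth_on_has_derivative[OF dFb F(2)])
      then have "((\<lambda>x. dF x (Y p)) has_derivative
        (\<lambda>w. \<Sum>b\<in>Basis. (Y p \<bullet> b) *\<^sub>R frechet_derivative (\<lambda>x. dF x b) (at p) w)) (at p)"
        by (rule has_derivative_transform_within_open[OF _ F(1,2)])
          (rule linear_basis_expansion[OF dFlin, symmetric])
      from fun_cong[OF frechet_derivative_at[OF this], of v] show ?thesis .
    qed
    have "frechet_derivative G (at p) v = deriv_within S Y p v"
      using deriv_within_extension[OF G(1,2) p G(3,4) v] by simp
    then show ?thesis
      unfolding deriv_within_eq[OF 1 v] sum.distrib GY
      using 2 linear_basis_expansion[OF dFlin[OF F(2)], of "deriv_within S Y p v"] by simp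
  qed
  have "frechet_derivative (\<lambda>x. dF x (Y p)) (at p) (X p) = frechet_derivative (\<lambda>x. dF x (X p)) (at p) (Y p)"
    unfolding dF_def by (rule symmetric_second_derivative[OF F(1-3)])
  then have "deriv_within S (\<lambda>q. deriv_within S f q (Y q)) p (X p) -
    deriv_within S (\<lambda>q. deriv_within S f q (X q)) p (Y p) = dF p (lie_bracket S X Y p)"
    unfolding *[OF Y vector_fieldsD(2)[OF X p]] *[OF X vector_fieldsD(2)[OF Y p]]
    by (simp add: lie_bracket_def deriv_along_def linear_diff[OF dFlin[OF F(2)]])
  also have "\<dots> = deriv_within S f p (lie_bracket S X Y p)"
    using deriv_within_extension[OF F(1,2) p F(3,4) br] dF_def by simp
  finally show ?thesis .
qed

section \<open>Tangent spaces\<close>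

lemma tangent_space_mono: "S \<subseteq> S' \<Longrightarrow> tangent_space S p \<subseteq> tangent_space S' p"
  unfolding tangent_space_def by blast

lemma tangent_space_Int_open:
  assumes "open U" "p \<in> U"
  shows "tangent_space (S \<inter> U) p = tangent_space S p"
proof
  show "tangent_space S p \<subseteq> tangent_space (S \<inter> U) p"
  proof
    fix v assume "v \<in> tangent_space S p"
    then obtain e :: real and \<gamma> where \<gamma>: "e > 0" "smooth_on {-e<..<e} \<gamma>" "\<gamma> ` {-e<..<e} \<subseteq> S" "\<gamma> 0 = p"
      "(\<gamma> has_vector_derivative v) (at 0)"
      unfolding tangent_space_def by auto
    have "isCont \<gamma> 0" using \<gamma>(5) has_vector_derivative_continuous by blast
    then obtain d where d: "d > 0" "\<And>t. dist t 0 < d \<Longrightarrow> \<gamma> t \<in> U"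
      using assms \<gamma>(4) by (metis continuous_at_open[of 0 \<gamma>] open_dist)
    define e' where "e' = min d e"
    have sub: "{-e'<..<e'} \<subseteq> {-e<..<e}" and e': "e' > 0" and inU: "\<And>t. t \<in> {-e'<..<e'} \<Longrightarrow> \<gamma> t \<in> U"
      using \<gamma>(1) d by (auto simp: e'_def)
    have "\<gamma> ` {-e'<..<e'} \<subseteq> S \<inter> U" using inU \<gamma>(3) sub by blast
    then have "v \<in> tangent_space (S \<inter> U) p"
      unfolding tangent_space_def mem_Collect_eq using e' smooth_on_subset[OF \<gamma>(2) sub] \<gamma>(4,5) by blast
    then show "v \<in> tangent_space (S \<inter> U) p" .
  qed
qed (rule tangent_space_mono, blast)

lemma slice_chart:
  assumes "smooth_submanifold m S" "p \<in> S"
  obtains U V :: "'a::euclidean_space set" and f g :: "'a \<Rightarrow> 'a" and L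
    where "open U" "open V" "p \<in> U" "smooth_on U f" "smooth_on V g" "subspace L" "dim L = m"
      "f ` (U \<inter> S) = V \<inter> L" "f p \<in> V" "f p \<in> L" "\<And>x. x \<in> U \<Longrightarrow> g (f x) = x" "\<And>y. y \<in> V \<Longrightarrow> f (g y) = y"
      "\<And>y. y \<in> V \<Longrightarrow> y \<in> L \<Longrightarrow> g y \<in> S"
proof -
  obtain U V :: "'a set" and f g :: "'a \<Rightarrow> 'a" and L where UV: "open U" "open V" "p \<in> U" "homeomorphism U V f g"
    "smooth_on U f" "smooth_on V g" and L: "subspace L" "dim L = m" "f ` (U \<inter> S) = V \<inter> L"
    using assms(1)[unfolded smooth_submanifold_def, rule_format, OF assms(2)]
    by (elim exE conjE) (rule that)
  have gf: "g (f x) = x" if "x \<in> U" for x using UV(4) that by (simp add: homeomorphism_def)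
  have fg: "f (g y) = y" if "y \<in> V" for y using UV(4) that by (simp add: homeomorphism_def)
  have "g y \<in> S" if "y \<in> V" "y \<in> L" for y
  proof -
    have "y \<in> f ` (U \<inter> S)" using that L(3) by blast
    then show ?thesis using gf by auto
  qed
  moreover have "f p \<in> V" "f p \<in> L" using L(3) UV(3) assms(2) by auto
  ultimately show thesis using that UV L gf fg by blast
qed

text \<open>The inverse chart carries a straight segment of the slice to a curve in
  \<open>S\<close>.\<close>

lemma slice_tangent:
  assumes V: "open V" "smooth_on V g" and L: "subspace L" and gS: "\<And>y. y \<in> V \<Longrightarrow> y \<in> L \<Longrightarrow> g y \<in> S"
    and y: "y \<in> V" "y \<in> L" "l \<in> L"
  shows "frechet_derivative g (at y) l \<in> tangent_space S (g y)"
proof -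
  have g': "(g has_derivative frechet_derivative g (at y)) (at y)" by (rule smooth_on_has_derivative[OF V(2) y(1)])
  obtain d where d: "d > 0" "ball y d \<subseteq> V" using V(1) y(1) openE by blast
  \<comment> \<open>Keeps the segment inside the ball of radius \<open>d\<close>; the summand 1
    covers \<open>l = 0\<close>.\<close>
  define e where "e = d / (norm l + 1)"
  have n: "norm l + 1 > 0" by (simp add: add_nonneg_pos)
  then have e: "e > 0" unfolding e_def using d by simp
  have inV: "y + t *\<^sub>R l \<in> V" if "t \<in> {-e<..<e}" for t
  proof -
    have "norm (t *\<^sub>R l) \<le> \<bar>t\<bar> * (norm l + 1)" by (simp add: mult_left_mono)
    also have "\<dots> < e * (norm l + 1)" using that n by (intro mult_strict_right_mono) auto
    also have "\<dots> = d" unfolding e_def using n by simp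
    finally have "norm (t *\<^sub>R l) < d" .
    then show ?thesis using d(2) by (auto simp: dist_norm subset_iff)
  qed
  show ?thesis
    unfolding tangent_space_def mem_Collect_eq
  proof (intro exI[of _ e] conjI exI[of _ "\<lambda>t. g (y + t *\<^sub>R l)"])
    show "smooth_on {-e<..<e} (\<lambda>t. g (y + t *\<^sub>R l))"
      by (rule smooth_on_affine[OF V(2) bounded_linear_scaleR_left]) (use inV in auto)
    show "(\<lambda>t. g (y + t *\<^sub>R l)) ` {-e<..<e} \<subseteq> S"
      using gS[OF inV] y L by (auto simp: subspace_add subspace_scale)
    have "((\<lambda>t. y + t *\<^sub>R l) has_derivative (\<lambda>t. t *\<^sub>R l)) (at 0)"
      by (auto intro!: derivative_eq_intros)
    from has_derivative_compose[OF this, of g "frechet_derivative g (at y)"] g'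
    show "((\<lambda>t. g (y + t *\<^sub>R l)) has_vector_derivative frechet_derivative g (at y) l) (at 0)"
      using linear_cmul[OF has_derivative_linear[OF g']] unfolding has_vector_derivative_def by simp
  qed (use e in auto)
qed

text \<open>The tangent space is the image of the slice \<open>L\<close> under the derivative of the
  inverse chart. That derivative is injective because the derivative of the chart is a left inverse
  of it.\<close>

lemma tangent_space_submanifold:
  assumes "smooth_submanifold m S" "p \<in> S"
  shows "subspace (tangent_space S p)" "dim (tangent_space S p) = m"
proof -
  obtain U V :: "'a set" and f g :: "'a \<Rightarrow> 'a" and L where UV: "open U" "open V" "p \<in> U"
    "smooth_on U f" "smooth_on V g" and L: "subspace L" "dim L = m" "f ` (U \<inter> S) = V \<inter> L"
    and fpV: "f p \<in> V" and fpL: "f p \<in> L" and gf: "\<And>x. x \<in> U \<Longrightarrow> g (f x) = x" and fg: "\<And>y. y \<in> V \<Longrightarrow> f (g y) = y"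
    and gS: "\<And>y. y \<in> V \<Longrightarrow> y \<in> L \<Longrightarrow> g y \<in> S"
    using slice_chart[OF assms] by (metis (no_types, lifting))
  define f' where "f' = frechet_derivative f (at p)"
  define g' where "g' = frechet_derivative g (at (f p))"
  have f': "(f has_derivative f') (at p)" unfolding f'_def using smooth_on_has_derivative UV by blast
  have g': "(g has_derivative g') (at (f p))" unfolding g'_def using smooth_on_has_derivative UV fpV by blast
  have lin: "linear f'" "linear g'" using f' g' has_derivative_linear by blast+
  have "((\<lambda>y. f (g y)) has_derivative (\<lambda>y. f' (g' y))) (at (f p))"
    using has_derivative_compose[OF g', of f f'] f' gf[OF UV(3)] by simp
  then have "((\<lambda>y. y) has_derivative (\<lambda>y. f' (g' y))) (at (f p))"
    by (rule has_derivative_transform_within_open[OF _ UV(2) fpV]) (rule fg)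
  then have f'g': "f' (g' y) = y" for y
    using has_derivative_unique[OF has_derivative_ident] by metis
  have "tangent_space S p = g' ` L"
  proof (intro equalityI subsetI)
    fix v assume "v \<in> tangent_space S p"
    then have "v \<in> tangent_space (S \<inter> U) p" using tangent_space_Int_open UV by blast
    then obtain e :: real and \<gamma> where \<gamma>: "e > 0" "\<gamma> ` {-e<..<e} \<subseteq> S \<inter> U" "\<gamma> 0 = p"
      "(\<gamma> has_vector_derivative v) (at 0)"
      unfolding tangent_space_def by auto
    have 1: "((\<lambda>t. f (\<gamma> t)) has_vector_derivative f' v) (at 0)"
      using has_derivative_compose[of \<gamma> "\<lambda>t. t *\<^sub>R v" 0 UNIV f f'] \<gamma>(3,4) f' linear_cmul[OF lin(1)]
      unfolding has_vector_derivative_def by simp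
    have fL: "f (\<gamma> t) \<in> V \<inter> L" if "t \<in> {-e<..<e}" for t using L(3) \<gamma>(2) that by blast
    \<comment> \<open>A curve inside \<open>L\<close> has constant inner product 0 with every normal
      of \<open>L\<close>, so its velocity lies in the double orthogonal complement, which is
      \<open>L\<close>.\<close>
    have "f' v \<bullet> w = 0" if w: "w \<in> L\<^sup>\<bottom>" for w
    proof -
      have "((\<lambda>t. f (\<gamma> t) \<bullet> w) has_derivative (\<lambda>t. (t *\<^sub>R f' v) \<bullet> w)) (at 0)"
        using 1 unfolding has_vector_derivative_def by (rule has_derivative_inner_left)
      then have "((\<lambda>t. 0) has_derivative (\<lambda>t. (t *\<^sub>R f' v) \<bullet> w)) (at 0)"
        by (rule has_derivative_transform_within_open[of _ _ _ _ "{-e<..<e}"])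
          (use \<gamma>(1) fL w in \<open>auto simp: orthogonal_comp_def orthogonal_def\<close>)
      from fun_cong[OF has_derivative_unique[OF this has_derivative_const], of 1]
      show ?thesis by simp
    qed
    then have "f' v \<in> L\<^sup>\<bottom>\<^sup>\<bottom>"
      by (auto simp: orthogonal_comp_def orthogonal_def inner_commute)
    then have "f' v \<in> L" using orthogonal_comp_self[OF L(1)] by simp
    moreover have "g' (f' v) = v"
    proof -
      have "((\<lambda>t. g (f (\<gamma> t))) has_vector_derivative g' (f' v)) (at 0)"
        using has_derivative_compose[of "\<lambda>t. f (\<gamma> t)" "\<lambda>t. t *\<^sub>R f' v" 0 UNIV g g'] 1 \<gamma>(3) g' linear_cmul[OF lin(2)]
        unfolding has_vector_derivative_def by simp
      then have "(\<gamma> has_vector_derivative g' (f' v)) (at 0)"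
        unfolding has_vector_derivative_def
      proof (rule has_derivative_transform_within_open[of _ _ _ _ "{-e<..<e}"])
        show "g (f (\<gamma> t)) = \<gamma> t" if "t \<in> {-e<..<e}" for t
          using gf \<gamma>(2) that by blast
      qed (use \<gamma>(1) in auto)
      then show ?thesis using \<gamma>(4) vector_derivative_unique_at by blast
    qed
    ultimately show "v \<in> g' ` L" by (metis imageI)
  next
    fix v assume "v \<in> g' ` L"
    then show "v \<in> tangent_space S p"
      using slice_tangent[OF UV(2,5) L(1) gS fpV fpL] gf[OF UV(3)] unfolding g'_def by auto
  qed
  moreover have "inj g'" using f'g' by (metis injI)
  ultimately show "subspace (tangent_space S p)" "dim (tangent_space S p) = m"
    using L lin(2) by (auto simp: linear_subspace_image dim_image_eq inj_on_subset)
qed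

text \<open>Along images of straight segments of a slice the function has zero derivative, so it is
  locally constant; connectedness makes it constant. It is applied to \<alpha> in
  \<open>identity_of_eta_umbilical\<close>.\<close>

lemma smooth_map_zero_derivative_constant:
  fixes f :: "'a::euclidean_space \<Rightarrow> real"
  assumes S: "smooth_submanifold m S" "connected S" and f: "smooth_map S f"
    and zero: "\<And>p v. p \<in> S \<Longrightarrow> v \<in> tangent_space S p \<Longrightarrow> deriv_within S f p v = 0"
    and ab: "a \<in> S" "b \<in> S"
  shows "f a = f b"
proof (rule connected_local_const[OF S(2) ab], rule ballI)
  fix p assume p: "p \<in> S"
  obtain U V :: "'a set" and \<phi> \<psi> :: "'a \<Rightarrow> 'a" and L where UV: "open U" "open V" "p \<in> U"
    "smooth_on U \<phi>" "smooth_on V \<psi>" and L: "subspace L" "\<phi> ` (U \<inter> S) = V \<inter> L"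
    and pV: "\<phi> p \<in> V" and pL: "\<phi> p \<in> L" and inv: "\<And>x. x \<in> U \<Longrightarrow> \<psi> (\<phi> x) = x"
    and \<psi>S: "\<And>y. y \<in> V \<Longrightarrow> y \<in> L \<Longrightarrow> \<psi> y \<in> S"
    using slice_chart[OF S(1) p] by (metis (no_types, lifting))
  obtain d where d: "d > 0" "ball (\<phi> p) d \<subseteq> V" using UV(2) pV openE by blast
  have const: "f (\<psi> y) = f p" if y: "y \<in> ball (\<phi> p) d" "y \<in> L" for y
  proof -
    define l where "l = y - \<phi> p"
    have l: "l \<in> L" unfolding l_def using y(2) pL L(1) by (simp add: subspace_diff)
    define c where "c t = \<phi> p + t *\<^sub>R l" for t
    have c: "c t \<in> V" "c t \<in> L" if t: "t \<in> {0..1}" for t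
    proof -
      have "norm (t *\<^sub>R l) \<le> norm l" using t by (simp add: mult_left_le_one_le)
      then have "c t \<in> ball (\<phi> p) d" using y(1) unfolding c_def l_def by (simp add: dist_norm norm_minus_commute)
      then show "c t \<in> V" using d(2) by blast
      show "c t \<in> L" unfolding c_def using l pL L(1) by (simp add: subspace_add subspace_scale)
    qed
    have "((\<lambda>t. f (\<psi> (c t))) has_derivative (\<lambda>h. 0)) (at t within {0..1})" if t: "t \<in> {0..1}" for t
    proof -
      define v where "v = frechet_derivative \<psi> (at (c t)) l"
      note d\<psi> = smooth_on_has_derivative[OF UV(5) c(1)[OF t]]
      have "(c has_derivative (\<lambda>h. h *\<^sub>R l)) (at t)"
        unfolding c_def[abs_def] by (auto intro!: derivative_eq_intros)
      from has_derivative_compose[OF this d\<psi>]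
      have d\<gamma>: "((\<lambda>t. \<psi> (c t)) has_derivative (\<lambda>h. h *\<^sub>R v)) (at t)"
        unfolding v_def by (simp add: linear_cmul[OF has_derivative_linear[OF d\<psi>]])
      note tS = \<psi>S[OF c[OF t]]
      have "v \<in> tangent_space S (\<psi> (c t))"
        unfolding v_def by (rule slice_tangent[OF UV(2,5) L(1) \<psi>S c[OF t] l])
      then have z: "deriv_within S f (\<psi> (c t)) (h *\<^sub>R v) = 0" for h
        using zero[OF tS] linear_cmul[OF linear_deriv_within[OF f tS]] by simp
      have "(f has_derivative deriv_within S f (\<psi> (c t))) (at (\<psi> (c t)) within (\<lambda>t. \<psi> (c t)) ` {0..1})"
        by (rule has_derivative_subset[OF smooth_map_has_derivative[OF f tS]]) (use \<psi>S c in auto)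
      from has_derivative_in_compose[OF has_derivative_at_withinI[OF d\<gamma>] this]
      show ?thesis by (simp add: z)
    qed
    then have "f (\<psi> (c 1)) = f (\<psi> (c 0))"
      using has_derivative_zero_unique[of "{0..1::real}" "\<lambda>t. f (\<psi> (c t))" 0 1] by simp
    then show ?thesis unfolding c_def l_def using inv[OF UV(3)] by simp
  qed
  have "open (U \<inter> \<phi> -` ball (\<phi> p) d)"
    by (rule continuous_open_preimage[OF smooth_on_continuous_on[OF UV(4)] UV(1) open_ball])
  moreover have "p \<in> U \<inter> \<phi> -` ball (\<phi> p) d" using UV(3) d(1) by simp
  ultimately have "\<forall>\<^sub>F q in at p within S. q \<in> U \<inter> \<phi> -` ball (\<phi> p) d \<and> q \<in> S"
    unfolding eventually_at_topological by blast
  then show "\<forall>\<^sub>F q in at p within S. f p = f q"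
  proof eventually_elim
    fix q assume q: "q \<in> U \<inter> \<phi> -` ball (\<phi> p) d \<and> q \<in> S"
    then have "\<phi> q \<in> L" using L(2) by blast
    then show "f p = f q" using const[of "\<phi> q"] q inv[of q] by simp
  qed
qed

section \<open>The Levi-Civita connection of a submanifold\<close>

text \<open>The difference of \<open>D\<close> and the flat derivative, tested against tangent
  fields, is symmetric in its first two arguments because both have the Lie bracket as torsion term,
  and skew in the last two because both are compatible with the constant form \<open>B\<close>. Such
  a trilinear expression vanishes. The projection \<open>pr\<close> is abstract so that the result
  serves the hypersurface and the ambient space form alike.\<close>

lemma levi_civita_unique:
  fixes S :: "'a::euclidean_space set" and pr :: "'a \<Rightarrow> 'a \<Rightarrow> 'a"
  assumes lc: "levi_civita S B D" and B: "bounded_bilinear B" and sym: "\<And>x y. B x y = B y x"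
    and sub: "\<And>q. q \<in> S \<Longrightarrow> subspace (tangent_space S q)"
    and pr_in: "\<And>q w. q \<in> S \<Longrightarrow> pr q w \<in> tangent_space S q"
    and pr_B: "\<And>q w x. q \<in> S \<Longrightarrow> x \<in> tangent_space S q \<Longrightarrow> B (pr q w) x = B w x"
    and pr_sm: "\<And>w. smooth_map S (\<lambda>q. pr q w)"
    and nd: "\<And>q x. q \<in> S \<Longrightarrow> x \<in> tangent_space S q \<Longrightarrow> (\<And>y. y \<in> tangent_space S q \<Longrightarrow> B x y = 0) \<Longrightarrow> x = 0"
    and X: "X \<in> vector_fields S" and Y: "Y \<in> vector_fields S" and p: "p \<in> S"
  shows "D X Y p = pr p (deriv_within S Y p (X p))"
proof -
  interpret B: bounded_bilinear B by (rule B)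
  note lc' = lc[unfolded levi_civita_def, rule_format, OF open_UNIV, unfolded Int_UNIV_right]
  have con: "D X Y \<in> vector_fields S" if "X \<in> vector_fields S" "Y \<in> vector_fields S" for X Y
    using lc' that unfolding connection_on_def by blast
  have tor: "D X Y p - D Y X p = lie_bracket S X Y p" if "X \<in> vector_fields S" "Y \<in> vector_fields S" for X Y
    using lc' that p by blast
  have met: "deriv_along S X (\<lambda>q. B (Y q) (Z q)) p = B (D X Y p) (Z p) + B (Y p) (D X Z p)"
    if "X \<in> vector_fields S" "Y \<in> vector_fields S" "Z \<in> vector_fields S" for X Y Z
    using lc' that p by blast
  define t where "t X Y Z = B (D X Y p - deriv_within S Y p (X p)) (Z p)" for X Y Z
  have t1: "t X Y Z = t Y X Z" if "X \<in> vector_fields S" "Y \<in> vector_fields S" "Z \<in> vector_fields S" for X Y Z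
  proof -
    have "D X Y p - deriv_within S Y p (X p) = D Y X p - deriv_within S X p (Y p)"
      using tor[OF that(1,2)] unfolding lie_bracket_def deriv_along_def by (simp add: algebra_simps)
    then show ?thesis unfolding t_def by simp
  qed
  have t2: "t X Y Z = - t X Z Y" if "X \<in> vector_fields S" "Y \<in> vector_fields S" "Z \<in> vector_fields S" for X Y Z
    using met[OF that] that p deriv_within_bilinear[OF B, of S Y Z p "X p"] sym[of "Z p"] sym[of "D X Z p"]
      sym[of "deriv_within S Z p (X p)"]
    unfolding t_def deriv_along_def
    by (simp add: vector_fieldsD B.diff_left)
  \<comment> \<open>Three symmetric and three skew transpositions lead from \<open>t X Y Z\<close>
    back to itself with the opposite sign.\<close>
  have t0: "t X Y Z = 0" if "Z \<in> vector_fields S" for Z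
    using t1[OF X Y that] t2[OF Y X that] t1[OF Y that X] t2[OF that Y X] t1[OF that X Y] t2[OF X that Y]
    by simp
  have "D X Y p - pr p (deriv_within S Y p (X p)) = 0"
  proof (rule nd[OF p])
    show "D X Y p - pr p (deriv_within S Y p (X p)) \<in> tangent_space S p"
      using vector_fieldsD(2)[OF con[OF X Y] p] pr_in[OF p] sub[OF p] by (simp add: subspace_diff)
    fix z assume z: "z \<in> tangent_space S p"
    have "(\<lambda>q. pr q z) \<in> vector_fields S" using pr_in pr_sm by (simp add: vector_fields_def)
    from t0[OF this] have "B (D X Y p - deriv_within S Y p (X p)) (pr p z) = 0" by (simp add: t_def)
    moreover have "pr p z - z = 0"
      by (rule nd[OF p]) (use z pr_in[OF p] sub[OF p] pr_B[OF p] in \<open>auto simp: subspace_diff B.diff_left\<close>)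
    ultimately show "B (D X Y p - pr p (deriv_within S Y p (X p))) z = 0"
      using pr_B[OF p z] by (simp add: B.diff_left)
  qed
  then show ?thesis by simp
qed

text \<open>The extensions in \<open>shape_operator\<close> exist only over open subsets, so
  uniqueness has to be available there.\<close>

lemma levi_civita_Int_open:
  assumes "levi_civita S B D" "open U" shows "levi_civita (S \<inter> U) B D"
  unfolding levi_civita_def
proof (intro allI impI)
  fix U' :: "'a set" assume "open U'"
  then have "open (U \<inter> U')" using assms by auto
  with assms(1) show "connection_on (S \<inter> U \<inter> U') D \<and>
        (\<forall>X\<in>vector_fields (S \<inter> U \<inter> U'). \<forall>Y\<in>vector_fields (S \<inter> U \<inter> U'). \<forall>p\<in>S \<inter> U \<inter> U'.
           D X Y p - D Y X p = lie_bracket (S \<inter> U \<inter> U') X Y p) \<and>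
        (\<forall>X\<in>vector_fields (S \<inter> U \<inter> U'). \<forall>Y\<in>vector_fields (S \<inter> U \<inter> U'). \<forall>Z\<in>vector_fields (S \<inter> U \<inter> U').
           \<forall>p\<in>S \<inter> U \<inter> U'.
           deriv_along (S \<inter> U \<inter> U') X (\<lambda>q. B (Y q) (Z q)) p = B (D X Y p) (Z p) + B (Y p) (D X Z p))"
    unfolding levi_civita_def Int_assoc by blast
qed

section \<open>Matrix description of the space forms\<close>

definition csm :: "complex \<Rightarrow> 'n::finite cmat \<Rightarrow> 'n cmat" where
  "csm z X = (\<chi> a b. z * X $ a $ b)"

lemma csm_simps:
  "csm z (X + Y) = csm z X + csm z Y" "csm z (X - Y) = csm z X - csm z Y" "csm z (- X) = - csm z X"
  "csm z X ** Y = csm z (X ** Y)" "X ** csm z Y = csm z (X ** Y)" "csm z (csm w X) = csm (z * w) X"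
  "csm (-1) X = - X" "csm 1 X = X" "csm 0 X = 0" "csm z 0 = 0"
  "csm (of_real r) X = r *\<^sub>R X" "csm z (r *\<^sub>R X) = r *\<^sub>R csm z X" "trace (csm z X) = z * trace X"
  unfolding csm_def matrix_matrix_mult_def trace_def vec_eq_iff
  by (auto simp: algebra_simps sum_distrib_left scaleR_conv_of_real[where 'a=complex])

lemma matrix_mult_add: "(X + X') ** Y = X ** Y + X' ** Y" "Y ** (X + X') = Y ** X + Y ** X'"
  for X Y :: "complex ^ 'm::finite ^ 'm"
  by (simp_all add: matrix_matrix_mult_def vec_eq_iff sum.distrib algebra_simps)

lemma matrix_mult_minus: "(- X) ** Y = - (X ** Y)" "X ** (- Y) = - (X ** Y)"
  for X Y :: "complex ^ 'm::finite ^ 'm"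
  by (simp_all add: matrix_matrix_mult_def vec_eq_iff sum_negf)

lemma matrix_mult_diff: "(X - X') ** Y = X ** Y - X' ** Y" "Y ** (X - X') = Y ** X - Y ** X'"
  for X Y :: "complex ^ 'm::finite ^ 'm"
  by (simp_all add: matrix_matrix_mult_def vec_eq_iff sum_subtractf algebra_simps)

lemma matrix_mult_scaleR: "(r *\<^sub>R X) ** Y = r *\<^sub>R (X ** Y)" "X ** (r *\<^sub>R Y) = r *\<^sub>R (X ** Y)"
  for X Y :: "complex ^ 'm::finite ^ 'm"
  by (simp_all add: matrix_matrix_mult_def vec_eq_iff scaleR_sum_right)

lemma matrix_mult_0: "0 ** X = 0" "X ** 0 = 0" for X :: "complex ^ 'm::finite ^ 'm"
  by (simp_all add: matrix_matrix_mult_def vec_eq_iff)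

text \<open>Collecting equal summands produces \<open>2 * X\<close>, an entrywise product with a
  constant matrix; this turns it back into a real multiple.\<close>

lemma numeral_mult_scaleR: "numeral k * X = numeral k *\<^sub>R X" for X :: "complex ^ 'm::finite ^ 'm"
  by (simp add: scaleR_conv_of_real)

lemma matrix_mult_numeral: "(numeral k * X) ** Y = numeral k * (X ** Y)" "X ** (numeral k * Y) = numeral k * (X ** Y)"
  for X Y :: "complex ^ 'm::finite ^ 'm"
  unfolding numeral_mult_scaleR by (rule matrix_mult_scaleR)+

lemma csm_numeral: "csm z (numeral k * X) = numeral k * csm z X"
  unfolding numeral_mult_scaleR by (rule csm_simps)

lemmas mat_simps = matrix_mult_numeral csm_numeral matrix_mult_add matrix_mult_diff
  matrix_mult_minus matrix_mult_scaleR matrix_mult_0 matrix_mul_assoc[symmetric]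

lemma bounded_bilinear_matrix_mult:
  "bounded_bilinear ((**) :: complex ^ 'm::finite ^ 'm \<Rightarrow> complex ^ 'm ^ 'm \<Rightarrow> complex ^ 'm ^ 'm)"
  unfolding bilinear_conv_bounded_bilinear[symmetric] bilinear_def
  by (auto intro!: linearI simp: mat_simps)

lemma trace_simps: "trace (X + Y) = trace X + trace Y" "trace (X - Y) = trace X - trace Y"
  "trace (- X) = - trace X" "trace (r *\<^sub>R X) = r *\<^sub>R trace X" "trace 0 = 0"
  "trace (numeral k * X) = numeral k * trace X"
  for X Y :: "complex ^ 'm::finite ^ 'm"
  unfolding numeral_mult_scaleR
  by (simp_all add: trace_def sum.distrib sum_subtractf sum_negf scaleR_sum_right sum_distrib_left scaleR_conv_of_real[where 'a=complex])

lemma trace_rotate: "trace (X ** (Y ** Z)) = trace (Y ** (Z ** X))"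
  for X Y Z :: "complex ^ 'm::finite ^ 'm"
  using trace_mul_sym[of X "Y ** Z"] by (simp add: matrix_mul_assoc[symmetric])

lemma bounded_bilinear_csf_metric: "bounded_bilinear (csf_metric c)"
  unfolding bilinear_conv_bounded_bilinear[symmetric] bilinear_def csf_metric_def
  by (intro conjI allI linearI; simp only: mat_simps trace_simps) (auto simp: algebra_simps)

lemma csf_metric_sym: "csf_metric c X Y = csf_metric c Y X"
  unfolding csf_metric_def by (simp only: trace_mul_sym[of X Y])

text \<open>For c = 1 or c = -1 this is the adjoint with respect to the Hermitian form
  \<open>herm c\<close>.\<close>

definition sadj :: "real \<Rightarrow> 'n::finite cmat \<Rightarrow> 'n cmat" where
  "sadj c X = (\<chi> a b. signature c a * cnj (X $ b $ a) * signature c b)"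

text \<open>The equations obtained by differentiating \<open>sadj c P = P\<close> and \<open>P ** P = P\<close>.\<close>

definition csf_tangent :: "real \<Rightarrow> 'n::finite cmat \<Rightarrow> 'n cmat set" where
  "csf_tangent c P = {X. sadj c X = X \<and> P ** X + X ** P = X}"

text \<open>The orthogonal projection onto \<open>csf_tangent c P\<close>; symmetrising \<open>W\<close> first makes it total.\<close>

definition csf_proj :: "real \<Rightarrow> 'n::finite cmat \<Rightarrow> 'n cmat \<Rightarrow> 'n cmat" where
  "csf_proj c P W = (let H = (1 / 2) *\<^sub>R (W + sadj c W) in P ** H + H ** P - (P ** (H ** P) + P ** (H ** P)))"

section \<open>Points, tangent matrices, projection and complex structure of the space form\<close>

locale csf =
  fixes c :: real
  assumes c: "c = 1 \<or> c = -1"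
begin

lemma cc: "c * c = 1" "complex_of_real c * complex_of_real c = 1" "c * (c * x) = x"
  "complex_of_real c * (complex_of_real c * z) = z"
  using c by auto

lemma sig: "signature c a * signature c a = 1" "cnj (signature c a) = signature c a"
  "signature c a * (signature c a * z) = z"
  using c by (auto simp: signature_def)

lemma sadj_simps: "sadj c (X + Y) = sadj c X + sadj c Y" "sadj c (X - Y) = sadj c X - sadj c Y"
  "sadj c (- X) = - sadj c X" "sadj c (r *\<^sub>R X) = r *\<^sub>R sadj c X" "sadj c (csm z X) = csm (cnj z) (sadj c X)"
  "sadj c (sadj c X) = X" "trace (sadj c X) = cnj (trace X)"
  unfolding sadj_def csm_def trace_def vec_eq_iff
  by (auto simp: algebra_simps sig cnj_sum)

lemma sadj_numeral: "sadj c (numeral k * X) = numeral k * sadj c X"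
  unfolding numeral_mult_scaleR by (rule sadj_simps)

lemma sadj_mult: "sadj c (X ** Y) = sadj c Y ** sadj c X"
  unfolding sadj_def matrix_matrix_mult_def vec_eq_iff
  by (auto simp: algebra_simps sig cnj_sum sum_distrib_left intro!: sum.cong)

lemma linear_sadj: "linear (sadj c)" by (rule linearI) (simp_all add: sadj_simps)

lemma hopf_point:
  assumes "P \<in> complex_space_form c"
  obtains z where "P = hopf_map c z" "herm c z z = of_real c"
  using assms unfolding complex_space_form_def by blast

text \<open>The points of the model are self-adjoint projections of rank one. The third equation
  expresses the rank and is what later reduces products of matrices to scalars.\<close>

lemma hopf_facts:
  assumes "herm c z z = of_real c"
  shows "hopf_map c z ** hopf_map c z = hopf_map c z" "sadj c (hopf_map c z) = hopf_map c z"
    "hopf_map c z ** (X ** hopf_map c z) = csm (trace (hopf_map c z ** X)) (hopf_map c z)"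
    "hopf_map c z *v w = (\<chi> a. of_real c * herm c w z * z $ a)"
proof -
  have "(hopf_map c z ** hopf_map c z) $ a $ b = of_real c * of_real c * (z $ a * signature c b * cnj (z $ b)) * herm c z z"
    for a b
    unfolding hopf_map_def matrix_matrix_mult_def herm_def
    by (simp add: sum_distrib_left algebra_simps)
  then show "hopf_map c z ** hopf_map c z = hopf_map c z"
    unfolding assms by (simp add: vec_eq_iff hopf_map_def cc algebra_simps)
  show "sadj c (hopf_map c z) = hopf_map c z"
    by (simp add: vec_eq_iff hopf_map_def sadj_def sig algebra_simps)
  show "hopf_map c z *v w = (\<chi> a. of_real c * herm c w z * z $ a)"
    by (simp add: vec_eq_iff hopf_map_def matrix_vector_mult_def herm_def sum_distrib_left sum_distrib_right algebra_simps)
  have "(hopf_map c z ** (X ** hopf_map c z)) $ a $ b = (\<Sum>e\<in>UNIV. \<Sum>f\<in>UNIV. 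
      of_real c * z $ f * signature c e * cnj (z $ e) * X $ e $ f) * (of_real c * z $ a * signature c b * cnj (z $ b))" for a b
    unfolding hopf_map_def matrix_matrix_mult_def
    by (simp add: sum_distrib_left sum_distrib_right algebra_simps)
  moreover have "trace (hopf_map c z ** X) = (\<Sum>e\<in>UNIV. \<Sum>f\<in>UNIV. of_real c * z $ f * signature c e * cnj (z $ e) * X $ e $ f)"
    unfolding trace_def hopf_map_def matrix_matrix_mult_def
    by (subst sum.swap) (simp add: algebra_simps)
  ultimately show "hopf_map c z ** (X ** hopf_map c z) = csm (trace (hopf_map c z ** X)) (hopf_map c z)"
    by (simp add: vec_eq_iff csm_def hopf_map_def)
qed

lemma csf_point:
  assumes "P \<in> complex_space_form c"
  shows "P ** P = P" "sadj c P = P" "P ** (X ** P) = csm (trace (P ** X)) P"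
proof -
  obtain z where "P = hopf_map c z" "herm c z z = of_real c" using hopf_point[OF assms] by blast
  then show "P ** P = P" "sadj c P = P" "P ** (X ** P) = csm (trace (P ** X)) P"
    using hopf_facts(1-3)[of z] by simp_all
qed

lemma csf_tangentD:
  assumes "X \<in> csf_tangent c P"
  shows "sadj c X = X" "P ** X = X - X ** P"
  using assms by (auto simp: csf_tangent_def algebra_simps)

lemma subspace_csf_tangent: "subspace (csf_tangent c P)"
proof (rule subspaceI)
  show "0 \<in> csf_tangent c P"
    by (simp add: csf_tangent_def mat_simps) (simp add: sadj_def vec_eq_iff)
  show "X + Y \<in> csf_tangent c P" if "X \<in> csf_tangent c P" "Y \<in> csf_tangent c P" for X Y
    using that by (simp add: csf_tangent_def sadj_simps mat_simps)
      (metis (no_types, lifting) add.assoc add.commute)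
  show "r *\<^sub>R X \<in> csf_tangent c P" if "X \<in> csf_tangent c P" for X r
    using that by (simp add: csf_tangent_def sadj_simps mat_simps flip: scaleR_add_right)
qed

context
  fixes P :: "'n::finite cmat"
  assumes P: "P \<in> complex_space_form c"
begin

lemma PP: "P ** P = P" "P ** (P ** X) = P ** (X :: 'n cmat)"
  using csf_point(1)[OF P] by (simp_all add: matrix_mul_assoc)

text \<open>Read as rewrite rules from left to right, these push every factor \<open>P\<close> to
  the right through tangent matrices. Together with \<open>PP\<close> they give a normal form in
  which the matrix identities below are checked.\<close>

lemma tangent_normal_form:
  assumes "X \<in> csf_tangent c P"
  shows "P ** X = X - X ** P" "P ** (X ** Y) = X ** Y - X ** (P ** (Y :: 'n cmat))"
proof -
  show 1: "P ** X = X - X ** P" by (rule csf_tangentD(2)[OF assms])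
  have "(P ** X) ** Y = X ** Y - X ** (P ** Y)" unfolding 1 by (simp only: mat_simps)
  then show "P ** (X ** Y) = X ** Y - X ** (P ** Y)" by (simp only: matrix_mul_assoc)
qed

lemma proj_in: "csf_proj c P W \<in> csf_tangent c P"
proof -
  define H where "H = (1 / 2) *\<^sub>R (W + sadj c W)"
  have H: "sadj c H = H" unfolding H_def by (simp add: sadj_simps add.commute)
  show ?thesis
    unfolding csf_tangent_def csf_proj_def Let_def H_def[symmetric] mem_Collect_eq
    using H csf_point(2)[OF P] by (simp add: sadj_simps sadj_numeral sadj_mult mat_simps PP)
qed

lemma metric_sadj:
  assumes "sadj c X = X"
  shows "csf_metric c (sadj c W) X = csf_metric c W X"
  unfolding csf_metric_def using sadj_simps(7)[of "X ** W"] assms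
  by (metis sadj_mult complex_cnj(1) complex.sel(1) cnj.simps(1) trace_mul_sym)

lemma proj_metric:
  assumes "X \<in> csf_tangent c P"
  shows "csf_metric c (csf_proj c P W) X = csf_metric c W X"
proof -
  interpret g: bounded_bilinear "csf_metric c" by (rule bounded_bilinear_csf_metric)
  define H where "H = (1 / 2) *\<^sub>R (W + sadj c W)"
  note X = csf_tangentD[OF assms] tangent_normal_form[OF assms]
  have "csf_metric c H X = csf_metric c W X"
    unfolding H_def using metric_sadj[OF X(1)] by (simp add: g.add_left g.scaleR_left)
  moreover have "csf_metric c (P ** H + H ** P - (P ** (H ** P) + P ** (H ** P))) X = csf_metric c H X"
  proof -
    have "trace (P ** (H ** X)) = trace (H ** (X ** P))" by (rule trace_rotate)
    moreover have "trace (P ** (H ** (P ** X))) = trace (H ** (P ** (X ** P)))"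
      by (metis matrix_mul_assoc trace_mul_sym)
    ultimately have "trace ((P ** H + H ** P - (P ** (H ** P) + P ** (H ** P))) ** X) = trace (H ** X)"
      by (simp add: mat_simps trace_simps X PP)
    then show ?thesis unfolding csf_metric_def by simp
  qed
  ultimately show ?thesis unfolding csf_proj_def Let_def H_def[symmetric] by simp
qed

lemma J_in:
  assumes "X \<in> csf_tangent c P"
  shows "csf_J P X \<in> csf_tangent c P"
proof -
  have J: "csf_J P X = csm \<i> (X ** P - P ** X)" by (simp add: csf_J_def csm_def)
  show ?thesis
    unfolding csf_tangent_def mem_Collect_eq J
    using csf_tangentD[OF assms] csf_point(2)[OF P] tangent_normal_form[OF assms]
    by (simp add: sadj_simps sadj_numeral sadj_mult mat_simps PP csm_simps) (simp add: csm_def vec_eq_iff)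
qed

end

lemma csf_J_eq: "csf_J P X = csm \<i> (X ** P - P ** X)" by (simp add: csf_J_def csm_def)

lemma linear_csf_J: "linear (csf_J P)"
  by (rule linearI) (simp_all add: csf_J_eq mat_simps csm_simps scaleR_diff_right)

lemma JJ:
  assumes "P \<in> complex_space_form c" "X \<in> csf_tangent c P"
  shows "csf_J P (csf_J P X) = - X"
  using tangent_normal_form[OF assms] PP[OF assms(1)]
  by (simp add: csf_J_eq csm_simps mat_simps) 

lemma J_skew:
  shows "csf_metric c (csf_J P X) Y = - csf_metric c X (csf_J P Y)"
proof -
  have "trace (P ** (X ** Y)) = trace (X ** (Y ** P))" by (rule trace_rotate)
  then show ?thesis
    unfolding csf_metric_def csf_J_eq by (simp add: csm_simps mat_simps trace_simps algebra_simps)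
qed

lemma J_isometry:
  assumes "P \<in> complex_space_form c" "X \<in> csf_tangent c P"
  shows "csf_metric c (csf_J P X) (csf_J P Y) = csf_metric c X Y"
proof -
  interpret g: bounded_bilinear "csf_metric c" by (rule bounded_bilinear_csf_metric)
  show ?thesis
  using J_skew[of P "csf_J P X" Y] JJ[OF assms] by (simp add: g.minus_left)
qed

lemma csf_proj_eqI:
  assumes "P \<in> complex_space_form c" "X \<in> csf_tangent c P"
  shows "csf_proj c P X = X"
  using tangent_normal_form[OF assms] PP[OF assms(1)] csf_tangentD(1)[OF assms(2)]
  by (simp add: csf_proj_def mat_simps scaleR_add_left[symmetric] scaleR_2[symmetric])

text \<open>Up to the factor \<open>c\<close> this trace is the Hermitian inner product of tangent
  vectors: the real part is the metric, the imaginary part the Kaehler form. The adjoint reverses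
  products, so conjugation interchanges \<open>X\<close> and \<open>Y\<close>.\<close>

lemma trace_metric:
  assumes P: "P \<in> complex_space_form c" and X: "X \<in> csf_tangent c P" and Y: "Y \<in> csf_tangent c P"
  shows "trace (P ** (X ** Y)) = of_real c * (of_real (csf_metric c X Y) + \<i> * of_real (csf_metric c (csf_J P X) Y))"
proof -
  define s where "s = trace (P ** (X ** Y))"
  have "sadj c (P ** (X ** Y)) = Y ** (X ** P)"
    using csf_tangentD(1)[OF X] csf_tangentD(1)[OF Y] csf_point(2)[OF P] by (simp add: sadj_mult mat_simps)
  then have "cnj s = trace (Y ** (X ** P))" unfolding s_def by (metis sadj_simps(7))
  then have 1: "trace (P ** (Y ** X)) = cnj s" by (simp add: trace_rotate)
  have xy: "trace (X ** Y) = s + trace (P ** (Y ** X))"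
  proof -
    have "trace (X ** Y) = trace (P ** (X ** Y)) + trace (X ** (P ** Y))"
      using tangent_normal_form[OF P X] by (simp add: trace_simps)
    also have "trace (X ** (P ** Y)) = trace (P ** (Y ** X))" by (rule trace_rotate)
    finally show ?thesis by (simp add: s_def)
  qed
  have a: "csf_metric c X Y = c * Re s"
    unfolding csf_metric_def xy 1 by simp
  have "trace (X ** (P ** Y) - P ** (X ** Y)) = cnj s - s"
    using xy 1 tangent_normal_form[OF P X] by (simp add: trace_simps s_def)
  have b: "csf_metric c (csf_J P X) Y = c * Im s"
  proof -
    have "csf_J P X ** Y = csm \<i> (X ** (P ** Y) - P ** (X ** Y))"
      by (simp only: csf_J_eq csm_simps(4) mat_simps)
    then have "trace (csf_J P X ** Y) = \<i> * (cnj s - s)"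
      using \<open>trace (X ** (P ** Y) - P ** (X ** Y)) = cnj s - s\<close> by (simp only: csm_simps(13))
    then show ?thesis unfolding csf_metric_def by simp
  qed
  show ?thesis unfolding a b s_def[symmetric] by (simp add: complex_eq_iff cc)
qed

text \<open>Tangent matrices interchange the image and the kernel of \<open>P\<close>, so a product
  of two of them preserves both, and on the image, a line, it acts as a scalar. Splitting the triple
  product according to its right factor \<open>P\<close> or \<open>1 - P\<close> gives the two
  summands.\<close>

lemma triple_product:
  assumes P: "P \<in> complex_space_form c" and X: "X \<in> csf_tangent c P" and Y: "Y \<in> csf_tangent c P"
    and Z: "Z \<in> csf_tangent c P"
  shows "X ** (Y ** Z) = csm (trace (P ** (Y ** Z))) (X ** P) + csm (trace (P ** (X ** Y))) (P ** Z)"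
proof -
  note n = tangent_normal_form[OF P X] tangent_normal_form[OF P Y] tangent_normal_form[OF P Z] PP[OF P]
  define s where "s = trace (P ** (Y ** Z))"
  define t where "t = trace (P ** (X ** Y))"
  have "P ** ((Y ** Z) ** P) = csm s P" unfolding s_def by (rule csf_point(3)[OF P])
  then have "X ** (P ** ((Y ** Z) ** P)) = csm s (X ** P)" by (simp only: csm_simps)
  then have 1: "X ** (Y ** (Z ** P)) = csm s (X ** P)" by (simp add: mat_simps n)
  have "P ** ((X ** Y) ** P) = csm t P" unfolding t_def by (rule csf_point(3)[OF P])
  then have "(P ** ((X ** Y) ** P)) ** Z = csm t (P ** Z)" by (simp only: csm_simps)
  then have "X ** (Y ** Z) - X ** (Y ** (Z ** P)) = csm t (P ** Z)" by (simp add: mat_simps n)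
  with 1 show ?thesis unfolding s_def[symmetric] t_def[symmetric] by (simp add: algebra_simps)
qed

text \<open>As in every symmetric space, the curvature tensor is the double bracket.\<close>

lemma double_bracket:
  assumes P: "P \<in> complex_space_form c" and X: "X \<in> csf_tangent c P" and Y: "Y \<in> csf_tangent c P"
    and Z: "Z \<in> csf_tangent c P"
  defines "J \<equiv> csf_J P" and "g \<equiv> csf_metric c"
  shows "(X ** Y - Y ** X) ** Z - Z ** (X ** Y - Y ** X) =
    c *\<^sub>R (g Y Z *\<^sub>R X - g X Z *\<^sub>R Y + g (J Y) Z *\<^sub>R J X - g (J X) Z *\<^sub>R J Y - (2 * g (J X) Y) *\<^sub>R J Z)"
proof -
  note t = trace_metric[OF P]
  note tp = triple_product[OF P]
  have sw: "g (J Y) X = - g (J X) Y" "g (J Z) X = - g (J X) Z" "g (J Z) Y = - g (J Y) Z"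
    "g Y X = g X Y" "g Z X = g X Z" "g Z Y = g Y Z"
    unfolding g_def J_def using J_skew csf_metric_sym by metis+
  have *: "csm (of_real c * (of_real r + \<i> * of_real s)) W = c *\<^sub>R (r *\<^sub>R W + s *\<^sub>R csm \<i> W)" for r s W
    by (simp add: csm_def vec_eq_iff scaleR_conv_of_real[where 'a=complex] algebra_simps)
  have Jx: "J W = csm \<i> (W ** P) - csm \<i> (P ** W)" for W
    by (simp add: J_def csf_J_eq csm_simps)
  have d: "W = W ** P + P ** W" if "W \<in> csf_tangent c P" for W
    using tangent_normal_form(1)[OF P that] by simp
  define j1 j2 j3 where "j1 = g (J X) Y" and "j2 = g (J X) Z" and "j3 = g (J Y) Z"
  have "(X ** Y - Y ** X) ** Z - Z ** (X ** Y - Y ** X) =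
      X ** (Y ** Z) - Y ** (X ** Z) - Z ** (X ** Y) + Z ** (Y ** X)"
    by (simp add: mat_simps)
  also have "\<dots> = c *\<^sub>R (g Y Z *\<^sub>R (X ** P + P ** X) - g X Z *\<^sub>R (Y ** P + P ** Y) + j3 *\<^sub>R J X
     - j2 *\<^sub>R J Y - (2 * j1) *\<^sub>R J Z)"
    unfolding tp[OF X Y Z] tp[OF Y X Z] tp[OF Z X Y] tp[OF Z Y X] t[OF Y Z] t[OF X Z] t[OF X Y]
      t[OF Z X] t[OF Z Y] t[OF Y X] g_def[symmetric] J_def[symmetric]
    unfolding sw * 
      j1_def[symmetric] j2_def[symmetric] j3_def[symmetric]
    unfolding Jx
    by (simp add: algebra_simps numeral_mult_scaleR)
  also have "\<dots> = c *\<^sub>R (g Y Z *\<^sub>R X - g X Z *\<^sub>R Y + g (J Y) Z *\<^sub>R J X - g (J X) Z *\<^sub>R J Y - (2 * g (J X) Y) *\<^sub>R J Z)"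
    unfolding j1_def j2_def j3_def using d[OF X] d[OF Y] by simp
  finally show ?thesis .
qed


section \<open>Horizontal lifts, positivity of the metric and tangent spaces of the space
  form\<close>

lemma herm_bilinear: "herm c (u + u') w = herm c u w + herm c u' w" "herm c w (u + u') = herm c w u + herm c w u'"
  "herm c (r *\<^sub>R u) w = of_real r * herm c u w" "herm c w (r *\<^sub>R u) = of_real r * herm c w u"
  "herm c u w = cnj (herm c w u)"
  unfolding herm_def
  by (auto simp: sum.distrib sum_distrib_left algebra_simps scaleR_conv_of_real[where 'a=complex] cnj_sum sig)

lemma herm_option: "herm c u w = of_real c * u $ None * cnj (w $ None) + (\<Sum>i\<in>UNIV. u $ Some i * cnj (w $ Some i))"
  unfolding herm_def UNIV_option_conv
  by (subst sum.insert) (auto simp: signature_def sum.reindex)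

text \<open>For c = 1 the form is positive definite anyway. For c = -1 the vector \<open>z\<close>
  is timelike, and the reversed Cauchy-Schwarz inequality makes its orthogonal complement
  spacelike.\<close>

lemma herm_horizontal_pos:
  assumes z: "herm c z z = of_real c" and u: "herm c u z = 0" "u \<noteq> 0"
  shows "Re (herm c u u) > 0"
proof -
  define n where "n w = (\<Sum>i\<in>UNIV. (cmod (w $ Some i))\<^sup>2)" for w :: "'a cvec"
  have n0: "n w \<ge> 0" for w unfolding n_def by (simp add: sum_nonneg)
  have hw: "Re (herm c w w) = c * (cmod (w $ None))\<^sup>2 + n w" for w :: "'a cvec"
    unfolding herm_option n_def
    by (simp add: mult.assoc complex_norm_square[symmetric] del: of_real_power)
  have z': "c * (cmod (z $ None))\<^sup>2 + n z = c" using hw[of z] z by simp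
  show ?thesis
  proof (cases "u $ None = 0")
    case True
    have "\<exists>i. u $ Some i \<noteq> 0"
    proof (rule ccontr)
      assume "\<not> ?thesis"
      then have "u $ a = 0" for a using True by (cases a) auto
      then show False using u(2) by (simp add: vec_eq_iff)
    qed
    then have "n u > 0" unfolding n_def by (auto intro: sum_pos2)
    then show ?thesis using hw[of u] True by simp
  next
    case False
    then have p: "(cmod (u $ None))\<^sup>2 > 0" by simp
    from c show ?thesis
    proof
      assume "c = 1" then show ?thesis using hw[of u] add_pos_nonneg[OF p n0[of u]] by simp
    next
      assume c1: "c = -1"
      have nz: "n z < (cmod (z $ None))\<^sup>2" using z' c1 by simp
      have "u $ None * cnj (z $ None) = (\<Sum>i\<in>UNIV. u $ Some i * cnj (z $ Some i))"
        using u(1) c1 unfolding herm_option by simp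
      then have "cmod (u $ None) * cmod (z $ None) = cmod (\<Sum>i\<in>UNIV. u $ Some i * cnj (z $ Some i))"
        by (metis complex_mod_cnj norm_mult)
      also have "\<dots> \<le> (\<Sum>i\<in>UNIV. \<bar>cmod (u $ Some i)\<bar> * \<bar>cmod (z $ Some i)\<bar>)"
        by (rule order_trans[OF norm_sum]) (simp add: norm_mult)
      also have "\<dots> \<le> L2_set (\<lambda>i. cmod (u $ Some i)) UNIV * L2_set (\<lambda>i. cmod (z $ Some i)) UNIV"
        by (rule L2_set_mult_ineq)
      also have "\<dots> = sqrt (n u) * sqrt (n z)" by (simp add: L2_set_def n_def)
      finally have le: "cmod (u $ None) * cmod (z $ None) \<le> sqrt (n u * n z)" by (simp add: real_sqrt_mult)
      have "(cmod (u $ None) * cmod (z $ None))\<^sup>2 \<le> n u * n z"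
        using power_mono[OF le, of 2] n0 by simp
      then have le2: "(cmod (u $ None))\<^sup>2 * (cmod (z $ None))\<^sup>2 \<le> n u * n z" by (simp add: power_mult_distrib)
      \<comment> \<open>Otherwise the Cauchy-Schwarz bound \<open>le2\<close> clashes with
        \<open>n z\<close> being strictly smaller than the squared timelike entry of
        \<open>z\<close>; strictness uses that the entry of \<open>u\<close> at \<open>None\<close>
        is nonzero.\<close>
      have "(cmod (u $ None))\<^sup>2 < n u"
      proof (rule ccontr)
        assume "\<not> ?thesis"
        then have "n u * n z \<le> (cmod (u $ None))\<^sup>2 * n z" using n0 by (intro mult_right_mono) auto
        also have "\<dots> < (cmod (u $ None))\<^sup>2 * (cmod (z $ None))\<^sup>2" using p nz by simp
        finally show False using le2 by simp
      qed
      then show ?thesis using hw[of u] c1 by simp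
    qed
  qed
qed

text \<open>The vector \<open>X *v z\<close> is the horizontal lift of \<open>X\<close> to
  \<open>z\<close>, and the differential of the Hopf map inverts the lift.\<close>

lemma tangent_horizontal:
  assumes z: "herm c z z = of_real c" and X: "X \<in> csf_tangent c (hopf_map c z)"
  shows "herm c (X *v z) z = 0" "hopf_differential c z (X *v z) = X"
proof -
  let ?P = "hopf_map c z"
  have P: "?P \<in> complex_space_form c" unfolding complex_space_form_def using z by blast
  have Pz: "?P *v w = (\<chi> a. of_real c * herm c w z * z $ a)" for w by (rule hopf_facts(4)[OF z])
  have Pzz: "?P *v z = z" unfolding Pz z by (simp add: cc vec_eq_iff)
  have z0: "z \<noteq> 0"
  proof
    assume "z = 0" then have "herm c z z = 0" by (simp add: herm_def)
    then show False using z c by auto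
  qed
  have "?P ** (X ** ?P) = 0" using tangent_normal_form[OF P X] PP[OF P] by simp
  then have "(?P ** (X ** ?P)) *v z = 0" by simp
  then have "?P *v (X *v z) = 0" by (simp add: matrix_vector_mul_assoc[symmetric] Pzz)
  then have "\<forall>a. of_real c * herm c (X *v z) z * z $ a = 0" unfolding Pz by (simp add: vec_eq_iff)
  then show h: "herm c (X *v z) z = 0" using z0 c by (auto simp: vec_eq_iff)
  have "(X ** ?P) $ a $ b = of_real c * (X *v z) $ a * signature c b * cnj (z $ b)" for a b
    unfolding matrix_matrix_mult_def hopf_map_def matrix_vector_mult_def
    by (simp add: sum_distrib_left sum_distrib_right algebra_simps)
  moreover have "?P ** X = sadj c (X ** ?P)"
    using csf_tangentD(1)[OF X] csf_point(2)[OF P] by (simp add: sadj_mult)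
  ultimately have "(X ** ?P + ?P ** X) $ a $ b = hopf_differential c z (X *v z) $ a $ b" for a b
    unfolding hopf_differential_def sadj_def by (simp add: algebra_simps sig)
  then have "hopf_differential c z (X *v z) = X ** ?P + ?P ** X" by (simp add: vec_eq_iff)
  also have "\<dots> = X" using tangent_normal_form(1)[OF P X] by simp
  finally show "hopf_differential c z (X *v z) = X" .
qed

lemma csf_metric_pos:
  assumes P: "P \<in> complex_space_form c" and X: "X \<in> csf_tangent c P" and "X \<noteq> 0"
  shows "csf_metric c X X > 0"
proof -
  obtain z where z: "P = hopf_map c z" "herm c z z = of_real c" using hopf_point[OF P] by blast
  note t = tangent_horizontal[OF z(2) X[unfolded z(1)]]
  have "hopf_differential c z 0 = 0" by (simp add: hopf_differential_def vec_eq_iff)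
  then have "X *v z \<noteq> 0" using t(2) \<open>X \<noteq> 0\<close> by auto
  from herm_horizontal_pos[OF z(2) t(1) this] csf_metric_hopf_differential[OF c z(2) t(1) t(1)]
  show ?thesis unfolding t(2) by simp
qed

text \<open>Horizontal lifting embeds the tangent matrices into the complex orthogonal complement of
  \<open>z\<close>. This bound is what \<open>T_I\<close> uses to identify the tangent space of a
  hypersurface.\<close>

lemma dim_csf_tangent:
  assumes P: "(P :: 'n::finite cmat) \<in> complex_space_form c"
  shows "dim (csf_tangent c P) \<le> 2 * CARD('n)"
proof -
  obtain z where z: "P = hopf_map c z" "herm c z z = of_real c" using hopf_point[OF P] by blast
  \<comment> \<open>The vectors \<open>a\<close> and \<open>b\<close> represent the real and the
    imaginary part of \<open>herm c u z\<close> in the Euclidean inner product, so that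
    horizontality becomes orthogonality to two real vectors.\<close>
  define a where "a = (\<chi> i. signature c i * z $ i)"
  define b where "b = (\<chi> i. \<i> * (signature c i * z $ i))"
  have a: "u \<bullet> a = Re (herm c u z)" for u
    unfolding inner_vec_def a_def herm_def Re_sum
    by (intro sum.cong refl) (simp add: inner_complex_def signature_def algebra_simps)
  have b: "u \<bullet> b = Im (herm c u z)" for u
    unfolding inner_vec_def b_def herm_def Im_sum
    by (intro sum.cong refl) (simp add: inner_complex_def signature_def algebra_simps)
  have ab: "b \<bullet> a = 0" unfolding inner_vec_def a_def b_def by (simp add: inner_complex_def algebra_simps)
  have z0: "z \<noteq> 0"
  proof
    assume "z = 0" then have "herm c z z = 0" by (simp add: herm_def)
    then show False using z c by auto
  qed
  then obtain i where i: "z $ i \<noteq> 0" by (auto simp: vec_eq_iff)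
  have "signature c i \<noteq> 0" using c by (auto simp: signature_def)
  then have "a $ i \<noteq> 0" "b $ i \<noteq> 0" using i by (simp_all add: a_def b_def)
  then have n0: "a \<noteq> 0" "b \<noteq> 0" by (metis zero_index)+
  have "independent {a, b}"
    by (rule pairwise_orthogonal_independent)
      (use n0 ab in \<open>auto simp: pairwise_insert orthogonal_def inner_commute\<close>)
  moreover have "a \<noteq> b" using n0 ab by auto
  ultimately have dab: "dim {a, b} = 2" by (simp add: dim_eq_card_independent)
  define H where "H = {u. \<forall>w\<in>span {a, b}. orthogonal w u}"
  have "dim {u\<in>UNIV. \<forall>w\<in>span {a, b}. orthogonal w u} + dim (span {a, b}) = dim (UNIV :: 'n cvec set)"
    by (rule dim_subspace_orthogonal_to_vectors) auto
  then have dH: "dim H + 2 = 2 * (CARD('n) + 1)"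
    unfolding H_def using dab by (simp add: dim_span card_option)
  have sub: "(\<lambda>X. X *v z) ` csf_tangent c P \<subseteq> H"
  proof clarify
    fix X assume "X \<in> csf_tangent c P"
    then have h0: "herm c (X *v z) z = 0" using tangent_horizontal z by blast
    have "orthogonal (X *v z) w" if "w \<in> span {a, b}" for w
    proof (rule orthogonal_to_span[OF that])
      fix y assume "y \<in> {a, b}"
      then show "orthogonal (X *v z) y"
        using h0 a[of "X *v z"] b[of "X *v z"] unfolding orthogonal_def by auto
    qed
    then show "X *v z \<in> H" unfolding H_def by (auto simp: orthogonal_commute)
  qed
  have lin: "linear (\<lambda>X :: 'n cmat. X *v z)"
    by (rule linearI) (simp_all add: vec_eq_iff matrix_vector_mult_def scaleR_sum_right sum.distrib algebra_simps)
  have inj: "inj_on (\<lambda>X. X *v z) (csf_tangent c P)"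
  proof (rule inj_onI)
    fix X Y assume "X \<in> csf_tangent c P" "Y \<in> csf_tangent c P" "X *v z = Y *v z"
    then show "X = Y" using tangent_horizontal(2)[OF z(2)] unfolding z(1) by metis
  qed
  have "dim (csf_tangent c P) = dim ((\<lambda>X. X *v z) ` csf_tangent c P)"
    by (rule dim_image_eq[OF lin, symmetric]) (simp add: inj span_eq_iff[THEN iffD2, OF subspace_csf_tangent])
  also have "\<dots> \<le> dim H" using sub by (rule dim_subset)
  finally show ?thesis using dH by simp
qed

text \<open>One inclusion differentiates the equations for a self-adjoint projection. For the other,
  the Hopf image of the line from \<open>z\<close> in the direction of the horizontal lift
  \<open>u\<close> is a curve with velocity \<open>X\<close>.\<close>

lemma tangent_space_csf:
  assumes P: "(P :: 'n::finite cmat) \<in> complex_space_form c"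
  shows "tangent_space (complex_space_form c) P = csf_tangent c P"
proof (intro equalityI subsetI)
  fix v assume v: "v \<in> tangent_space (complex_space_form c) P"
  let ?Q = "complex_space_form c :: 'n cmat set"
  have id: "smooth_map ?Q (\<lambda>q. q)" by (rule smooth_map_ident)
  have "deriv_within ?Q (\<lambda>q. q ** q) P v = P ** v + v ** P"
    using deriv_within_bilinear[OF bounded_bilinear_matrix_mult id id P v] v
    by (simp add: deriv_within_ident)
  moreover have "deriv_within ?Q (\<lambda>q. q ** q) P v = deriv_within ?Q (\<lambda>q. q) P v"
    by (rule deriv_within_cong[OF id P v]) (simp add: csf_point)
  moreover have "deriv_within ?Q (sadj c) P v = sadj c v"
    using deriv_within_linear[OF _ id P v, of "sadj c"] linear_sadj v
    by (simp add: deriv_within_ident linear_conv_bounded_linear)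
  moreover have "deriv_within ?Q (sadj c) P v = deriv_within ?Q (\<lambda>q. q) P v"
    by (rule deriv_within_cong[OF id P v]) (simp add: csf_point)
  ultimately show "v \<in> csf_tangent c P"
    using v by (simp add: csf_tangent_def deriv_within_ident)
next
  fix X assume X: "X \<in> csf_tangent c P"
  obtain z where z: "P = hopf_map c z" "herm c z z = of_real c" using hopf_point[OF P] by blast
  define u where "u = X *v z"
  note t = tangent_horizontal[OF z(2) X[unfolded z(1)], folded u_def]
  define h where "h = Re (herm c u u)"
  have hu: "herm c u u = of_real h"
    using herm_bilinear(5)[of u u] by (simp add: h_def complex_eq_iff)
  have zu: "herm c z u = 0" using herm_bilinear(5)[of z u] t(1) by simp
  \<comment> \<open>\<open>c * f t\<close> is the square of \<open>z + t *\<^sub>R u\<close> under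
    \<open>herm c\<close>. The Hopf map is quadratic, so rescaling to the total space divides by
    \<open>f t\<close> and the curve contains no square root.\<close>
  define f where "f t = 1 + t * t * (c * h)" for t :: real
  define \<gamma> where "\<gamma> t = inverse (f t) *\<^sub>R (P + t *\<^sub>R X + (t * t) *\<^sub>R hopf_map c u)" for t
  \<comment> \<open>From \<open>e \<le> 1\<close> the square of \<open>t\<close> is bounded by its
    absolute value, and \<open>e * (\<bar>h\<bar> + 1) = 1\<close> then keeps \<open>f\<close>
    positive.\<close>
  define e where "e = 1 / (\<bar>h\<bar> + 1)"
  have e: "e > 0" "e \<le> 1" "e * (\<bar>h\<bar> + 1) = 1" unfolding e_def by (auto simp: field_simps)
  have f: "f t > 0" if "t \<in> {-e<..<e}" for t
  proof -
    have "\<bar>t * t * (c * h)\<bar> = \<bar>t\<bar> * \<bar>t\<bar> * \<bar>h\<bar>" using c by (auto simp: abs_mult)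
    also have "\<dots> \<le> \<bar>t\<bar> * 1 * \<bar>h\<bar>" using that e(2) by (intro mult_right_mono mult_left_mono) auto
    also have "\<dots> \<le> \<bar>t\<bar> * (\<bar>h\<bar> + 1)" by (simp add: mult_left_mono)
    also have "\<dots> < e * (\<bar>h\<bar> + 1)" using that by (intro mult_strict_right_mono) auto
    finally show ?thesis unfolding f_def e(3) by linarith
  qed
  have hz: "hopf_map c (z + t *\<^sub>R u) = P + t *\<^sub>R X + (t * t) *\<^sub>R hopf_map c u" for t
    unfolding z(1) t(2)[symmetric] hopf_map_def hopf_differential_def
    by (simp add: vec_eq_iff algebra_simps scaleR_conv_of_real[where 'a=complex])
  have in_Q: "\<gamma> t \<in> complex_space_form c" if "t \<in> {-e<..<e}" for t
  proof -
    define r where "r = inverse (sqrt (f t))"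
    have r: "r * r = inverse (f t)" using f[OF that] by (simp add: r_def flip: inverse_mult_distrib)
    have "herm c (z + t *\<^sub>R u) (z + t *\<^sub>R u) = of_real (c * f t)"
      using z(2) hu zu t(1) by (simp add: herm_bilinear(1-4) f_def algebra_simps cc)
    then have "herm c (r *\<^sub>R (z + t *\<^sub>R u)) (r *\<^sub>R (z + t *\<^sub>R u)) = of_real (c * ((r * r) * f t))"
      by (simp only: herm_bilinear(3,4) of_real_mult mult_ac)
    then have "herm c (r *\<^sub>R (z + t *\<^sub>R u)) (r *\<^sub>R (z + t *\<^sub>R u)) = of_real c"
      using f[OF that] unfolding r by simp
    moreover have "hopf_map c (r *\<^sub>R (z + t *\<^sub>R u)) = (r * r) *\<^sub>R hopf_map c (z + t *\<^sub>R u)"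
      unfolding hopf_map_def by (simp add: vec_eq_iff algebra_simps scaleR_conv_of_real[where 'a=complex])
    ultimately show ?thesis
      unfolding complex_space_form_def \<gamma>_def r hz by (metis (mono_tags, lifting) image_eqI mem_Collect_eq)
  qed
  have sm: "smooth_on U (\<lambda>t::real. t * t)" for U
    by (intro smooth_on_bilinear[OF bounded_bilinear_mult] smooth_on_ident)
  have "smooth_on {-e<..<e} \<gamma>"
    unfolding \<gamma>_def f_def
    by (intro smooth_on_bilinear[OF bounded_bilinear_scaleR] smooth_on_inverse smooth_on_add sm smooth_on_const
        smooth_on_bilinear[OF bounded_bilinear_mult] smooth_on_ident)
      (use f in \<open>force simp: f_def\<close>)
  moreover have "(\<gamma> has_vector_derivative X) (at 0)"
    unfolding \<gamma>_def f_def has_vector_derivative_def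
    by (auto intro!: derivative_eq_intros)
  ultimately show "X \<in> tangent_space (complex_space_form c) P"
    unfolding tangent_space_def mem_Collect_eq
    using e(1) in_Q by (intro exI[of _ e] conjI exI[of _ \<gamma>]) (auto simp: \<gamma>_def f_def)
qed

lemma smooth_map_csf_proj:
  assumes "smooth_map S f" "smooth_map S w"
  shows "smooth_map S (\<lambda>q. csf_proj c (f q) (w q))"
  unfolding csf_proj_def Let_def
  by (intro smooth_map_add smooth_map_diff smooth_map_bilinear[OF bounded_bilinear_matrix_mult] assms
      smooth_map_linear[OF bounded_linear_scaleR_right] smooth_map_linear[OF linear_sadj[unfolded linear_conv_bounded_linear]])

lemma linear_csf_proj: "linear (csf_proj c P)"
  by (rule linearI) (simp_all add: csf_proj_def Let_def sadj_simps mat_simps algebra_simps numeral_mult_scaleR)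

end

lemma csm_minus_left: "csm (- z) X = - csm z X"
  by (simp add: csm_def vec_eq_iff)

context csf
begin

text \<open>Matrices commuting with \<open>P\<close> are block diagonal, tangent matrices are
  off-diagonal. This disposes of the purely algebraic terms left over when \<open>csf_J\<close> and
  the shape operator are differentiated.\<close>

lemma csf_proj_commuting:
  assumes P: "P \<in> complex_space_form c" and w: "P ** w = w ** P"
  shows "csf_proj c P w = 0"
proof -
  define H where "H = (1 / 2) *\<^sub>R (w + sadj c w)"
  have "sadj c (P ** w) = sadj c (w ** P)" using w by simp
  then have "P ** sadj c w = sadj c w ** P" using csf_point(2)[OF P] by (simp add: sadj_mult)
  then have 1: "P ** H = H ** P" using w unfolding H_def by (simp add: mat_simps)
  then have "P ** (H ** P) = H ** P" using PP(2)[OF P, of H] by (simp add: 1[symmetric])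
  then show ?thesis unfolding csf_proj_def Let_def H_def[symmetric] by (simp add: 1)
qed

lemma csf_proj_J:
  assumes P: "P \<in> complex_space_form c"
  shows "csf_proj c P (csf_J P w) = csf_J P (csf_proj c P w)"
proof -
  define H where "H = (1 / 2) *\<^sub>R (w + sadj c w)"
  have "sadj c (csf_J P w) = csf_J P (sadj c w)"
    using csf_point(2)[OF P]
    by (simp add: csf_J_eq sadj_simps sadj_mult csm_simps csm_minus_left mat_simps)
  then have "(1 / 2) *\<^sub>R (csf_J P w + sadj c (csf_J P w)) = csf_J P H"
    unfolding H_def by (simp add: linear_add[OF linear_csf_J] linear_cmul[OF linear_csf_J])
  then show ?thesis
    unfolding csf_proj_def Let_def H_def[symmetric]
    by (simp add: csf_J_eq mat_simps csm_simps PP[OF P])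
qed

end

section \<open>Real hypersurfaces\<close>

locale hypersurface = csf c for c :: real +
  fixes M :: "'n::finite cmat set" and N :: "'n cmat \<Rightarrow> 'n cmat" and D :: "'n cmat connection"
  assumes card_n: "CARD('n) > 2"
    and M: "real_hypersurface c M"
    and N: "unit_normal c M N"
    and D: "levi_civita M (csf_metric c) D"
begin

abbreviation g where "g \<equiv> csf_metric c"
abbreviation T where "T \<equiv> tangent_space M"

sublocale g: bounded_bilinear g
  by (rule bounded_bilinear_csf_metric)

lemma g_sym: "g x y = g y x" by (rule csf_metric_sym)

lemma M_csf: "p \<in> M \<Longrightarrow> p \<in> complex_space_form c"
  using M unfolding real_hypersurface_def by blast

lemma connected_M: "connected M" and M_nonempty: "M \<noteq> {}"
  using M unfolding real_hypersurface_def by auto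

lemma subspace_T: "p \<in> M \<Longrightarrow> subspace (T p)" and dim_T: "p \<in> M \<Longrightarrow> dim (T p) = 2 * CARD('n) - 1"
  using M tangent_space_submanifold unfolding real_hypersurface_def by blast+

lemma T_csf: "p \<in> M \<Longrightarrow> v \<in> T p \<Longrightarrow> v \<in> csf_tangent c p"
  using tangent_space_mono[of M "complex_space_form c" p] tangent_space_csf[of p] M_csf by blast

lemma smooth_N: "smooth_map M N"
  using N unfolding unit_normal_def by blast

lemma N_csf: "p \<in> M \<Longrightarrow> N p \<in> csf_tangent c p"
  using N tangent_space_csf[of p] M_csf[of p] unfolding unit_normal_def by blast

lemma N_unit: "p \<in> M \<Longrightarrow> g (N p) (N p) = 1"
  using N unfolding unit_normal_def by blast

lemma N_normal: "p \<in> M \<Longrightarrow> v \<in> T p \<Longrightarrow> g v (N p) = 0"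
  using N g_sym[of v] unfolding unit_normal_def by simp

lemma g_pos: "p \<in> M \<Longrightarrow> v \<in> T p \<Longrightarrow> v \<noteq> 0 \<Longrightarrow> g v v > 0"
  using csf_metric_pos M_csf T_csf by blast

text \<open>The orthogonal complement of \<open>N p\<close> contains \<open>T p\<close> and is a
  proper subspace of a space of dimension at most 2n, while \<open>T p\<close> has dimension 2n - 1;
  so the two agree.\<close>

lemma T_I:
  assumes p: "p \<in> M" and v: "v \<in> csf_tangent c p" "g v (N p) = 0"
  shows "v \<in> T p"
proof -
  define W where "W = {v \<in> csf_tangent c p. g v (N p) = 0}"
  have W: "subspace W"
    unfolding W_def using subspace_csf_tangent[of p]
    by (auto simp: subspace_def g.zero_left g.add_left g.scaleR_left)
  have TW: "T p \<subseteq> W" unfolding W_def using T_csf[OF p] N_normal[OF p] by blast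
  have "W \<subset> csf_tangent c p"
  proof -
    have "N p \<notin> W" unfolding W_def using N_unit[OF p] by simp
    moreover have "W \<subseteq> csf_tangent c p" unfolding W_def by blast
    ultimately show ?thesis using N_csf[OF p] by blast
  qed
  then have "span W \<subset> span (csf_tangent c p)"
    using W subspace_csf_tangent[of p] by (simp add: span_eq_iff[THEN iffD2])
  then have "dim W < dim (csf_tangent c p)" by (rule dim_psubset)
  then have "dim W \<le> dim (T p)" using dim_csf_tangent[OF M_csf[OF p]] dim_T[OF p] by simp
  then have "T p = W" using subspace_dim_equal[OF subspace_T[OF p] W TW] by simp
  then show ?thesis using v W_def by blast
qed

section \<open>The induced connection and covariant derivatives of operator fields\<close>

definition tproj where "tproj p w = csf_proj c p w - g w (N p) *\<^sub>R N p"

lemma linear_tproj: "linear (tproj p)"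
  unfolding tproj_def
  by (rule linearI) (simp_all add: linear_add[OF linear_csf_proj] linear_cmul[OF linear_csf_proj]
      g.add_left g.scaleR_left algebra_simps)

lemma tproj_in: "p \<in> M \<Longrightarrow> tproj p w \<in> T p"
  by (rule T_I) (auto simp: tproj_def g.diff_left g.scaleR_left N_unit proj_metric[OF M_csf N_csf]
      intro!: subspace_diff subspace_scale subspace_csf_tangent proj_in M_csf N_csf)

lemma g_tproj: "p \<in> M \<Longrightarrow> x \<in> T p \<Longrightarrow> g (tproj p w) x = g w x"
  using N_normal[of p x] by (simp add: tproj_def g.diff_left g.scaleR_left proj_metric[OF M_csf T_csf] g_sym[of "N p"])

lemma tproj_csf: "p \<in> M \<Longrightarrow> x \<in> csf_tangent c p \<Longrightarrow> tproj p x = x - g x (N p) *\<^sub>R N p"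
  by (simp add: tproj_def csf_proj_eqI[OF M_csf])

lemma tproj_id: "p \<in> M \<Longrightarrow> x \<in> T p \<Longrightarrow> tproj p x = x"
  by (simp add: tproj_csf T_csf N_normal)

lemma tproj_N: "p \<in> M \<Longrightarrow> tproj p (N p) = 0"
  by (simp add: tproj_csf N_csf N_unit)

lemma tproj_proj: "p \<in> M \<Longrightarrow> tproj p (csf_proj c p w) = tproj p w"
  by (simp add: tproj_csf proj_in[OF M_csf] proj_metric[OF M_csf N_csf]) (simp add: tproj_def)

lemma tproj_commuting: "p \<in> M \<Longrightarrow> p ** w = w ** p \<Longrightarrow> tproj p w = 0"
  using tproj_proj[of p w] csf_proj_commuting[OF M_csf] linear_0[OF linear_tproj] by simp

lemma smooth_g: "smooth_map M f \<Longrightarrow> smooth_map M h \<Longrightarrow> smooth_map M (\<lambda>q. g (f q) (h q))"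
  by (rule smooth_map_bilinear[OF bounded_bilinear_csf_metric])

lemma smooth_tproj: "smooth_map M w \<Longrightarrow> smooth_map M (\<lambda>q. tproj q (w q))"
  unfolding tproj_def
  by (intro smooth_map_diff smooth_map_scaleR smooth_g smooth_map_csf_proj smooth_map_ident smooth_N)

abbreviation VF where "VF \<equiv> vector_fields M"

lemma VF_I: "smooth_map M X \<Longrightarrow> (\<And>p. p \<in> M \<Longrightarrow> X p \<in> T p) \<Longrightarrow> X \<in> VF"
  by (simp add: vector_fields_def)

lemma tproj_VF: "smooth_map M w \<Longrightarrow> (\<lambda>q. tproj q (w q)) \<in> VF"
  by (rule VF_I) (auto intro: smooth_tproj tproj_in)

text \<open>Projecting a constant matrix tangentially gives a global field; this is how statements
  about fields are converted into statements about tangent vectors at one point.\<close>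

lemma extend_VF: 
  assumes "p \<in> M" "v \<in> T p" obtains X where "X \<in> VF" "X p = v"
  using tproj_VF[OF smooth_map_const, of v] tproj_id[OF assms] by blast

lemma D_eq: "X \<in> VF \<Longrightarrow> Y \<in> VF \<Longrightarrow> p \<in> M \<Longrightarrow> D X Y p = tproj p (deriv_within M Y p (X p))"
proof (rule levi_civita_unique[OF D bounded_bilinear_csf_metric csf_metric_sym])
  show "x = 0" if "q \<in> M" "x \<in> T q" "\<And>y. y \<in> T q \<Longrightarrow> g x y = 0" for q x
    using g_pos[OF that(1,2)] that(3)[OF that(2)] by fastforce
qed (auto intro: subspace_T tproj_in g_tproj smooth_tproj)

lemmas D_props = D[unfolded levi_civita_def, rule_format, OF open_UNIV, unfolded Int_UNIV_right]

lemma D_VF: "X \<in> VF \<Longrightarrow> Y \<in> VF \<Longrightarrow> D X Y \<in> VF"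
  using D_props unfolding connection_on_def by blast

lemma D_torsion: "X \<in> VF \<Longrightarrow> Y \<in> VF \<Longrightarrow> p \<in> M \<Longrightarrow> D X Y p - D Y X p = lie_bracket M X Y p"
  using D_props by blast

abbreviation dd :: "('n cmat \<Rightarrow> 'b::euclidean_space) \<Rightarrow> 'n cmat \<Rightarrow> 'n cmat \<Rightarrow> 'b"
  where "dd f p \<equiv> deriv_within M f p"

lemma VF_smooth: "X \<in> VF \<Longrightarrow> smooth_map M X" and VF_in: "X \<in> VF \<Longrightarrow> p \<in> M \<Longrightarrow> X p \<in> T p"
  by (auto simp: vector_fields_def)

lemma D_metric: "X \<in> VF \<Longrightarrow> Y \<in> VF \<Longrightarrow> Z \<in> VF \<Longrightarrow> p \<in> M \<Longrightarrow>
   dd (\<lambda>q. g (Y q) (Z q)) p (X p) = g (D X Y p) (Z p) + g (Y p) (D X Z p)"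
  using D_props unfolding deriv_along_def by blast

lemma VF_add: "X \<in> VF \<Longrightarrow> Y \<in> VF \<Longrightarrow> (\<lambda>q. X q + Y q) \<in> VF"
  by (rule VF_I) (auto intro: VF_smooth VF_in subspace_add subspace_T)

lemma VF_diff: "X \<in> VF \<Longrightarrow> Y \<in> VF \<Longrightarrow> (\<lambda>q. X q - Y q) \<in> VF"
  by (rule VF_I) (auto intro: VF_smooth VF_in subspace_diff subspace_T)

lemma VF_scale: "smooth_map M f \<Longrightarrow> X \<in> VF \<Longrightarrow> (\<lambda>q. f q *\<^sub>R X q) \<in> VF"
  by (rule VF_I) (auto intro: VF_smooth VF_in subspace_scale subspace_T)

text \<open>Tangency is read off from torsion-freeness, since covariant derivatives are vector
  fields.\<close>

lemma lie_bracket_VF: "X \<in> VF \<Longrightarrow> Y \<in> VF \<Longrightarrow> lie_bracket M X Y \<in> VF"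
  using VF_diff[OF D_VF D_VF, of X Y Y X] D_torsion[of X Y] smooth_map_cong
  unfolding vector_fields_def by (smt (verit) mem_Collect_eq)

lemma D_add: "X \<in> VF \<Longrightarrow> Y \<in> VF \<Longrightarrow> Z \<in> VF \<Longrightarrow> p \<in> M \<Longrightarrow> D X (\<lambda>q. Y q + Z q) p = D X Y p + D X Z p"
  by (simp add: D_eq VF_add deriv_within_add VF_smooth VF_in linear_add[OF linear_tproj])

lemma D_diff: "X \<in> VF \<Longrightarrow> Y \<in> VF \<Longrightarrow> Z \<in> VF \<Longrightarrow> p \<in> M \<Longrightarrow> D X (\<lambda>q. Y q - Z q) p = D X Y p - D X Z p"
  by (simp add: D_eq VF_diff deriv_within_diff VF_smooth VF_in linear_diff[OF linear_tproj])

lemma D_scale: "smooth_map M f \<Longrightarrow> X \<in> VF \<Longrightarrow> Y \<in> VF \<Longrightarrow> p \<in> M \<Longrightarrow>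
    D X (\<lambda>q. f q *\<^sub>R Y q) p = dd f p (X p) *\<^sub>R Y p + f p *\<^sub>R D X Y p"
  by (simp add: D_eq VF_scale deriv_within_bilinear[OF bounded_bilinear_scaleR] VF_smooth VF_in
      linear_add[OF linear_tproj] linear_cmul[OF linear_tproj] tproj_id add.commute)

lemma D_cong:
  assumes "X \<in> VF" "Y \<in> VF" "p \<in> M" "\<And>q. q \<in> M \<Longrightarrow> Y q = Z q"
  shows "D X Z p = D X Y p"
proof -
  have "Z \<in> VF" using assms(2,4) smooth_map_cong[of M Y Z] by (auto simp: vector_fields_def)
  then show ?thesis
    using assms deriv_within_cong[OF VF_smooth[OF assms(2)] assms(3) VF_in[OF assms(1,3)] assms(4)]
    by (simp add: D_eq)
qed

lemma dd_commute:
  assumes "smooth_map M f" "X \<in> VF" "Y \<in> VF" "p \<in> M"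
  shows "dd (\<lambda>q. dd f q (Y q)) p (X p) - dd (\<lambda>q. dd f q (X q)) p (Y p) = dd f p (D X Y p - D Y X p)"
  using deriv_within_commute[OF assms VF_in[OF lie_bracket_VF[OF assms(2,3)] assms(4)]]
    D_torsion[OF assms(2-4)] by simp

text \<open>For an operator field \<open>K\<close> that is tangential on both sides, the tangential part of its flat
  derivative is its covariant derivative.\<close>

definition nabla_op :: "('n cmat \<Rightarrow> 'n cmat \<Rightarrow> 'n cmat) \<Rightarrow> 'n cmat \<Rightarrow> 'n cmat \<Rightarrow> 'n cmat \<Rightarrow> 'n cmat" where
  "nabla_op K p x y = tproj p (dd (\<lambda>q. K q y) p x)"

lemma operator_VF:
  assumes lin: "\<And>q. q \<in> M \<Longrightarrow> linear (K q)" and sm: "\<And>w. smooth_map M (\<lambda>q. K q w)" and Y: "Y \<in> VF"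
    and K_in: "\<And>q w. q \<in> M \<Longrightarrow> K q w \<in> T q"
  shows "(\<lambda>q. K q (Y q)) \<in> VF"
proof (rule VF_I)
  have "smooth_map M (\<lambda>q. \<Sum>b\<in>Basis. (Y q \<bullet> b) *\<^sub>R K q b)"
    by (intro smooth_map_sum smooth_map_scaleR sm smooth_map_linear[OF bounded_linear_inner_left] VF_smooth Y)
  then show "smooth_map M (\<lambda>q. K q (Y q))"
    by (rule smooth_map_cong) (rule linear_basis_expansion[OF lin, symmetric])
qed (rule K_in)

text \<open>The product rule, applied to the expansion of \<open>Y\<close> in the fixed basis of the
  surrounding space. \<open>K_tproj\<close> allows the flat derivative of \<open>Y\<close> inside
  \<open>K\<close> to be replaced by its tangential part, the covariant derivative.\<close>

lemma D_operator:
  assumes lin: "\<And>q. q \<in> M \<Longrightarrow> linear (K q)" and sm: "\<And>w. smooth_map M (\<lambda>q. K q w)"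
    and K_in: "\<And>q w. q \<in> M \<Longrightarrow> K q w \<in> T q" and K_tproj: "\<And>q w. q \<in> M \<Longrightarrow> K q (tproj q w) = K q w"
    and X: "X \<in> VF" and Y: "Y \<in> VF" and p: "p \<in> M"
  shows "D X (\<lambda>q. K q (Y q)) p = nabla_op K p (X p) (Y p) + K p (D X Y p)"
proof -
  have smY: "smooth_map M (\<lambda>q. Y q \<bullet> b)" for b
    by (intro smooth_map_linear[OF bounded_linear_inner_left] VF_smooth Y)
  have Xp: "X p \<in> T p" by (rule VF_in[OF X p])
  have "dd (\<lambda>q. K q (Y q)) p (X p) = dd (\<lambda>q. \<Sum>b\<in>Basis. (Y q \<bullet> b) *\<^sub>R K q b) p (X p)"
    by (rule deriv_within_cong[OF _ p Xp])
      (auto intro!: smooth_map_sum smooth_map_scaleR sm smY linear_basis_expansion[OF lin, symmetric])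
  also have "\<dots> = (\<Sum>b\<in>Basis. (Y p \<bullet> b) *\<^sub>R dd (\<lambda>q. K q b) p (X p) + (dd Y p (X p) \<bullet> b) *\<^sub>R K p b)"
    using sm smY p Xp VF_smooth[OF Y]
    by (simp add: deriv_within_sum deriv_within_bilinear[OF bounded_bilinear_scaleR] smooth_map_scaleR
        deriv_within_linear[OF bounded_linear_inner_left])
  also have "\<dots> = (\<Sum>b\<in>Basis. (Y p \<bullet> b) *\<^sub>R dd (\<lambda>q. K q b) p (X p)) + K p (dd Y p (X p))"
    by (simp only: sum.distrib linear_basis_expansion[OF lin[OF p], symmetric])
  also have "(\<Sum>b\<in>Basis. (Y p \<bullet> b) *\<^sub>R dd (\<lambda>q. K q b) p (X p)) = dd (\<lambda>q. \<Sum>b\<in>Basis. (Y p \<bullet> b) *\<^sub>R K q b) p (X p)"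
    using sm p Xp
    by (simp add: deriv_within_sum smooth_map_linear[OF bounded_linear_scaleR_right] deriv_within_linear[OF bounded_linear_scaleR_right])
  also have "\<dots> = dd (\<lambda>q. K q (Y p)) p (X p)"
    by (rule deriv_within_cong[OF sm p Xp]) (rule linear_basis_expansion[OF lin])
  finally have "D X (\<lambda>q. K q (Y q)) p = nabla_op K p (X p) (Y p) + tproj p (K p (dd Y p (X p)))"
    using X p operator_VF[OF lin sm Y K_in]
    by (simp add: D_eq nabla_op_def linear_add[OF linear_tproj])
  then show ?thesis using K_tproj[OF p] by (simp add: tproj_id[OF p K_in[OF p]] D_eq[OF X Y p])
qed

section \<open>Shape operator, structure tensors and their covariant derivatives\<close>

definition shp where "shp q x = - csf_proj c q (dd N q (tproj q x))"
text \<open>The inner \<open>tproj\<close>, here and in \<open>shp\<close>, makes the operators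
  linear on all matrices, the form in which \<open>operator_VF\<close> takes them; for
  \<open>shp\<close> it also gives the invariance required by \<open>D_operator\<close>.\<close>

definition phi where "phi q x = tproj q (csf_J q (tproj q x))"
definition xi where "xi = structure_xi N"

lemma linear_shp: "q \<in> M \<Longrightarrow> linear (shp q)"
  using linear_deriv_within[OF smooth_N, of q] linear_csf_proj[of q] linear_tproj[of q]
  unfolding shp_def by (auto intro!: linearI simp: linear_add linear_cmul)

lemma linear_phi: "linear (phi q)"
  unfolding phi_def using linear_csf_J[of q] linear_tproj[of q]
  by (auto intro!: linearI simp: linear_add linear_cmul)

lemma dN_normal: "p \<in> M \<Longrightarrow> v \<in> T p \<Longrightarrow> g (dd N p v) (N p) = 0"
proof -
  assume p: "p \<in> M" and v: "v \<in> T p"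
  have "dd (\<lambda>q. g (N q) (N q)) p v = dd (\<lambda>q. 1) p v"
    by (rule deriv_within_cong[OF smooth_map_const p v]) (simp add: N_unit)
  then show ?thesis
    using deriv_within_bilinear[OF bounded_bilinear_csf_metric smooth_N smooth_N p v] v
      g_sym[of "N p" "dd N p v"] by (simp add: deriv_within_const)
qed

lemma shp_in: "p \<in> M \<Longrightarrow> shp p x \<in> T p"
proof -
  assume p: "p \<in> M"
  have "shp p x = - tproj p (dd N p (tproj p x))"
    unfolding shp_def tproj_def using dN_normal[OF p tproj_in[OF p]] by (simp add: tproj_def)
  then show ?thesis using tproj_in[OF p] subspace_T[OF p] by (simp add: subspace_neg)
qed

lemma shp_eq: "p \<in> M \<Longrightarrow> x \<in> T p \<Longrightarrow> tproj p (dd N p x) = - shp p x"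
  "p \<in> M \<Longrightarrow> x \<in> T p \<Longrightarrow> csf_proj c p (dd N p x) = - shp p x"
  using dN_normal by (simp_all add: shp_def tproj_id) (simp add: tproj_def)

lemma shp_tproj: "p \<in> M \<Longrightarrow> shp p (tproj p x) = shp p x"
  by (simp add: shp_def tproj_id tproj_in)

lemma smooth_shp: "smooth_map M (\<lambda>q. shp q w)"
  unfolding shp_def
  by (intro smooth_map_minus smooth_map_csf_proj smooth_map_ident smooth_map_deriv_within[OF smooth_N]
      tproj_VF[OF smooth_map_const])

lemma phi_in: "p \<in> M \<Longrightarrow> phi p x \<in> T p"
  unfolding phi_def by (rule tproj_in)

lemma bounded_linear_csm: "bounded_linear (csm \<i> :: 'n cmat \<Rightarrow> _)"
  unfolding linear_conv_bounded_linear[symmetric] by (rule linearI) (simp_all add: csm_simps)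

lemma smooth_csf_J: "smooth_map M w \<Longrightarrow> smooth_map M (\<lambda>q. csf_J q (w q))"
  unfolding csf_J_eq
  by (intro smooth_map_linear[OF bounded_linear_csm] smooth_map_diff
      smooth_map_bilinear[OF bounded_bilinear_matrix_mult] smooth_map_ident)

lemma smooth_phi: "smooth_map M (\<lambda>q. phi q w)"
  unfolding phi_def by (intro smooth_tproj smooth_csf_J smooth_map_const)

lemma xi_eq: "xi p = - csf_J p (N p)" by (simp add: xi_def structure_xi_def)

lemma xi_in: "p \<in> M \<Longrightarrow> xi p \<in> T p"
proof (rule T_I)
  assume p: "p \<in> M"
  show "xi p \<in> csf_tangent c p"
    unfolding xi_eq by (rule subspace_neg[OF subspace_csf_tangent J_in[OF M_csf[OF p] N_csf[OF p]]])
  show "g (xi p) (N p) = 0"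
    using J_skew[of p "N p" "N p"] g_sym[of "N p"] by (simp add: xi_eq g.minus_left)
qed

lemma xi_VF: "xi \<in> VF"
proof (rule VF_I)
  show "smooth_map M xi" unfolding xi_eq[abs_def] by (intro smooth_map_minus smooth_csf_J smooth_N)
qed (rule xi_in)

lemma J_xi: "p \<in> M \<Longrightarrow> csf_J p (xi p) = N p" and J_N: "csf_J p (N p) = - xi p"
  by (simp_all add: xi_eq linear_neg[OF linear_csf_J] JJ[OF M_csf N_csf])

lemma g_xi_xi: "p \<in> M \<Longrightarrow> g (xi p) (xi p) = 1"
  by (simp add: xi_eq g.minus_left g.minus_right J_isometry[OF M_csf N_csf] N_unit)

lemma J_eq_phi:
  assumes "p \<in> M" "x \<in> T p"
  shows "csf_J p x = phi p x + g x (xi p) *\<^sub>R N p"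
proof -
  have "g (csf_J p x) (N p) = g x (xi p)" using J_skew[of p x "N p"] by (simp add: J_N g.minus_right)
  then show ?thesis
    unfolding phi_def using assms by (simp add: tproj_id tproj_csf J_in[OF M_csf T_csf])
qed

lemma structure_phi_eq: "p \<in> M \<Longrightarrow> X p \<in> T p \<Longrightarrow> structure_phi c N X p = phi p (X p)"
  by (simp add: structure_phi_def structure_eta_def J_eq_phi xi_def)

lemma phi_xi: "p \<in> M \<Longrightarrow> phi p (xi p) = 0"
  using J_eq_phi[OF _ xi_in, of p] J_xi[of p] g_xi_xi[of p] by simp

lemma phi_phi:
  assumes p: "p \<in> M" and x: "x \<in> T p"
  shows "phi p (phi p x) = - x + g x (xi p) *\<^sub>R xi p"
proof -
  have "phi p (phi p x) = tproj p (csf_J p (phi p x))"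
    by (simp add: phi_def[of p "phi p x"] tproj_id[OF p phi_in[OF p]])
  also have "csf_J p (phi p x) = csf_J p (csf_J p x - g x (xi p) *\<^sub>R N p)"
    using J_eq_phi[OF p x] by simp
  also have "\<dots> = - x + g x (xi p) *\<^sub>R xi p"
    using JJ[OF M_csf[OF p] T_csf[OF p x]]
    by (simp add: linear_diff[OF linear_csf_J] linear_cmul[OF linear_csf_J] J_N)
  also have "tproj p \<dots> = \<dots>"
    using x xi_in[OF p] subspace_T[OF p] by (intro tproj_id p) (simp add: subspace_diff subspace_scale)
  finally show ?thesis .
qed

lemma phi_skew:
  assumes p: "p \<in> M" and x: "x \<in> T p" and y: "y \<in> T p"
  shows "g (phi p x) y = - g x (phi p y)"
  using J_skew[of p x y] J_eq_phi[OF p x] J_eq_phi[OF p y] N_normal[OF p x] N_normal[OF p y] g_sym[of "N p"]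
  by (simp add: g.add_left g.add_right g.scaleR_left g.scaleR_right)

text \<open>Differentiating the orthogonality of \<open>N\<close> and a tangent field expresses
  \<open>g (shp p x) y\<close> through the derivative of the field for \<open>y\<close>. The two
  sides differ by the normal component of a Lie bracket, which is 0.\<close>

lemma shp_sym:
  assumes p: "p \<in> M" and x: "x \<in> T p" and y: "y \<in> T p"
  shows "g (shp p x) y = g x (shp p y)"
proof -
  obtain X where X: "X \<in> VF" "X p = x" using extend_VF[OF p x] by blast
  obtain Y where Y: "Y \<in> VF" "Y p = y" using extend_VF[OF p y] by blast
  have *: "g (shp p (Z p)) (W p) = g (N p) (dd W p (Z p))" if Z: "Z \<in> VF" and W: "W \<in> VF" for Z W
  proof -
    have "dd (\<lambda>q. g (N q) (W q)) p (Z p) = dd (\<lambda>q. 0) p (Z p)"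
      by (rule deriv_within_cong[OF smooth_map_const p VF_in[OF Z p]]) (simp add: N_normal VF_in[OF W] g_sym[of "N _"])
    then have "g (N p) (dd W p (Z p)) = - g (dd N p (Z p)) (W p)"
      using deriv_within_bilinear[OF bounded_bilinear_csf_metric smooth_N VF_smooth[OF W] p VF_in[OF Z p]] VF_in[OF Z p]
      by (simp add: deriv_within_const)
    also have "\<dots> = - g (tproj p (dd N p (Z p))) (W p)" using g_tproj[OF p VF_in[OF W p]] by simp
    finally show ?thesis using shp_eq[OF p VF_in[OF Z p]] by (simp add: g.minus_left)
  qed
  have "g (N p) (dd Y p x) - g (N p) (dd X p y) = g (N p) (lie_bracket M X Y p)"
    by (simp add: lie_bracket_def deriv_along_def X Y g.diff_right)
  also have "\<dots> = 0" by (subst g_sym) (rule N_normal[OF p VF_in[OF lie_bracket_VF[OF X(1) Y(1)] p]])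
  finally show ?thesis using *[OF X(1) Y(1)] *[OF Y(1) X(1)] X Y g_sym[of x] by simp
qed

lemma shp_VF: "Y \<in> VF \<Longrightarrow> (\<lambda>q. shp q (Y q)) \<in> VF"
  by (rule operator_VF[OF linear_shp smooth_shp _ shp_in])

lemma phi_VF: "Y \<in> VF \<Longrightarrow> (\<lambda>q. phi q (Y q)) \<in> VF"
  by (rule operator_VF[OF linear_phi smooth_phi _ phi_in])

text \<open>\<open>C p x y\<close> is the covariant derivative of A in direction \<open>x\<close>,
  applied to \<open>y\<close>.\<close>

abbreviation C where "C \<equiv> nabla_op shp"

lemma D_shp: "X \<in> VF \<Longrightarrow> Y \<in> VF \<Longrightarrow> p \<in> M \<Longrightarrow>
    D X (\<lambda>q. shp q (Y q)) p = C p (X p) (Y p) + shp p (D X Y p)"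
  by (rule D_operator[OF linear_shp smooth_shp shp_in shp_tproj])

lemma C_in: "p \<in> M \<Longrightarrow> C p x y \<in> T p"
  unfolding nabla_op_def by (rule tproj_in)

lemma C_sym:
  assumes p: "p \<in> M" and x: "x \<in> T p" and y: "y \<in> T p" and z: "z \<in> T p"
  shows "g (C p x y) z = g y (C p x z)"
proof -
  obtain X where X: "X \<in> VF" "X p = x" using extend_VF[OF p x] by blast
  obtain Y where Y: "Y \<in> VF" "Y p = y" using extend_VF[OF p y] by blast
  obtain Z where Z: "Z \<in> VF" "Z p = z" using extend_VF[OF p z] by blast
  have "dd (\<lambda>q. g (shp q (Y q)) (Z q)) p (X p) = dd (\<lambda>q. g (Y q) (shp q (Z q))) p (X p)"
    by (rule deriv_within_cong[OF _ p VF_in[OF X(1) p]])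
      (auto intro!: smooth_g VF_smooth shp_VF Y Z simp: shp_sym VF_in[OF Y(1)] VF_in[OF Z(1)])
  then have "g (C p x y + shp p (D X Y p)) z + g (shp p y) (D X Z p) =
     g (D X Y p) (shp p z) + g y (C p x z + shp p (D X Z p))"
    using D_metric[OF X(1) shp_VF[OF Y(1)] Z(1) p] D_metric[OF X(1) Y(1) shp_VF[OF Z(1)] p]
      D_shp[OF X(1) Y(1) p] D_shp[OF X(1) Z(1) p] X(2) Y(2) Z(2) by simp
  then show ?thesis
    using shp_sym[OF p VF_in[OF D_VF[OF X(1) Y(1)] p] z] shp_sym[OF p y VF_in[OF D_VF[OF X(1) Z(1)] p]]
    by (simp add: g.add_left g.add_right)
qed

lemma dJ:
  assumes p: "p \<in> M" and x: "x \<in> T p" and w: "smooth_map M w"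
  shows "dd (\<lambda>q. csf_J q (w q)) p x = csf_J p (dd w p x) + csm \<i> (w p ** x - x ** w p)"
proof -
  have "dd (\<lambda>q. csf_J q (w q)) p x = csm \<i> (dd (\<lambda>q. w q ** q - q ** w q) p x)"
    unfolding csf_J_eq
    by (intro deriv_within_linear[OF bounded_linear_csm _ p x] smooth_map_diff smooth_map_bilinear[OF bounded_bilinear_matrix_mult] smooth_map_ident w)
  also have "dd (\<lambda>q. w q ** q - q ** w q) p x = w p ** x + dd w p x ** p - (p ** dd w p x + x ** w p)"
    using x by (simp add: deriv_within_diff[OF _ _ p x] smooth_map_bilinear[OF bounded_bilinear_matrix_mult] smooth_map_ident w
      deriv_within_bilinear[OF bounded_bilinear_matrix_mult _ _ p x] deriv_within_ident)
  finally show ?thesis by (simp add: csf_J_eq csm_simps algebra_simps)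
qed

text \<open>A product of two tangent matrices at \<open>p\<close> commutes with \<open>p\<close>. So
  the dependence of \<open>csf_J\<close> on its base point contributes nothing tangential, which is
  the Kaehler condition \<nabla>J = 0.\<close>

lemma tproj_bracket:
  assumes p: "p \<in> M" and x: "x \<in> csf_tangent c p" and y: "y \<in> csf_tangent c p"
  shows "tproj p (csm \<i> (y ** x - x ** y)) = 0"
  using tangent_normal_form[OF M_csf[OF p] x] tangent_normal_form[OF M_csf[OF p] y]
  by (intro tproj_commuting[OF p]) (simp add: csm_simps mat_simps)

lemma tproj_J:
  assumes p: "p \<in> M" 
  shows "tproj p (csf_J p w) = phi p (tproj p w) - g w (N p) *\<^sub>R xi p"
proof -
  have "tproj p (csf_J p w) = tproj p (csf_J p (csf_proj c p w))"
    using tproj_proj[OF p, of "csf_J p w"] csf_proj_J[OF M_csf[OF p]] by simp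
  also have "csf_proj c p w = tproj p w + g w (N p) *\<^sub>R N p" by (simp add: tproj_def)
  also have "tproj p (csf_J p \<dots>) = phi p (tproj p w) + g w (N p) *\<^sub>R tproj p (- xi p)"
    by (simp add: linear_add[OF linear_csf_J] linear_cmul[OF linear_csf_J] linear_add[OF linear_tproj]
       linear_cmul[OF linear_tproj] linear_diff[OF linear_tproj] linear_neg[OF linear_tproj] J_N phi_def tproj_id tproj_in p)
  finally show ?thesis by (simp add: linear_neg[OF linear_tproj] tproj_id[OF p xi_in[OF p]])
qed

lemma D_xi:
  assumes X: "X \<in> VF" and p: "p \<in> M"
  shows "D X xi p = phi p (shp p (X p))"
proof -
  have x: "X p \<in> T p" by (rule VF_in[OF X p])
  have "dd xi p (X p) = - dd (\<lambda>q. csf_J q (N q)) p (X p)"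
    unfolding xi_eq[abs_def] by (rule deriv_within_minus[OF smooth_csf_J[OF smooth_N] p x])
  then have "D X xi p = - tproj p (csf_J p (dd N p (X p)) + csm \<i> (N p ** X p - X p ** N p))"
    using D_eq[OF X xi_VF p] dJ[OF p x smooth_N] by (simp add: linear_neg[OF linear_tproj] flip: minus_add_distrib)
  also have "\<dots> = - phi p (- shp p (X p))"
    using tproj_bracket[OF p T_csf[OF p x] N_csf[OF p]] dN_normal[OF p x]
    by (simp add: linear_add[OF linear_tproj] tproj_J[OF p] shp_eq(1)[OF p x])
  finally show ?thesis by (simp add: linear_neg[OF linear_phi])
qed

lemma D_phi:
  assumes X: "X \<in> VF" and Y: "Y \<in> VF" and p: "p \<in> M"
  shows "D X (\<lambda>q. phi q (Y q)) p =
    g (Y p) (xi p) *\<^sub>R shp p (X p) - g (shp p (X p)) (Y p) *\<^sub>R xi p + phi p (D X Y p)"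
proof -
  have x: "X p \<in> T p" and y: "Y p \<in> T p" by (rule VF_in[OF _ p], fact)+
  have sm1: "smooth_map M (\<lambda>q. csf_J q (Y q))" by (rule smooth_csf_J[OF VF_smooth[OF Y]])
  have sm2: "smooth_map M (\<lambda>q. g (Y q) (xi q))" by (intro smooth_g VF_smooth Y xi_VF)
  have sm3: "smooth_map M (\<lambda>q. g (Y q) (xi q) *\<^sub>R N q)" by (intro smooth_map_scaleR sm2 smooth_N)
  have "dd (\<lambda>q. phi q (Y q)) p (X p) = dd (\<lambda>q. csf_J q (Y q) - g (Y q) (xi q) *\<^sub>R N q) p (X p)"
    by (rule deriv_within_cong[OF _ p x]) (auto intro!: smooth_map_diff sm1 sm3 simp: J_eq_phi VF_in[OF Y])
  also have "\<dots> = csf_J p (dd Y p (X p)) + csm \<i> (Y p ** X p - X p ** Y p) -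
     (g (Y p) (xi p) *\<^sub>R dd N p (X p) + dd (\<lambda>q. g (Y q) (xi q)) p (X p) *\<^sub>R N p)"
    by (simp add: deriv_within_diff[OF sm1 sm3 p x] dJ[OF p x VF_smooth[OF Y]]
        deriv_within_bilinear[OF bounded_bilinear_scaleR sm2 smooth_N p x])
  finally have "D X (\<lambda>q. phi q (Y q)) p = tproj p (csf_J p (dd Y p (X p))) + g (Y p) (xi p) *\<^sub>R shp p (X p)"
    using tproj_bracket[OF p T_csf[OF p x] T_csf[OF p y]]
    by (simp add: D_eq[OF X phi_VF[OF Y] p] linear_add[OF linear_tproj] linear_diff[OF linear_tproj]
        linear_cmul[OF linear_tproj] tproj_N[OF p] shp_eq(1)[OF p x])
  moreover have "g (dd Y p (X p)) (N p) = g (shp p (X p)) (Y p)"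
  proof -
    have "dd (\<lambda>q. g (Y q) (N q)) p (X p) = dd (\<lambda>q. 0) p (X p)"
      by (rule deriv_within_cong[OF smooth_map_const p x]) (simp add: N_normal VF_in[OF Y])
    then have "g (dd Y p (X p)) (N p) = - g (dd N p (X p)) (Y p)"
      using deriv_within_bilinear[OF bounded_bilinear_csf_metric VF_smooth[OF Y] smooth_N p x] x g_sym[of "Y p"]
      by (simp add: deriv_within_const)
    also have "\<dots> = - g (tproj p (dd N p (X p))) (Y p)" using g_tproj[OF p y] by simp
    finally show ?thesis using shp_eq(1)[OF p x] by (simp add: g.minus_left)
  qed
  ultimately show ?thesis by (simp add: tproj_J[OF p] D_eq[OF X Y p])
qed

text \<open>Replaces the projection in the definition of A by a polynomial in \<open>p\<close>,
  \<open>y\<close>, \<open>N p\<close> and the derivative of \<open>N\<close>. In this form A can be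
  differentiated with a single term containing second derivatives of \<open>N\<close>.\<close>

lemma shp_field:
  assumes p: "p \<in> M" and y: "y \<in> T p"
  shows "shp p y = - dd N p y + ((y ** N p + N p ** y) - (p ** (y ** N p + N p ** y) + p ** (y ** N p + N p ** y)))"
proof -
  let ?H = "dd N p y"
  note n = tangent_normal_form[OF M_csf[OF p] T_csf[OF p y]] tangent_normal_form[OF M_csf[OF p] N_csf[OF p]] PP[OF M_csf[OF p]]
  have 1: "sadj c ?H = ?H"
  proof -
    have "dd (\<lambda>q. sadj c (N q)) p y = dd N p y"
      by (rule deriv_within_cong[OF smooth_N p y]) (simp add: csf_tangentD(1)[OF N_csf])
    then show ?thesis
      using deriv_within_linear[OF linear_sadj[unfolded linear_conv_bounded_linear] smooth_N p y] by simp
  qed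
  have "dd (\<lambda>q. q ** N q + N q ** q) p y = dd N p y"
    by (rule deriv_within_cong[OF smooth_N p y]) (simp add: csf_tangentD(2)[OF N_csf])
  moreover have "dd (\<lambda>q. q ** N q + N q ** q) p y = (p ** ?H + y ** N p) + (N p ** y + ?H ** p)"
    using y by (simp add: deriv_within_add[OF _ _ p y] smooth_map_bilinear[OF bounded_bilinear_matrix_mult] smooth_map_ident smooth_N
      deriv_within_bilinear[OF bounded_bilinear_matrix_mult _ _ p y] deriv_within_ident)
  ultimately have 2: "p ** ?H + ?H ** p = ?H - (y ** N p + N p ** y)" by (simp add: algebra_simps)
  \<comment> \<open>Multiplication by \<open>p\<close> isolates \<open>p ** (?H ** p)\<close>, the
    last unknown in the projection formula.\<close>
  then have "p ** (p ** ?H + ?H ** p) = p ** (?H - (y ** N p + N p ** y))" by simp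
  then have "p ** (?H ** p) + p ** (y ** N p + N p ** y) = 0" by (simp add: mat_simps PP[OF M_csf[OF p]] algebra_simps)
  then have 3: "p ** (?H ** p) = - (p ** (y ** N p + N p ** y))" using eq_neg_iff_add_eq_0 by blast
  have "(1 / 2) *\<^sub>R (?H + sadj c ?H) = ?H" unfolding 1 by (simp add: scaleR_half_double flip: scaleR_add_right)
  then have "csf_proj c p ?H = p ** ?H + ?H ** p - (p ** (?H ** p) + p ** (?H ** p))"
    unfolding csf_proj_def by (simp only: Let_def)
  then show ?thesis using shp_eq(2)[OF p y] unfolding 2 3 by (simp add: algebra_simps)
qed

text \<open>After antisymmetrising, the second derivatives of \<open>N\<close> combine into its
  derivative along the bracket and produce \<open>shp p z\<close>, which cancels. The rest is
  algebraic and, modulo matrices commuting with \<open>p\<close>, equals minus the double bracket,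
  that is, the ambient curvature applied to the normal.\<close>

lemma C_codazzi:
  assumes p: "p \<in> M" and x: "x \<in> T p" and y: "y \<in> T p"
  shows "C p x y - C p y x =
    c *\<^sub>R (g x (xi p) *\<^sub>R phi p y - g y (xi p) *\<^sub>R phi p x - (2 * g (phi p x) y) *\<^sub>R xi p)"
proof -
  obtain X where X: "X \<in> VF" "X p = x" using extend_VF[OF p x] by blast
  obtain Y where Y: "Y \<in> VF" "Y p = y" using extend_VF[OF p y] by blast
  let ?n = "N p"
  define z where "z = D X Y p - D Y X p"
  have z: "z = lie_bracket M X Y p" "z \<in> T p"
    unfolding z_def using D_torsion[OF X(1) Y(1) p] VF_in[OF lie_bracket_VF[OF X(1) Y(1)] p] by simp_all
  \<comment> \<open>All terms of the derivative of \<open>shp_field\<close> except the second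
    derivative of \<open>N\<close>: \<open>a\<close> is the direction, \<open>b\<close> the value of
    the differentiated field and \<open>a'\<close> its derivative.\<close>
  define F where "F a a' b = (b ** dd N p a + a' ** ?n + (?n ** a' + dd N p a ** b)) -
     ((p ** (b ** dd N p a + a' ** ?n + (?n ** a' + dd N p a ** b)) + a ** (b ** ?n + ?n ** b)) +
      (p ** (b ** dd N p a + a' ** ?n + (?n ** a' + dd N p a ** b)) + a ** (b ** ?n + ?n ** b)))" for a a' b
  have der: "dd (\<lambda>q. shp q (Z q)) p (V p) = - dd (\<lambda>q. dd N q (Z q)) p (V p) + F (V p) (dd Z p (V p)) (Z p)"
    if V: "V \<in> VF" and Z: "Z \<in> VF" for V Z
  proof -
    note v = VF_in[OF V p]
    define K where "K q = Z q ** N q + N q ** Z q" for q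
    have smm: "smooth_map M (\<lambda>q. a q ** b q)" if "smooth_map M a" "smooth_map M b" for a b :: "'n cmat \<Rightarrow> 'n cmat"
      using smooth_map_bilinear[OF bounded_bilinear_matrix_mult that] .
    have smK: "smooth_map M K" unfolding K_def[abs_def] by (intro smooth_map_add smm VF_smooth Z smooth_N)
    have smpK: "smooth_map M (\<lambda>q. q ** K q)" by (intro smm smK smooth_map_ident)
    have smd: "smooth_map M (\<lambda>q. dd N q (Z q))" by (rule smooth_map_deriv_within[OF smooth_N Z])
    have dK: "dd K p (V p) = Z p ** dd N p (V p) + dd Z p (V p) ** ?n + (?n ** dd Z p (V p) + dd N p (V p) ** Z p)"
      unfolding K_def[abs_def] using VF_smooth[OF Z] smooth_N
      by (simp add: deriv_within_add[OF _ _ p v] smm deriv_within_bilinear[OF bounded_bilinear_matrix_mult _ _ p v])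
    have dpK: "dd (\<lambda>q. q ** K q) p (V p) = p ** dd K p (V p) + V p ** K p"
      using deriv_within_bilinear[OF bounded_bilinear_matrix_mult smooth_map_ident smK p v] v
      by (simp add: deriv_within_ident)
    have "dd (\<lambda>q. shp q (Z q)) p (V p) = dd (\<lambda>q. - dd N q (Z q) + (K q - (q ** K q + q ** K q))) p (V p)"
    proof (rule deriv_within_cong[OF _ p v])
      show "smooth_map M (\<lambda>q. - dd N q (Z q) + (K q - (q ** K q + q ** K q)))"
        by (intro smooth_map_add smooth_map_diff smooth_map_minus smK smpK smd)
      show "- dd N q (Z q) + (K q - (q ** K q + q ** K q)) = shp q (Z q)" if "q \<in> M" for q
        using shp_field[OF that VF_in[OF Z that]] unfolding K_def by simp
    qed
    also have "\<dots> = - dd (\<lambda>q. dd N q (Z q)) p (V p) + (dd K p (V p) - (dd (\<lambda>q. q ** K q) p (V p) + dd (\<lambda>q. q ** K q) p (V p)))"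
      by (simp only: deriv_within_add[OF _ _ p v] deriv_within_diff[OF _ _ p v] deriv_within_minus[OF _ p v]
        smooth_map_add smooth_map_diff smooth_map_minus smK smpK smd)
    finally show ?thesis unfolding dpK dK unfolding F_def K_def .
  qed
  define a b where "a = dd Y p x" and "b = dd X p y"
  have zab: "z = a - b" unfolding z(1) a_def b_def lie_bracket_def deriv_along_def X(2) Y(2) ..
  have "C p x y - C p y x + shp p z = D X (\<lambda>q. shp q (Y q)) p - D Y (\<lambda>q. shp q (X q)) p"
    using D_shp[OF X(1) Y(1) p] D_shp[OF Y(1) X(1) p] X Y
    by (simp add: z_def linear_diff[OF linear_shp[OF p]])
  also have "\<dots> = tproj p (dd (\<lambda>q. shp q (Y q)) p (X p) - dd (\<lambda>q. shp q (X q)) p (Y p))"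
    by (simp add: D_eq shp_VF X Y p linear_diff[OF linear_tproj])
  also have "\<dots> = tproj p (- (dd (\<lambda>q. dd N q (Y q)) p (X p) - dd (\<lambda>q. dd N q (X q)) p (Y p)) + (F x a y - F y b x))"
    by (simp only: der[OF X(1) Y(1), unfolded X(2) Y(2)] der[OF Y(1) X(1), unfolded X(2) Y(2)] X(2) Y(2) a_def b_def)
      (simp add: algebra_simps)
  also have "\<dots> = tproj p (- dd N p z + (F x a y - F y b x))"
    unfolding dd_commute[OF smooth_N X(1) Y(1) p] z_def ..
  also have "\<dots> = shp p z + tproj p (F x a y - F y b x)"
    unfolding linear_add[OF linear_tproj] linear_neg[OF linear_tproj] shp_eq(1)[OF p z(2)] by simp
  finally have 1: "C p x y - C p y x = tproj p (F x a y - F y b x)" by simp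
  define B where "B = (x ** y - y ** x) ** ?n - ?n ** (x ** y - y ** x)"
  define ax ay where "ax = shp p x" and "ay = shp p y"
  define Ex Ey where "Ex = x ** ?n + ?n ** x" and "Ey = y ** ?n + ?n ** y"
  have nx: "dd N p x = - ax + (Ex - (p ** Ex + p ** Ex))"
    using shp_field[OF p x] unfolding ax_def Ex_def by (simp add: algebra_simps)
  have ny: "dd N p y = - ay + (Ey - (p ** Ey + p ** Ey))"
    using shp_field[OF p y] unfolding ay_def Ey_def by (simp add: algebra_simps)
  note nf = tangent_normal_form[OF M_csf[OF p]]
  note nfs = nf[OF T_csf[OF p x]] nf[OF T_csf[OF p y]] nf[OF N_csf[OF p]] nf[OF T_csf[OF p z(2)]]
    nf[OF T_csf[OF p shp_in[OF p]], of x, folded ax_def] nf[OF T_csf[OF p shp_in[OF p]], of y, folded ay_def] PP[OF M_csf[OF p]]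
  have ab: "a = z + b" using zab by simp
  \<comment> \<open>Adding the double bracket \<open>B\<close> leaves a matrix that commutes with
    \<open>p\<close>, whose tangential part is 0.\<close>
  have "F x a y - F y b x + B = (z ** ?n + ?n ** z - (p ** (z ** ?n + ?n ** z) + p ** (z ** ?n + ?n ** z))) +
    ((y ** dd N p x + dd N p x ** y) - (p ** (y ** dd N p x + dd N p x ** y) + p ** (y ** dd N p x + dd N p x ** y)) - (x ** Ey + x ** Ey)
    - ((x ** dd N p y + dd N p y ** x) - (p ** (x ** dd N p y + dd N p y ** x) + p ** (x ** dd N p y + dd N p y ** x)) - (y ** Ex + y ** Ex)) + B)"
    unfolding F_def ab Ex_def Ey_def by (simp add: mat_simps algebra_simps)
  also have "tproj p \<dots> = 0"
    unfolding nx ny Ex_def Ey_def B_def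
    by (rule tproj_commuting[OF p]) (simp add: mat_simps nfs)
  finally have 2: "tproj p (F x a y - F y b x) = - tproj p B"
    by (simp add: linear_add[OF linear_tproj] eq_neg_iff_add_eq_0)
  have "g (csf_J p w) ?n = g w (xi p)" if "w \<in> T p" for w
    using J_skew[of p w ?n] by (simp add: J_N g.minus_right)
  moreover have "g (csf_J p x) y = g (phi p x) y"
    using J_eq_phi[OF p x] N_normal[OF p y] g_sym[of ?n y] by (simp add: g.add_left g.scaleR_left)
  moreover have "tproj p (csf_J p w) = phi p w" if "w \<in> T p" for w
    using that p by (simp add: phi_def tproj_id)
  ultimately have "tproj p B = c *\<^sub>R (g y (xi p) *\<^sub>R phi p x - g x (xi p) *\<^sub>R phi p y + (2 * g (phi p x) y) *\<^sub>R xi p)"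
    unfolding B_def double_bracket[OF M_csf[OF p] T_csf[OF p x] T_csf[OF p y] N_csf[OF p]]
    using x y by (simp add: N_normal[OF p] J_N linear_add[OF linear_tproj] linear_diff[OF linear_tproj]
      linear_cmul[OF linear_tproj] linear_neg[OF linear_tproj] tproj_id[OF p xi_in[OF p]])
  then show ?thesis unfolding 1 2 by (simp add: algebra_simps)
qed

section \<open>The structure Jacobi operator\<close>

definition alpha where "alpha p = g (shp p (xi p)) (xi p)"

text \<open>The expression that the Gauss equation gives for \<open>R\<^sub>\<xi>\<close>.\<close>

definition jac where
  "jac p y = c *\<^sub>R (y - g y (xi p) *\<^sub>R xi p) + alpha p *\<^sub>R shp p y - g (shp p y) (xi p) *\<^sub>R shp p (xi p)"

text \<open>The derivatives of \<open>alpha\<close> and of \<open>jac\<close> written out with \<open>\<nabla>\<xi> = \<phi>A\<close>; see \<open>dd_alpha\<close> and \<open>D_jac\<close>.\<close>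

definition dalpha where
  "dalpha p x = g (C p x (xi p) + shp p (phi p (shp p x))) (xi p) + g (shp p (xi p)) (phi p (shp p x))"

definition njac where
  "njac p x y = dalpha p x *\<^sub>R shp p y + alpha p *\<^sub>R C p x y
    - c *\<^sub>R (g y (phi p (shp p x)) *\<^sub>R xi p + g y (xi p) *\<^sub>R phi p (shp p x))
    - (g (C p x y) (xi p) + g (shp p y) (phi p (shp p x))) *\<^sub>R shp p (xi p)
    - g (shp p y) (xi p) *\<^sub>R (C p x (xi p) + shp p (phi p (shp p x)))"

lemma smooth_alpha: "smooth_map M alpha"
  unfolding alpha_def[abs_def] by (intro smooth_g VF_smooth shp_VF xi_VF)

lemma D_shp_xi: "X \<in> VF \<Longrightarrow> p \<in> M \<Longrightarrow>
    D X (\<lambda>q. shp q (xi q)) p = C p (X p) (xi p) + shp p (phi p (shp p (X p)))"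
  by (simp add: D_shp[OF _ xi_VF] D_xi)

lemma dd_alpha: "X \<in> VF \<Longrightarrow> p \<in> M \<Longrightarrow> dd alpha p (X p) = dalpha p (X p)"
  unfolding alpha_def[abs_def] dalpha_def
  by (simp add: D_metric[OF _ shp_VF[OF xi_VF] xi_VF] D_shp_xi D_xi)

lemma jac_VF: "Y \<in> VF \<Longrightarrow> (\<lambda>q. jac q (Y q)) \<in> VF"
  unfolding jac_def
  by (intro VF_add VF_diff VF_scale shp_VF xi_VF smooth_g VF_smooth smooth_alpha smooth_map_const)

lemma D_jac:
  assumes X: "X \<in> VF" and Y: "Y \<in> VF" and p: "p \<in> M"
  shows "D X (\<lambda>q. jac q (Y q)) p = njac p (X p) (Y p) + jac p (D X Y p)"
proof -
  have f1: "(\<lambda>q. g (Y q) (xi q) *\<^sub>R xi q) \<in> VF" "smooth_map M (\<lambda>q. g (Y q) (xi q))"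
    "smooth_map M (\<lambda>q. g (shp q (Y q)) (xi q))"
    by (intro VF_scale smooth_g VF_smooth shp_VF xi_VF Y)+
  have f2: "(\<lambda>q. Y q - g (Y q) (xi q) *\<^sub>R xi q) \<in> VF" by (intro VF_diff f1 Y)
  have f3: "(\<lambda>q. c *\<^sub>R (Y q - g (Y q) (xi q) *\<^sub>R xi q)) \<in> VF" by (intro VF_scale f2 smooth_map_const)
  have f4: "(\<lambda>q. alpha q *\<^sub>R shp q (Y q)) \<in> VF" by (intro VF_scale shp_VF Y smooth_alpha)
  have f5: "(\<lambda>q. g (shp q (Y q)) (xi q) *\<^sub>R shp q (xi q)) \<in> VF" by (intro VF_scale shp_VF xi_VF f1)
  show ?thesis
    unfolding jac_def
    unfolding D_diff[OF X VF_add[OF f3 f4] f5 p] D_add[OF X f3 f4 p] D_scale[OF smooth_map_const X f2 p]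
      D_diff[OF X Y f1(1) p] D_scale[OF f1(2) X xi_VF p] D_scale[OF smooth_alpha X shp_VF[OF Y] p]
      D_scale[OF f1(3) X shp_VF[OF xi_VF] p] D_shp_xi[OF X p] D_shp[OF X Y p] D_xi[OF X p]
      D_metric[OF X Y xi_VF p] D_metric[OF X shp_VF[OF Y] xi_VF p] dd_alpha[OF X p]
      deriv_within_const[OF VF_in[OF X p]] njac_def
    by (simp add: algebra_simps g.add_left)
qed

text \<open>Inserting \<nabla>\<xi> = \<phi>A into the curvature reduces it to derivatives of \<phi>
  and A. The derivatives of A occur only in a combination evaluated by the Codazzi equation, and
  this yields the summand with factor \<open>c\<close>.\<close>

lemma structure_jacobi_eq:
  assumes Y: "Y \<in> VF" and p: "p \<in> M"
  shows "structure_jacobi D M N Y p = jac p (Y p)"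
proof -
  have y: "Y p \<in> T p" by (rule VF_in[OF Y p])
  have A: "D Y (D xi xi) p = g (shp p (xi p)) (xi p) *\<^sub>R shp p (Y p) - g (shp p (Y p)) (shp p (xi p)) *\<^sub>R xi p
      + phi p (C p (Y p) (xi p) + shp p (phi p (shp p (Y p))))"
    using D_cong[OF Y phi_VF[OF shp_VF[OF xi_VF]] p, of "D xi xi"] D_xi[OF xi_VF]
      D_phi[OF Y shp_VF[OF xi_VF] p] D_shp_xi[OF Y p] by simp
  have B: "D xi (D Y xi) p = g (shp p (Y p)) (xi p) *\<^sub>R shp p (xi p) - g (shp p (xi p)) (shp p (Y p)) *\<^sub>R xi p
      + phi p (C p (xi p) (Y p) + shp p (D xi Y p))"
    using D_cong[OF xi_VF phi_VF[OF shp_VF[OF Y]] p, of "D Y xi"] D_xi[OF Y]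
      D_phi[OF xi_VF shp_VF[OF Y] p] D_shp[OF xi_VF Y p] by simp
  have L: "D (lie_bracket M Y xi) xi p = phi p (shp p (phi p (shp p (Y p)))) - phi p (shp p (D xi Y p))"
    using D_xi[OF lie_bracket_VF[OF Y xi_VF] p] D_torsion[OF Y xi_VF p] D_xi[OF Y p]
    by (metis linear_diff linear_phi linear_shp[OF p])
  have "phi p (C p (Y p) (xi p)) - phi p (C p (xi p) (Y p)) = phi p (C p (Y p) (xi p) - C p (xi p) (Y p))"
    by (simp add: linear_diff[OF linear_phi])
  also have "\<dots> = c *\<^sub>R (Y p - g (Y p) (xi p) *\<^sub>R xi p)"
    unfolding C_codazzi[OF p y xi_in[OF p]]
    using phi_skew[OF p y xi_in[OF p]]
    by (simp add: phi_phi[OF p y] phi_xi[OF p] g_xi_xi[OF p] linear_cmul[OF linear_phi] linear_neg[OF linear_phi] g.zero_right algebra_simps)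
  finally have "phi p (C p (Y p) (xi p)) = c *\<^sub>R (Y p - g (Y p) (xi p) *\<^sub>R xi p) + phi p (C p (xi p) (Y p))"
    by (simp add: algebra_simps)
  then show ?thesis
    unfolding structure_jacobi_def curvature_def xi_def[symmetric] A B L jac_def alpha_def
    by (simp add: linear_add[OF linear_phi] g_sym[of "shp p (Y p)" "shp p (xi p)"])
qed

lemma nabla_structure_jacobi_eq:
  assumes X: "X \<in> VF" and Y: "Y \<in> VF" and p: "p \<in> M"
  shows "nabla_structure_jacobi D M N X Y p = njac p (X p) (Y p)"
  unfolding nabla_structure_jacobi_def structure_jacobi_eq[OF D_VF[OF X Y] p]
  using D_cong[OF X jac_VF[OF Y] p, of "structure_jacobi D M N Y"] structure_jacobi_eq[OF Y] D_jac[OF X Y p]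
  by simp

lemma njac_in: "p \<in> M \<Longrightarrow> njac p x y \<in> T p"
  unfolding njac_def
  by (intro subspace_add subspace_diff subspace_scale subspace_T shp_in phi_in C_in xi_in)

lemma T_eqI:
  assumes p: "p \<in> M" and xy: "x \<in> T p" "y \<in> T p" and eq: "\<And>w. w \<in> T p \<Longrightarrow> g x w = g y w"
  shows "x = y"
proof (rule ccontr)
  have d: "x - y \<in> T p" using xy subspace_T[OF p] by (simp add: subspace_diff)
  assume "x \<noteq> y"
  then show False using g_pos[OF p d] eq[OF d] by (simp add: g.diff_left)
qed

definition codazzi_jac where
  "codazzi_jac k p \<longleftrightarrow> (\<forall>x\<in>T p. \<forall>y\<in>T p. njac p x y - njac p y x =
     k *\<^sub>R ((2 * g (phi p x) y) *\<^sub>R xi p + g y (xi p) *\<^sub>R phi p x - g x (xi p) *\<^sub>R phi p y))"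

text \<open>Both sides depend only on the values of the fields at the point, every tangent vector
  extends to a field, and positivity of the metric removes the third field.\<close>

lemma jacobi_codazzi_identity_iff:
  "jacobi_codazzi_identity c D M N k \<longleftrightarrow> (\<forall>p\<in>M. codazzi_jac k p)"
proof
  assume *: "jacobi_codazzi_identity c D M N k"
  show "\<forall>p\<in>M. codazzi_jac k p"
    unfolding codazzi_jac_def
  proof (intro ballI, rule T_eqI)
    fix p x y assume p: "p \<in> M" and x: "x \<in> T p" and y: "y \<in> T p"
    show "p \<in> M" by fact
    show "njac p x y - njac p y x \<in> T p" using njac_in[OF p] subspace_T[OF p] by (simp add: subspace_diff)
    show "k *\<^sub>R ((2 * g (phi p x) y) *\<^sub>R xi p + g y (xi p) *\<^sub>R phi p x - g x (xi p) *\<^sub>R phi p y) \<in> T p"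
      by (intro subspace_add subspace_diff subspace_scale subspace_T p phi_in xi_in)
    fix w assume w: "w \<in> T p"
    obtain X where X: "X \<in> VF" "X p = x" using extend_VF[OF p x] by blast
    obtain Y where Y: "Y \<in> VF" "Y p = y" using extend_VF[OF p y] by blast
    obtain W where W: "W \<in> VF" "W p = w" using extend_VF[OF p w] by blast
    show "g (njac p x y - njac p y x) w =
      g (k *\<^sub>R ((2 * g (phi p x) y) *\<^sub>R xi p + g y (xi p) *\<^sub>R phi p x - g x (xi p) *\<^sub>R phi p y)) w"
      using *[unfolded jacobi_codazzi_identity_def, rule_format, OF X(1) Y(1) W(1) p]
      by (simp add: nabla_structure_jacobi_eq X Y W p structure_phi_eq x y structure_eta_def xi_def[symmetric]
         g.add_left g.diff_left g.scaleR_left g_sym[of w])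
  qed
next
  assume *: "\<forall>p\<in>M. codazzi_jac k p"
  show "jacobi_codazzi_identity c D M N k"
    unfolding jacobi_codazzi_identity_def
  proof (intro ballI)
    fix X Y W p assume X: "X \<in> VF" and Y: "Y \<in> VF" and W: "W \<in> VF" and p: "p \<in> M"
    note x = VF_in[OF X p] and y = VF_in[OF Y p] and w = VF_in[OF W p]
    show "g (nabla_structure_jacobi D M N X Y p - nabla_structure_jacobi D M N Y X p) (W p) =
        k * (2 * structure_eta c N W p * g (structure_phi c N X p) (Y p)
             + structure_eta c N Y p * g (structure_phi c N X p) (W p)
             - structure_eta c N X p * g (structure_phi c N Y p) (W p))"
      using *[unfolded codazzi_jac_def, rule_format, OF p x y]
      by (simp add: nabla_structure_jacobi_eq X Y p structure_phi_eq x y structure_eta_def xi_def[symmetric]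
         g.add_left g.diff_left g.scaleR_left g_sym[of "W p"])
  qed
qed

text \<open>The definite description ranges over a universally quantified implication. So all
  extensions must give the same value, and at least one extension has to be exhibited, since
  otherwise every \<open>w\<close> would qualify.\<close>

lemma shape_operator_eq:
  assumes Db: "levi_civita (complex_space_form c) g Db" and p: "p \<in> M" and x: "X p \<in> T p"
  shows "shape_operator c Db M N X p = shp p (X p)"
proof -
  let ?Q = "complex_space_form c :: 'n cmat set"
  have tq: "tangent_space (?Q \<inter> U) q = csf_tangent c q" if "open U" "q \<in> ?Q \<inter> U" for U q
    using tangent_space_Int_open[of U q ?Q] tangent_space_csf[of q] that by auto
  have key: "Db V W p = - shp p (X p)"
    if U: "open U" "p \<in> U" and V: "V \<in> vector_fields (?Q \<inter> U)" and W: "W \<in> vector_fields (?Q \<inter> U)"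
      and Vp: "V p = X p" and WN: "\<forall>q\<in>M \<inter> U. W q = N q" for U V W
  proof -
    have pQ: "p \<in> ?Q \<inter> U" using M_csf[OF p] U by blast
    have xQ: "X p \<in> tangent_space (?Q \<inter> U) p" using tq[OF U(1) pQ] T_csf[OF p x] by simp
    have "Db V W p = csf_proj c p (deriv_within (?Q \<inter> U) W p (V p))"
    proof (rule levi_civita_unique[OF levi_civita_Int_open[OF Db U(1)] bounded_bilinear_csf_metric csf_metric_sym])
      show "y = 0" if "q \<in> ?Q \<inter> U" "y \<in> tangent_space (?Q \<inter> U) q"
        "\<And>z. z \<in> tangent_space (?Q \<inter> U) q \<Longrightarrow> g y z = 0" for q y
        using csf_metric_pos[of q y] that tq[OF U(1) that(1)] by fastforce
      show "smooth_map (?Q \<inter> U) (\<lambda>q. csf_proj c q w)" for w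
        by (intro smooth_map_csf_proj smooth_map_ident smooth_map_const)
    qed (use tq[OF U(1)] V W pQ in \<open>auto intro: subspace_csf_tangent proj_in proj_metric\<close>)
    \<comment> \<open>Both derivatives are computed from one smooth extension \<open>G\<close>. As
      \<open>X p\<close> is tangent to \<open>M\<close>, only the values along \<open>M\<close>
      matter, where the extended field is \<open>N\<close>.\<close>
    also have "deriv_within (?Q \<inter> U) W p (V p) = dd N p (X p)"
    proof -
      obtain U' G where G: "open U'" "p \<in> U'" "smooth_on U' G" "\<And>q. q \<in> ?Q \<inter> U \<Longrightarrow> q \<in> U' \<Longrightarrow> G q = W q"
        using smooth_mapE[OF vector_fieldsD(1)[OF W] pQ] by blast
      have "deriv_within (?Q \<inter> U) W p (X p) = frechet_derivative G (at p) (X p)"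
        by (rule deriv_within_extension[OF G(1,2) pQ G(3,4) xQ])
      moreover have "dd N p (X p) = frechet_derivative G (at p) (X p)"
      proof (rule deriv_within_extension[of "U \<inter> U'", OF _ _ p _ _ x])
        show "smooth_on (U \<inter> U') G" using G(3) by (rule smooth_on_subset) blast
        show "G q = N q" if "q \<in> M" "q \<in> U \<inter> U'" for q
          using G(4)[of q] WN M_csf[OF that(1)] that by auto
      qed (use U G in auto)
      ultimately show ?thesis unfolding Vp by simp
    qed
    finally show ?thesis using shp_eq(2)[OF p x] by simp
  qed
  obtain U F where F: "open U" "p \<in> U" "smooth_on U F" "\<And>q. q \<in> M \<Longrightarrow> q \<in> U \<Longrightarrow> F q = N q"
    using smooth_mapE[OF smooth_N p] by blast
  \<comment> \<open>Witnesses for the existence of extensions: a constant matrix and a local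
    extension of \<open>N\<close>, projected to the space form.\<close>
  define V where "V q = csf_proj c q (X p)" for q
  define W where "W q = csf_proj c q (F q)" for q
  have smF: "smooth_map (?Q \<inter> U) F" using F(1,3) by (intro smooth_mapI) auto
  have VW: "V \<in> vector_fields (?Q \<inter> U)" "W \<in> vector_fields (?Q \<inter> U)"
    unfolding vector_fields_def V_def[abs_def] W_def[abs_def]
    using tq[OF F(1)] by (auto intro!: smooth_map_csf_proj smooth_map_ident smooth_map_const smF proj_in)
  have Vp: "V p = X p" unfolding V_def by (rule csf_proj_eqI[OF M_csf[OF p] T_csf[OF p x]])
  have WN: "\<forall>q\<in>M \<inter> U. W q = N q" unfolding W_def using F(4) csf_proj_eqI[OF M_csf N_csf] by simp
  show ?thesis
    unfolding shape_operator_def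
  proof (rule the_equality)
    show "\<forall>U V W. open U \<and> p \<in> U \<and> V \<in> vector_fields (?Q \<inter> U) \<and> W \<in> vector_fields (?Q \<inter> U) \<and>
        V p = X p \<and> (\<forall>q\<in>M \<inter> U. W q = N q) \<longrightarrow> shp p (X p) = - Db V W p"
      using key by fastforce
    fix w assume "\<forall>U V W. open U \<and> p \<in> U \<and> V \<in> vector_fields (?Q \<inter> U) \<and> W \<in> vector_fields (?Q \<inter> U) \<and>
        V p = X p \<and> (\<forall>q\<in>M \<inter> U. W q = N q) \<longrightarrow> w = - Db V W p"
    then have "w = - Db V W p" using F(1,2) VW Vp WN by blast
    then show "w = shp p (X p)" using key[OF F(1,2) VW Vp WN] by simp
  qed
qed

end

section \<open>Pointwise consequences of the identity\<close>

context hypersurface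
begin

definition uu where "uu p = shp p (xi p) - alpha p *\<^sub>R xi p"
definition vv where "vv p = phi p (uu p)"
definition hh where "hh p = g (uu p) (uu p)"
definition perp where "perp p = {x \<in> T p. g x (xi p) = 0 \<and> g x (uu p) = 0 \<and> g x (vv p) = 0}"
text \<open>The covariant derivative of \<open>uu\<close>; see \<open>D_uu\<close>.\<close>

definition nabla_uu where
  "nabla_uu p x = C p x (xi p) + shp p (phi p (shp p x)) - dalpha p x *\<^sub>R xi p - alpha p *\<^sub>R phi p (shp p x)"

context
  fixes p assumes p: "p \<in> M"
begin

abbreviation A where "A \<equiv> shp p"
abbreviation F where "F \<equiv> phi p"
abbreviation \<xi> where "\<xi> \<equiv> xi p"
abbreviation a where "a \<equiv> alpha p"
abbreviation u where "u \<equiv> uu p"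
abbreviation v where "v \<equiv> vv p"
abbreviation h where "h \<equiv> hh p"
abbreviation W where "W \<equiv> perp p"
abbreviation nu where "nu \<equiv> nabla_uu p"

lemmas lin = linear_add[OF linear_shp[OF p]] linear_diff[OF linear_shp[OF p]] linear_cmul[OF linear_shp[OF p]]
  linear_neg[OF linear_shp[OF p]] linear_0[OF linear_shp[OF p]]
  linear_add[OF linear_phi[of p]] linear_diff[OF linear_phi[of p]] linear_cmul[OF linear_phi[of p]]
  linear_neg[OF linear_phi[of p]] linear_0[OF linear_phi[of p]]
  g.add_left g.add_right g.diff_left g.diff_right g.scaleR_left g.scaleR_right g.minus_left g.minus_right
  g.zero_left g.zero_right

lemmas mem = shp_in[OF p] phi_in[OF p] xi_in[OF p] C_in[OF p] njac_in[OF p]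
  subspace_add[OF subspace_T[OF p]] subspace_diff[OF subspace_T[OF p]] subspace_scale[OF subspace_T[OF p]]
  subspace_neg[OF subspace_T[OF p]]

lemma u_in: "u \<in> T p" and v_in: "v \<in> T p"
  unfolding uu_def vv_def by (auto intro!: mem)

lemma jac_in: "x \<in> T p \<Longrightarrow> jac p x \<in> T p"
  unfolding jac_def by (intro mem)

lemma eq0I: "x \<in> T p \<Longrightarrow> (\<And>y. y \<in> T p \<Longrightarrow> g x y = 0) \<Longrightarrow> x = 0"
  using g_pos[OF p, of x] by force

lemma g_F_xi: "x \<in> T p \<Longrightarrow> g (F x) \<xi> = 0" "x \<in> T p \<Longrightarrow> g \<xi> (F x) = 0"
  using phi_skew[OF p _ xi_in[OF p], of x] g_sym[of \<xi> "F x"] by (simp_all add: phi_xi[OF p] lin)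

lemma A_xi: "A \<xi> = a *\<^sub>R \<xi> + u" by (simp add: uu_def)

lemma g_u_xi: "g u \<xi> = 0" "g \<xi> u = 0"
  using g_sym[of \<xi> u] by (simp_all add: uu_def lin alpha_def g_xi_xi[OF p])

lemma g_v_xi: "g v \<xi> = 0" "g \<xi> v = 0"
  unfolding vv_def by (rule g_F_xi[OF u_in])+

lemma g_u_v: "g u v = 0" "g v u = 0"
  using phi_skew[OF p u_in u_in] g_sym[of u "F u"] by (simp_all add: vv_def)

lemma F_v: "F v = - u"
  by (simp add: vv_def phi_phi[OF p u_in] g_u_xi)

lemma g_F_F: "x \<in> T p \<Longrightarrow> y \<in> T p \<Longrightarrow> g (F x) (F y) = g x y - g x \<xi> * g y \<xi>"
  using phi_skew[OF p _ phi_in[OF p], of x y] by (simp add: phi_phi[OF p] lin)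

lemma g_v_v: "g v v = h"
  using g_F_F[OF u_in u_in] by (simp add: vv_def hh_def g_u_xi)

lemma F_A_xi: "F (A \<xi>) = v"
  by (simp add: A_xi lin phi_xi[OF p] vv_def)

lemma A_sym: "x \<in> T p \<Longrightarrow> y \<in> T p \<Longrightarrow> g (A x) y = g x (A y)"
  by (rule shp_sym[OF p])

lemma g_A_u_xi: "g (A u) \<xi> = h"
  using A_sym[OF u_in xi_in[OF p]] by (simp add: A_xi lin g_u_xi hh_def)

lemma jac_sym: "x \<in> T p \<Longrightarrow> y \<in> T p \<Longrightarrow> g (jac p x) y = g x (jac p y)"
  unfolding jac_def using A_sym[of x y] A_sym[of x \<xi>] A_sym[of y \<xi>] g_sym[of \<xi> y] g_sym[of y "A \<xi>"] mem
  by (simp add: lin)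

lemma linear_jac: "linear (jac p)"
  unfolding jac_def by (rule linearI) (simp_all add: lin algebra_simps)

lemma jac_xi: "jac p \<xi> = 0"
  unfolding jac_def by (simp add: g_xi_xi[OF p] alpha_def)

text \<open>Reflects that \<open>R\<^sub>\<xi>\<close> is symmetric and annihilates \<xi>: the
  derivative of g(R y, \<xi>) = 0 moves onto \<xi>, whose derivative is \<phi>A.\<close>

lemma njac_g_xi:
  assumes x: "x \<in> T p" and y: "y \<in> T p"
  shows "g (njac p x y) \<xi> = - g y (jac p (F (A x)))"
proof -
  define w where "w = F (A x)"
  have w: "w \<in> T p" "g w \<xi> = 0" unfolding w_def by (auto intro!: mem g_F_xi)
  show ?thesis
    unfolding njac_def jac_def dalpha_def w_def[symmetric]
    using w A_sym[OF y w(1)] A_sym[OF w(1) xi_in[OF p]] A_sym[OF y xi_in[OF p]] g_sym[of "A \<xi>" w] g_sym[of "A y" w]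
    by (simp add: lin g_xi_xi[OF p] alpha_def[symmetric] algebra_simps)
qed

section \<open>Action of A and of the structure Jacobi operator on u, v and W\<close>

context
  fixes k :: real
  assumes K: "codazzi_jac k p"
begin

lemmas codazzi_jacD = K[unfolded codazzi_jac_def, rule_format]

lemma jac_phi_shp:
  assumes x: "x \<in> T p" and y: "y \<in> T p"
  shows "g (jac p (F (A x))) y - g (jac p (F (A y))) x = - 2 * k * g (F x) y"
  using arg_cong[OF codazzi_jacD[OF x y], of "\<lambda>z. g z \<xi>"] njac_g_xi[OF x y] njac_g_xi[OF y x]
    g_F_xi[OF x] g_F_xi[OF y] g_sym[of y "jac p (F (A x))"] g_sym[of x "jac p (F (A y))"]
  by (simp add: lin g_xi_xi[OF p])

text \<open>For \<open>x = \<xi>\<close> in \<open>jac_phi_shp\<close> the vector \<phi>Ax is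
  \<open>v\<close>, the right-hand side vanishes, and so does the second term because the image of
  \<open>jac p\<close> is orthogonal to \<xi>.\<close>

lemma jac_v: "jac p v = 0"
proof (rule eq0I)
  show "jac p v \<in> T p" by (rule jac_in[OF v_in])
  fix y assume y: "y \<in> T p"
  have "g (jac p (F (A y))) \<xi> = 0" using jac_sym[of "F (A y)" \<xi>] mem by (simp add: jac_xi lin)
  then show "g (jac p v) y = 0"
    using jac_phi_shp[OF xi_in[OF p] y] by (simp add: F_A_xi phi_xi[OF p] lin)
qed

lemma alpha_A_v: "a *\<^sub>R A v = - c *\<^sub>R v"
  using jac_v A_sym[OF v_in xi_in[OF p]] by (simp add: jac_def A_xi lin g_v_xi g_u_v eq_neg_iff_add_eq_0 add.commute)

text \<open>Taking \<open>x = v\<close> in \<open>jac_phi_shp\<close> gives the value of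
  \<open>jac p\<close> on \<phi>Av. Multiplication by \<alpha> replaces Av by a multiple of v, and
  \<phi>v = -u.\<close>

lemma jac_u: "jac p u = (2 * k * c * a) *\<^sub>R u"
proof -
  have "jac p (F (A v)) - (2 * k) *\<^sub>R u = 0"
  proof (rule eq0I)
    show "jac p (F (A v)) - (2 * k) *\<^sub>R u \<in> T p" by (intro mem jac_in u_in)
    fix y assume y: "y \<in> T p"
    have "g (jac p (F (A y))) v = 0" using jac_sym[of "F (A y)" v] v_in mem by (simp add: jac_v lin)
    then show "g (jac p (F (A v)) - (2 * k) *\<^sub>R u) y = 0"
      using jac_phi_shp[OF v_in y] by (simp add: F_v lin)
  qed
  then have "a *\<^sub>R jac p (F (A v)) = (2 * k * a) *\<^sub>R u" by simp
  moreover have "a *\<^sub>R jac p (F (A v)) = jac p (F (a *\<^sub>R A v))"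
    by (simp add: lin linear_cmul[OF linear_jac])
  ultimately have "c *\<^sub>R jac p u = (2 * k * a) *\<^sub>R u"
    by (simp add: alpha_A_v lin F_v linear_cmul[OF linear_jac])
  then have "c *\<^sub>R (c *\<^sub>R jac p u) = c *\<^sub>R ((2 * k * a) *\<^sub>R u)" by simp
  then show ?thesis by (simp add: cc mult_ac)
qed

lemma alpha_A_u: "a *\<^sub>R A u = (a * h) *\<^sub>R \<xi> + (h - c + 2 * k * c * a) *\<^sub>R u"
proof -
  have "g (A u) \<xi> = h" using A_sym[OF u_in xi_in[OF p]] by (simp add: A_xi lin g_u_xi hh_def)
  then have "jac p u = c *\<^sub>R u + a *\<^sub>R A u - (h * a) *\<^sub>R \<xi> - h *\<^sub>R u"
    by (simp add: jac_def g_u_xi A_xi algebra_simps)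
  then show ?thesis using jac_u by (simp add: algebra_simps)
qed

text \<open>If \<alpha> = 0 then \<open>alpha_A_v\<close> forces v = 0, hence u = -\<phi>v = 0. This
  permits division by \<alpha> on the non-Hopf set.\<close>

lemma alpha_nonzero: "u \<noteq> 0 \<Longrightarrow> a \<noteq> 0"
proof
  assume "u \<noteq> 0" "a = 0"
  then have "v = 0" using alpha_A_v c by auto
  then show False using F_v \<open>u \<noteq> 0\<close> by (simp add: lin)
qed

lemma h_pos: "u \<noteq> 0 \<Longrightarrow> h > 0"
  unfolding hh_def by (rule g_pos[OF p u_in])

lemma subspace_W: "subspace W"
  unfolding perp_def subspace_def using subspace_T[OF p]
  by (auto simp: lin subspace_0 subspace_add subspace_scale)

lemma W_D: "x \<in> W \<Longrightarrow> x \<in> T p" "x \<in> W \<Longrightarrow> g x \<xi> = 0" "x \<in> W \<Longrightarrow> g x u = 0" "x \<in> W \<Longrightarrow> g x v = 0"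
  "x \<in> W \<Longrightarrow> g \<xi> x = 0" "x \<in> W \<Longrightarrow> g u x = 0" "x \<in> W \<Longrightarrow> g v x = 0"
  unfolding perp_def by (auto simp: g_sym)

lemma F_W: "x \<in> W \<Longrightarrow> F x \<in> W"
proof -
  assume x: "x \<in> W"
  note W_D[OF x]
  then show ?thesis
    using phi_skew[OF p W_D(1)[OF x] u_in] phi_skew[OF p W_D(1)[OF x] v_in]
    by (simp add: perp_def mem g_F_xi vv_def[symmetric] F_v lin)
qed

text \<open>The vectors A\<xi>, \<alpha>Au and \<alpha>Av lie in the span of \<xi>, u, v, and
  \<alpha> is nonzero; symmetry of A transfers the invariance to the complement.\<close>

lemma A_W: "x \<in> W \<Longrightarrow> u \<noteq> 0 \<Longrightarrow> A x \<in> W"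
proof -
  assume x: "x \<in> W" and u: "u \<noteq> 0"
  note W_D[OF x]
  moreover have "a * g (A x) u = g x (a *\<^sub>R A u)" "a * g (A x) v = g x (a *\<^sub>R A v)"
    using A_sym[OF W_D(1)[OF x] u_in] A_sym[OF W_D(1)[OF x] v_in] by (simp_all add: lin)
  ultimately show ?thesis
    using A_sym[OF W_D(1)[OF x] xi_in[OF p]] alpha_nonzero[OF u]
    unfolding alpha_A_u alpha_A_v by (simp add: perp_def mem A_xi lin)
qed

lemma W_eqI: "x \<in> W \<Longrightarrow> y \<in> W \<Longrightarrow> (\<And>z. z \<in> W \<Longrightarrow> g x z = g y z) \<Longrightarrow> x = y"
proof -
  assume xy: "x \<in> W" "y \<in> W" and eq: "\<And>z. z \<in> W \<Longrightarrow> g x z = g y z"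
  have d: "x - y \<in> W" using xy subspace_W by (simp add: subspace_diff)
  have "g (x - y) (x - y) = 0" using eq[OF d] by (simp add: lin)
  then show ?thesis using g_pos[OF p W_D(1)[OF d]] by fastforce
qed

lemma codazzi_W:
  assumes x: "x \<in> W" and y: "y \<in> W"
  shows "C p x y - C p y x = (- 2 * c * g (F x) y) *\<^sub>R \<xi>"
  unfolding C_codazzi[OF p W_D(1)[OF x] W_D(1)[OF y]] using W_D[OF x] W_D[OF y] by simp

lemma g_skew_W: "x \<in> T p \<Longrightarrow> y \<in> T p \<Longrightarrow> g (F y) x = - g (F x) y"
  using phi_skew[OF p, of y x] g_sym[of y "F x"] by simp

text \<open>On W the antisymmetrised derivative of A is a multiple of \<xi>. In the u-component of
  the identity it therefore survives only next to A\<xi>, with the factor \<open>h\<close>, which is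
  divided out.\<close>

lemma AFA_W:
  assumes u: "u \<noteq> 0" and x: "x \<in> W"
  shows "A (F (A x)) = c *\<^sub>R F x"
proof (rule W_eqI)
  show "A (F (A x)) \<in> W" "c *\<^sub>R F x \<in> W" using x u A_W F_W subspace_W by (auto intro: subspace_scale)
  fix y assume y: "y \<in> W"
  note Wx = W_D[OF x] W_D[OF A_W[OF x u]] and Wy = W_D[OF y] W_D[OF A_W[OF y u]]
  have 1: "g (njac p x y) u - g (njac p y x) u = 0"
    using arg_cong[OF codazzi_jacD[OF Wx(1) Wy(1)], of "\<lambda>z. g z u"] Wx Wy by (simp add: lin g_u_xi)
  have n: "g (njac p x y) u = a * g (C p x y) u - h * (g (C p x y) \<xi> + g (A y) (F (A x)))"
    if "x \<in> W" "y \<in> W" for x y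
    unfolding njac_def using W_D[OF that(2)] W_D[OF A_W[OF that(2) u]]
    by (simp add: lin g_u_xi A_xi hh_def)
  have "a * g (C p x y - C p y x) u - h * (g (C p x y - C p y x) \<xi> + g (A y) (F (A x)) - g (A x) (F (A y))) = 0"
    using 1 n[OF x y] n[OF y x] by (simp add: lin algebra_simps)
  moreover have "g (A y) (F (A x)) = g (A (F (A x))) y" "g (A x) (F (A y)) = - g (A (F (A x))) y"
    using A_sym[of "F (A x)" y] phi_skew[OF p, of "A x" "A y"] Wy mem g_sym[of "A y"] by simp_all
  ultimately have "h * (g (A (F (A x))) y - c * g (F x) y) = 0"
    unfolding codazzi_W[OF x y] by (auto simp: lin g_u_xi g_xi_xi[OF p] algebra_simps)
  then show "g (A (F (A x))) y = g (c *\<^sub>R F x) y" using h_pos[OF u] by (simp add: lin)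
qed

lemma jac_W: "x \<in> W \<Longrightarrow> u \<noteq> 0 \<Longrightarrow> jac p x = c *\<^sub>R x + a *\<^sub>R A x"
  using W_D[of x] W_D[OF A_W[of x]] by (simp add: jac_def)

text \<open>On W the structure Jacobi operator is c + \<alpha>A, so \<open>jac_phi_shp\<close>
  becomes a relation between \<phi>A and A\<phi> once A\<phi>A is replaced by c\<phi>.\<close>

lemma FA_AF_W:
  assumes u: "u \<noteq> 0" and x: "x \<in> W"
  shows "F (A x) + A (F x) = (- 2 * (k * c + a)) *\<^sub>R F x"
proof (rule W_eqI)
  show "F (A x) + A (F x) \<in> W" "(- 2 * (k * c + a)) *\<^sub>R F x \<in> W"
    by (intro subspace_add[OF subspace_W] subspace_scale[OF subspace_W] F_W A_W x u)+
  fix y assume y: "y \<in> W"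
  have j: "jac p (F (A z)) = c *\<^sub>R F (A z) + (a * c) *\<^sub>R F z" if "z \<in> W" for z
    using jac_W[OF F_W[OF A_W[OF that u]] u] AFA_W[OF u that] by simp
  have "g (F (A y)) x = - g (A (F x)) y"
    using g_skew_W[of x "A y"] A_sym[of "F x" y] W_D[OF x] W_D[OF y] mem g_sym[of "A y"] by simp
  then have "c * (g (F (A x)) y + g (A (F x)) y) + 2 * (a * c) * g (F x) y = - 2 * k * g (F x) y"
    using jac_phi_shp[OF W_D(1)[OF x] W_D(1)[OF y]] g_skew_W[OF W_D(1)[OF x] W_D(1)[OF y]]
    unfolding j[OF x] j[OF y] by (simp add: lin algebra_simps)
  then have "c * (c * (g (F (A x)) y + g (A (F x)) y) + 2 * (a * c) * g (F x) y) = c * (- 2 * k * g (F x) y)" by simp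
  then show "g (F (A x) + A (F x)) y = g ((- 2 * (k * c + a)) *\<^sub>R F x) y"
    by (simp add: lin algebra_simps cc)
qed

lemma nu_in: "nu x \<in> T p" unfolding nabla_uu_def by (intro mem)

text \<open>The identity with second argument \<xi>, tested on W and solved for the derivative of A
  applied to \<xi>.\<close>

lemma C_xi_W:
  assumes u: "u \<noteq> 0" and x: "x \<in> W" and y: "y \<in> W"
  shows "a * g (C p x \<xi>) y = - dalpha p \<xi> * g (A x) y - c * g (F (A x)) y - (2 * a * c + k) * g (F x) y"
proof -
  note Wx = W_D[OF x] W_D[OF A_W[OF x u]] and Wy = W_D[OF y]
  have 1: "g (njac p x \<xi>) y - g (njac p \<xi> x) y = k * g (F x) y"
    using arg_cong[OF codazzi_jacD[OF Wx(1) xi_in[OF p]], of "\<lambda>z. g z y"] Wx Wy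
    by (simp add: lin phi_xi[OF p] g_F_xi g_xi_xi[OF p])
  have 2: "g (njac p x \<xi>) y = - c * g (F (A x)) y - a * c * g (F x) y"
    unfolding njac_def using Wy by (simp add: lin A_xi g_xi_xi[OF p] g_u_xi AFA_W[OF u x] algebra_simps)
  have 3: "g (njac p \<xi> x) y = dalpha p \<xi> * g (A x) y + a * g (C p \<xi> x) y"
    unfolding njac_def using Wx Wy by (simp add: lin F_A_xi) (simp add: A_xi lin Wy)
  have d: "C p x \<xi> - C p \<xi> x = - c *\<^sub>R F x"
    using C_codazzi[OF p Wx(1) xi_in[OF p]] Wx by (simp add: g_xi_xi[OF p] g_F_xi)
  have 4: "g (C p \<xi> x) y = g (C p x \<xi>) y + c * g (F x) y"
    using arg_cong[OF d, of "\<lambda>z. g z y"] by (simp add: lin)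
  show ?thesis using 1 unfolding 2 3 4 by (simp add: algebra_simps)
qed

text \<open>The W-part of \<nabla>u is known from \<open>C_xi_W\<close>, and the derivative of the
  eigenvalue equation for u gives a second relation for it. Antisymmetrising the latter eliminates
  the derivatives of A and leaves numbers only.\<close>

lemma alpha_cubic:
  assumes u: "u \<noteq> 0" and x: "x \<in> W" and x0: "x \<noteq> 0"
    and Du: "\<And>x. x \<in> T p \<Longrightarrow> njac p x u + jac p (nu x) = (2 * k * c * dalpha p x) *\<^sub>R u + (2 * k * c * a) *\<^sub>R nu x"
  shows "2 * k * a ^ 3 + (2 * k\<^sup>2 * c - 1) * a\<^sup>2 - 3 * k * c * a + c - k\<^sup>2 = 0"
proof -
  define d where "d = dalpha p \<xi>"
  \<comment> \<open>The unknown \<open>d\<close> multiplies an expression that is symmetric under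
    the later exchange of the two vectors, and so drops out.\<close>
  have w: "a * g (nu x) z = - d * g (A x) z - (c + a * a) * g (F (A x)) z - (a * c + k) * g (F x) z"
    if "x \<in> W" "z \<in> W" for x z
  proof -
    have "a * g (nu x) z = a * g (C p x \<xi>) z + a * c * g (F x) z - a * a * g (F (A x)) z"
      unfolding nabla_uu_def AFA_W[OF u that(1)] using W_D[OF that(2)] by (simp add: lin algebra_simps)
    then show ?thesis using C_xi_W[OF u that] by (simp add: d_def algebra_simps)
  qed
  \<comment> \<open>The \<open>y\<close>-component of the differentiated equation
    \<open>R\<^sub>\<xi>u = 2kc\<alpha>u\<close>.\<close>
  have E: "a * g (C p x u) y - h * (g (C p x \<xi>) y + c * g (F x) y) + (c - 2 * k * c * a) * g (nu x) y + a * g (nu x) (A y) = 0"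
    if x: "x \<in> W" and y: "y \<in> W" for x y
  proof -
    note Wy = W_D[OF y] W_D[OF A_W[OF y u]]
    have "g (A u) y = 0" using A_sym[OF u_in Wy(1)] Wy by simp
    then have "g (njac p x u) y = a * g (C p x u) y - h * (g (C p x \<xi>) y + c * g (F x) y)"
      unfolding njac_def using Wy by (simp add: lin A_xi g_u_xi g_A_u_xi[unfolded A_xi] AFA_W[OF u x])
    moreover have "g (jac p (nu x)) y = c * g (nu x) y + a * g (nu x) (A y)"
      unfolding jac_sym[OF nu_in Wy(1)] jac_W[OF y u] by (simp add: lin)
    ultimately show ?thesis
      using arg_cong[OF Du[OF W_D(1)[OF x]], of "\<lambda>z. g z y"] Wy by (simp add: lin algebra_simps)
  qed
  \<comment> \<open>With this choice, A\<phi>A = c\<phi> reduces everything to \<open>s\<close> and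
    \<open>q1 + q2\<close>, and \<open>FA_AF_W\<close> evaluates the sum.\<close>
  define y where "y = F x"
  define s where "s = g y y"
  have y: "y \<in> W" unfolding y_def by (rule F_W[OF x])
  note Wx = W_D[OF x] W_D[OF A_W[OF x u]] and Wy = W_D[OF y] W_D[OF A_W[OF y u]]
  have s: "s > 0" using g_F_F[OF Wx(1) Wx(1)] g_pos[OF p Wx(1) x0] Wx unfolding s_def y_def by simp
  define q1 q2 where "q1 = g (F (A x)) y" and "q2 = g (A (F x)) y"
  have q: "q1 + q2 = - 2 * (k * c + a) * s"
    using arg_cong[OF FA_AF_W[OF u x], of "\<lambda>z. g z y"] by (simp add: lin q1_def q2_def s_def y_def)
  have f: "g (A y) x = g (A x) y" "g (F (A y)) x = - q2" "g (F y) x = - s" "g (F x) y = s" "g (A y) (A x) = g (A x) (A y)"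
    "g (F (A x)) (A y) = c * s" "g (F x) (A y) = q2" "g (F (A y)) (A x) = - c * s" "g (F y) (A x) = - q1"
    using A_sym[OF Wy(1) Wx(1)] g_sym[of y "A x"] g_skew_W[OF Wx(1) mem(1), of y] g_sym[of "A y" "F x"]
      g_skew_W[OF Wx(1) Wy(1)] g_sym[of "A y" "A x"] A_sym[OF mem(2) Wy(1), of "A x"] A_sym[OF mem(2) Wy(1), of x]
      A_sym[OF mem(2) Wx(1), of "A y"] g_skew_W[OF mem(1) Wy(1), of x] AFA_W[OF u x] AFA_W[OF u y] A_sym[OF mem(2) Wx(1)]
    by (simp_all add: q1_def q2_def s_def y_def[symmetric] lin)
  have cz: "g (C p x u) y - g (C p y u) x = 0" "g (C p x \<xi>) y - g (C p y \<xi>) x = - 2 * c * s"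
    using arg_cong[OF codazzi_W[OF x y], of "g u"] arg_cong[OF codazzi_W[OF x y], of "g \<xi>"]
      C_sym[OF p Wx(1) u_in Wy(1)] C_sym[OF p Wy(1) u_in Wx(1)]
      C_sym[OF p Wx(1) xi_in[OF p] Wy(1)] C_sym[OF p Wy(1) xi_in[OF p] Wx(1)] f
    by (simp_all add: lin g_u_xi g_xi_xi[OF p])
  have "a * (g (C p x u) y - g (C p y u) x) - h * ((g (C p x \<xi>) y - g (C p y \<xi>) x) + 2 * c * s)
      + (c - 2 * k * c * a) * (g (nu x) y - g (nu y) x) + a * (g (nu x) (A y) - g (nu y) (A x)) = 0"
    using E[OF x y] E[OF y x] unfolding f by (simp add: algebra_simps)
  then have e: "(c - 2 * k * c * a) * (g (nu x) y - g (nu y) x) + a * (g (nu x) (A y) - g (nu y) (A x)) = 0"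
    unfolding cz by simp
  have "(c - 2 * k * c * a) * (a * g (nu x) y - a * g (nu y) x) + a * (a * g (nu x) (A y) - a * g (nu y) (A x))
    = a * ((c - 2 * k * c * a) * (g (nu x) y - g (nu y) x) + a * (g (nu x) (A y) - g (nu y) (A x)))"
    by (simp add: algebra_simps)
  also have "\<dots> = 0" unfolding e by simp
  finally have "(c - 2 * k * c * a) * (a * g (nu x) y - a * g (nu y) x) + a * (a * g (nu x) (A y) - a * g (nu y) (A x)) = 0" .
  then have "(c - 2 * k * c * a) * (- (c + a * a) * (q1 + q2) - (a * c + k) * (2 * s))
     + a * (- (c + a * a) * (2 * c * s) - (a * c + k) * (q1 + q2)) = 0"
    unfolding w[OF x y] w[OF y x] w[OF x A_W[OF y u]] w[OF y A_W[OF x u]] f q1_def[symmetric]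
    by (simp add: algebra_simps)
  then have "s * (- 2 * c * a) * (2 * k * a ^ 3 + (2 * k\<^sup>2 * c - 1) * a\<^sup>2 - 3 * k * c * a + c - k\<^sup>2) = 0"
    unfolding q using c by (elim disjE) (simp_all add: algebra_simps power2_eq_square power3_eq_cube)
  then show ?thesis using s alpha_nonzero[OF u] c by auto
qed

section \<open>Non-Hopf points at which the differential of \<alpha> vanishes\<close>

context
  assumes u: "u \<noteq> 0" and da: "\<And>x. x \<in> T p \<Longrightarrow> dalpha p x = 0"
begin

text \<open>Written out, d\<alpha> = 0 says that the derivative of A at \<xi> applied to \<xi> is
  2Av; multiplied by \<alpha>, this is a multiple of v.\<close>

lemma alpha_C_xi_xi: "a *\<^sub>R C p \<xi> \<xi> = (- 2 * c) *\<^sub>R v"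
proof -
  have "a *\<^sub>R C p \<xi> \<xi> - (- 2 * c) *\<^sub>R v = 0"
  proof (rule eq0I)
    show "a *\<^sub>R C p \<xi> \<xi> - (- 2 * c) *\<^sub>R v \<in> T p" by (intro mem v_in)
    fix y assume y: "y \<in> T p"
    have "g (C p \<xi> \<xi>) y = g (C p \<xi> y) \<xi>"
      using C_sym[OF p xi_in[OF p] xi_in[OF p] y] g_sym by simp
    also have "\<dots> = g (C p y \<xi>) \<xi>"
      using arg_cong[OF C_codazzi[OF p xi_in[OF p] y], of "\<lambda>z. g z \<xi>"] y
      by (simp add: lin g_F_xi phi_xi[OF p] g_xi_xi[OF p])
    also have "\<dots> = - 2 * g (F (A y)) u"
      using da[OF y] A_sym[OF mem(2) xi_in[OF p], of "A y"] g_sym[of u "F (A y)"] unfolding dalpha_def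
      by (simp add: lin A_xi g_F_xi mem)
    also have "\<dots> = 2 * g y (A v)"
      using phi_skew[OF p mem(1) u_in, of y] A_sym[OF y v_in] by (simp add: vv_def)
    finally have "a * g (C p \<xi> \<xi>) y = 2 * g y (a *\<^sub>R A v)" by (simp add: lin)
    then show "g (a *\<^sub>R C p \<xi> \<xi> - (- 2 * c) *\<^sub>R v) y = 0"
      unfolding alpha_A_v by (simp add: lin g_sym[of y])
  qed
  then show ?thesis by (simp add: eq_neg_iff_add_eq_0)
qed

lemma alpha_nu_xi: "a *\<^sub>R nu \<xi> = (- (3 * c + a * a)) *\<^sub>R v"
proof -
  have "a *\<^sub>R nu \<xi> = a *\<^sub>R C p \<xi> \<xi> + a *\<^sub>R A v - (a * a) *\<^sub>R v"
    unfolding nabla_uu_def F_A_xi da[OF xi_in[OF p]] by (simp add: algebra_simps)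
  also have "\<dots> = (- 2 * c + - c - a * a) *\<^sub>R v"
    unfolding alpha_C_xi_xi alpha_A_v by (simp only: scaleR_left_distrib scaleR_left_diff_distrib)
  also have "- 2 * c + - c - a * a = - (3 * c + a * a)" by simp
  finally show ?thesis .
qed

text \<open>The u-component of the identity for the pair v, \<xi>. Both covariant derivatives of the
  operator follow from differentiating its kernel equations for v and \<xi>, and
  \<open>jac_u\<close> evaluates what remains.\<close>

lemma alpha_quadratic:
  assumes Dv: "\<And>x. x \<in> T p \<Longrightarrow> njac p x v + jac p (F (nu x)) = 0"
    and Dx: "\<And>x. x \<in> T p \<Longrightarrow> njac p x \<xi> + jac p (F (A x)) = 0"
  shows "k * (5 + 2 * c * a\<^sup>2) = 0"
proof -
  have 1: "g (njac p v \<xi>) u - g (njac p \<xi> v) u = - k * h"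
    using arg_cong[OF codazzi_jacD[OF v_in xi_in[OF p]], of "\<lambda>z. g z u"]
    by (simp add: lin phi_xi[OF p] g_u_xi g_v_xi g_xi_xi[OF p] F_v hh_def)
  have j: "g (jac p x) u = 2 * k * c * (a * g x u)" if "x \<in> T p" for x
    using jac_sym[OF that u_in] unfolding jac_u by (simp add: lin)
  have "a * g (F (A v)) u = g (F (a *\<^sub>R A v)) u" by (simp add: lin)
  also have "\<dots> = c * h" unfolding alpha_A_v by (simp add: lin F_v hh_def)
  finally have 2: "g (njac p v \<xi>) u = - 2 * k * c * (c * h)"
    using arg_cong[OF Dx[OF v_in], of "\<lambda>z. g z u"] j[of "F (A v)"] by (simp add: lin mem)
  have "a * g (F (nu \<xi>)) u = g (F (a *\<^sub>R nu \<xi>)) u" by (simp add: lin)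
  also have "\<dots> = (3 * c + a * a) * h" unfolding alpha_nu_xi by (simp add: lin F_v hh_def algebra_simps)
  finally have 3: "g (njac p \<xi> v) u = - 2 * k * c * ((3 * c + a * a) * h)"
    using arg_cong[OF Dv[OF xi_in[OF p]], of "\<lambda>z. g z u"] j[of "F (nu \<xi>)"] by (simp add: lin mem)
  have "h * (k * (5 + 2 * c * a\<^sup>2)) = 0"
    using 1 unfolding 2 3 by (simp add: algebra_simps power2_eq_square cc)
  then show ?thesis using h_pos[OF u] by simp
qed

context
  assumes Du: "\<And>x. x \<in> T p \<Longrightarrow> njac p x u + jac p (nu x) = (2 * k * c * a) *\<^sub>R nu x"
begin

lemma g_A_xi_v: "g (A \<xi>) v = 0"
  by (simp add: A_xi lin g_v_xi g_u_v)

lemma g_A_u_v: "g (A u) v = 0"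
proof -
  have "a * g (A u) v = g (a *\<^sub>R A u) v" by (simp add: lin)
  then show ?thesis using alpha_nonzero[OF u] unfolding alpha_A_u by (simp add: lin g_v_xi g_u_v)
qed

text \<open>The u-component of the identity for the pair u, v forces \<nabla>_u u to be orthogonal
  to v. Expanding this component, with the Codazzi equation and the derivative in direction \<xi>,
  gives a relation free of derivatives of A.\<close>

lemma hh_alpha_relation:
  assumes Dv: "\<And>x. x \<in> T p \<Longrightarrow> njac p x v + jac p (F (nu x)) = 0" and k: "k \<noteq> 0"
  shows "h * (4 * c + a\<^sup>2) + 8 * k * a + 4 * k * c * a ^ 3 - 1 = 0"
proof -
  note a0 = alpha_nonzero[OF u] and h0 = h_pos[OF u]
  define m where "m = h - c + 2 * k * c * a"
  have 1: "g (njac p u v) u - g (njac p v u) u = 0"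
    using arg_cong[OF codazzi_jacD[OF u_in v_in], of "\<lambda>z. g z u"] by (simp add: lin g_u_xi g_v_xi)
  have j: "g (jac p x) u = 2 * k * c * a * g x u" if "x \<in> T p" for x
    using jac_sym[OF that u_in] unfolding jac_u by (simp add: lin)
  have "g (njac p u v) u = 2 * k * c * a * g (nu u) v"
    using arg_cong[OF Dv[OF u_in], of "\<lambda>z. g z u"] j[of "F (nu u)"] phi_skew[OF p nu_in u_in, of u] mem
    by (simp add: lin vv_def)
  moreover have "g (njac p v u) u = 0"
    using arg_cong[OF Du[OF v_in], of "\<lambda>z. g z u"] j[OF nu_in, of v] by (simp add: lin)
  \<comment> \<open>The remaining factor \<open>2 * k * c * a\<close> can be cancelled because
    \<open>k\<close> is nonzero.\<close>
  ultimately have nuv: "g (nu u) v = 0" using 1 a0 k c by auto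
  have FAu: "a *\<^sub>R F (A u) = m *\<^sub>R v"
  proof -
    have "a *\<^sub>R F (A u) = F (a *\<^sub>R A u)" by (simp add: lin)
    also have "\<dots> = m *\<^sub>R v" unfolding alpha_A_u m_def by (simp add: lin phi_xi[OF p] vv_def)
    finally show ?thesis .
  qed
  have e1: "a * a * g (A (F (A u))) v = - c * m * h"
  proof -
    have "a * a * g (A (F (A u))) v = g (a *\<^sub>R F (A u)) (a *\<^sub>R A v)"
      using A_sym[OF mem(2) v_in, of "A u"] by (simp add: lin)
    then show ?thesis unfolding FAu alpha_A_v by (simp add: lin g_v_v)
  qed
  have e2: "a * g (F (A u)) v = m * h"
    using arg_cong[OF FAu, of "\<lambda>z. g z v"] by (simp add: lin g_v_v)
  have e3: "g (C p u \<xi>) v = g (C p \<xi> u) v - c * h"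
    using arg_cong[OF C_codazzi[OF p u_in xi_in[OF p]], of "\<lambda>z. g z v"]
    by (simp add: lin phi_xi[OF p] g_u_xi g_xi_xi[OF p] g_v_xi g_v_v vv_def[symmetric])
  have e4: "a * g (nu \<xi>) v = - (3 * c + a * a) * h"
    using arg_cong[OF alpha_nu_xi, of "\<lambda>z. g z v"] by (simp add: lin g_v_v)
  have "g (jac p (nu \<xi>)) v = 0" using jac_sym[OF nu_in v_in] by (simp add: jac_v lin)
  then have n1: "g (njac p \<xi> u) v = 2 * k * c * (a * g (nu \<xi>) v)"
    using arg_cong[OF Du[OF xi_in[OF p]], of "\<lambda>z. g z v"] by (simp add: lin)
  have n2: "g (njac p \<xi> u) v = a * g (C p \<xi> u) v - h * (g (C p \<xi> \<xi>) v + g (A v) v)"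
    unfolding njac_def da[OF xi_in[OF p]] F_A_xi
    by (simp add: lin g_u_xi g_v_xi g_A_xi_v g_A_u_xi g_u_v)
  have n3: "a * g (C p \<xi> \<xi>) v = - 2 * c * h" "a * g (A v) v = - c * h"
    using arg_cong[OF alpha_C_xi_xi, of "\<lambda>z. g z v"] arg_cong[OF alpha_A_v, of "\<lambda>z. g z v"]
    by (simp_all add: lin g_v_v)
  have "a * g (C p \<xi> u) v = h * (g (C p \<xi> \<xi>) v + g (A v) v) + 2 * k * c * (- (3 * c + a * a) * h)"
    using n1 n2 unfolding e4 by simp
  then have "a * (a * g (C p \<xi> u) v) =
      h * (a * g (C p \<xi> \<xi>) v + a * g (A v) v) + a * (2 * k * c * (- (3 * c + a * a) * h))"
    by (simp add: distrib_left mult.left_commute)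
  then have e5: "a * a * g (C p \<xi> u) v = h * (- 3 * c * h) - 2 * k * c * a * ((3 * c + a * a) * h)"
    unfolding n3 by (simp add: algebra_simps)
  have "g (C p u \<xi>) v + g (A (F (A u))) v - a * g (F (A u)) v = 0"
    using nuv unfolding nabla_uu_def da[OF u_in] by (simp add: lin)
  then have "a * a * (g (C p u \<xi>) v + g (A (F (A u))) v - a * g (F (A u)) v) = 0" by simp
  then have "a * a * g (C p \<xi> u) v - a * a * (c * h) + a * a * g (A (F (A u))) v - a * a * (a * g (F (A u)) v) = 0"
    unfolding e3 by (simp add: algebra_simps)
  then have "h * (h * (4 * c + a\<^sup>2) + 8 * k * a + 4 * k * c * a ^ 3 - 1) = 0"
    unfolding e5 e1 e2 m_def using c by (elim disjE) (simp_all add: algebra_simps power2_eq_square power3_eq_cube)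
  then show ?thesis using h0 by simp
qed

text \<open>The left-hand side is half the derivative of \<open>h\<close>. For k = 0 both u and
  \<nabla>_\<xi> u are in the kernel of the structure Jacobi operator, so its \<xi>-derivative
  annihilates u. This determines the \<xi>-derivative of A on u, and the Codazzi equation carries it
  over to direction \<open>x\<close>.\<close>

lemma nabla_uu_uu_of_k0:
  assumes k: "k = 0" and c1: "c = 1" and a1: "a * a = 1" and x: "x \<in> T p"
  shows "g (nu x) u = - (2 * h + 1) * g x v"
proof -
  note a0 = alpha_nonzero[OF u]
  have "a *\<^sub>R jac p (nu \<xi>) = 0"
    using arg_cong[OF alpha_nu_xi, of "jac p"] by (simp add: linear_cmul[OF linear_jac] jac_v)
  then have n0: "njac p \<xi> u = 0" using Du[OF xi_in[OF p]] a0 k by simp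
  have "a * g (C p \<xi> u) \<xi> = g (a *\<^sub>R C p \<xi> \<xi>) u"
    using C_sym[OF p xi_in[OF p] u_in xi_in[OF p]] g_sym[of u] by (simp add: lin)
  then have "g (C p \<xi> u) \<xi> = 0" unfolding alpha_C_xi_xi using a0 by (simp add: lin g_u_v)
  then have "a *\<^sub>R C p \<xi> u = h *\<^sub>R (C p \<xi> \<xi> + A v)"
    using n0 unfolding njac_def da[OF xi_in[OF p]] F_A_xi
    by (simp add: g_u_v g_u_xi g_A_u_v g_A_u_xi)
  then have "a *\<^sub>R (a *\<^sub>R C p \<xi> u) = h *\<^sub>R (a *\<^sub>R C p \<xi> \<xi> + a *\<^sub>R A v)" by (simp add: algebra_simps)
  then have "(a * a) *\<^sub>R C p \<xi> u = (h * (- 2 * c + - c)) *\<^sub>R v"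
    unfolding alpha_C_xi_xi alpha_A_v by (simp only: scaleR_scaleR[symmetric] scaleR_left_distrib)
  moreover have "h * (- 2 * c + - c) = - 3 * h" using c1 by simp
  ultimately have Cu: "C p \<xi> u = (- 3 * h) *\<^sub>R v"
    unfolding a1 by (simp only: scaleR_one)
  have "g (C p x \<xi>) u = g (C p \<xi> x) u - c * g (F x) u"
    using arg_cong[OF C_codazzi[OF p x xi_in[OF p]], of "\<lambda>z. g z u"]
    by (simp add: lin phi_xi[OF p] g_u_xi g_xi_xi[OF p])
  also have "g (C p \<xi> x) u = - 3 * h * g x v"
    using C_sym[OF p xi_in[OF p] x u_in] by (simp add: Cu lin)
  also have "g (F x) u = - g x v" using phi_skew[OF p x u_in] by (simp add: vv_def)
  finally have e1: "g (C p x \<xi>) u = (c - 3 * h) * g x v" by (simp add: algebra_simps)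
  have "a * g (F (A x)) u = - g x (a *\<^sub>R A v)"
    using phi_skew[OF p mem(1) u_in, of x] A_sym[OF x v_in] by (simp add: lin vv_def)
  then have e2: "a * g (F (A x)) u = c * g x v" unfolding alpha_A_v by (simp add: lin)
  have "a * g (A (F (A x))) u = g (F (A x)) (a *\<^sub>R A u)"
    using A_sym[OF mem(2) u_in, of "A x"] by (simp add: lin)
  also have "\<dots> = (h - c + 2 * k * c * a) * g (F (A x)) u"
    unfolding alpha_A_u by (simp add: lin g_F_xi mem)
  finally have "a * (a * g (A (F (A x))) u) = (h - c + 2 * k * c * a) * (a * g (F (A x)) u)" by simp
  then have "a * a * g (A (F (A x))) u = (h - c + 2 * k * c * a) * c * g x v" unfolding e2 by simp
  moreover have "(h - c + 2 * k * c * a) * c = h - 1" using c1 k by simp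
  ultimately have e3: "g (A (F (A x))) u = (h - 1) * g x v" unfolding a1 by simp
  show ?thesis unfolding nabla_uu_def da[OF x] using e1 e2 e3 by (simp add: lin g_u_xi algebra_simps)
qed

text \<open>Hypothesis \<open>eq\<close> says that the bracket of \<xi> and u has no
  v-component.\<close>

lemma k0_contradiction:
  assumes k: "k = 0" and c1: "c = 1" and a1: "a * a = 1" and eq: "g (nu \<xi>) v = g (F (A u)) v"
  shows False
proof -
  have n1: "a * g (nu \<xi>) v = - (3 * c + a * a) * h"
    using arg_cong[OF alpha_nu_xi, of "\<lambda>z. g z v"] by (simp add: lin g_v_v)
  have n2: "3 * c + a * a = 4" using c1 a1 by simp
  have "a * g (F (A u)) v = g (F (a *\<^sub>R A u)) v" by (simp add: lin)
  also have "\<dots> = (h - c + 2 * k * c * a) * h"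
    unfolding alpha_A_u by (simp add: lin phi_xi[OF p] vv_def[symmetric] g_v_v)
  also have "h - c + 2 * k * c * a = h - 1" using c1 k by simp
  finally have n3: "a * g (F (A u)) v = (h - 1) * h" .
  have "- 4 * h = (h - 1) * h" using n1 n3 unfolding n2 eq by simp
  then have "h * (h + 3) = 0" by (simp add: algebra_simps)
  then show False using h_pos[OF u] by simp
qed

end

end

end

end

end

section \<open>Hypersurfaces with the identity are Hopf\<close>

context hypersurface
begin

lemma uu_VF: "uu \<in> VF"
  using VF_diff[OF shp_VF[OF xi_VF] VF_scale[OF smooth_alpha xi_VF]] unfolding uu_def[abs_def] .

lemma vv_VF: "vv \<in> VF"
  using phi_VF[OF uu_VF] unfolding vv_def[abs_def] .

lemma D_uu: "X \<in> VF \<Longrightarrow> p \<in> M \<Longrightarrow> D X uu p = nu p (X p)"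
  using D_diff[of X "\<lambda>q. shp q (xi q)" "\<lambda>q. alpha q *\<^sub>R xi q" p]
  by (simp add: uu_def[abs_def] shp_VF VF_scale smooth_alpha xi_VF D_shp_xi D_scale D_xi dd_alpha nabla_uu_def algebra_simps)

lemma D_vv: "X \<in> VF \<Longrightarrow> p \<in> M \<Longrightarrow> D X vv p = phi p (nu p (X p)) - g (shp p (X p)) (uu p) *\<^sub>R xi p"
  using D_phi[OF _ uu_VF, of X p] by (simp add: vv_def[abs_def] D_uu g_u_xi)

lemma D_zero: "X \<in> VF \<Longrightarrow> p \<in> M \<Longrightarrow> D X (\<lambda>q. 0) p = 0"
  using D_scale[of "\<lambda>q. 0" X xi p] by (simp add: smooth_map_const xi_VF deriv_within_const VF_in)

text \<open>The derivative of \<open>jac q (xi q) = 0\<close>. In the same way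
  \<open>njac_uu\<close> and \<open>njac_vv\<close> differentiate the equations for u and v.\<close>

lemma njac_xi: 
  assumes "p \<in> M" "x \<in> T p" shows "njac p x (xi p) + jac p (phi p (shp p x)) = 0"
proof -
  obtain X where X: "X \<in> VF" "X p = x" using extend_VF[OF assms] by blast
  have "D X (\<lambda>q. jac q (xi q)) p = D X (\<lambda>q. 0) p"
    by (rule D_cong[OF X(1) _ assms(1)]) (use VF_scale[OF smooth_map_const xi_VF, of 0] in \<open>auto simp: jac_xi\<close>)
  then show ?thesis using D_jac[OF X(1) xi_VF assms(1)] D_zero D_xi[OF X(1) assms(1)] X assms by simp
qed

text \<open>W is cut out of a space of dimension 2n - 1 by three linear equations, and 2n - 1 > 3
  for n > 2.\<close>

lemma ex_W: "p \<in> M \<Longrightarrow> \<exists>x\<in>perp p. x \<noteq> 0"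
proof (rule ccontr)
  assume p: "p \<in> M" and *: "\<not> (\<exists>x\<in>perp p. x \<noteq> 0)"
  define l where "l x = (g x (xi p), g x (uu p), g x (vv p))" for x
  have l: "linear l" unfolding l_def by (rule linearI) (simp_all add: g.add_left g.scaleR_left)
  have "inj_on l (T p)"
  proof (rule inj_onI)
    fix x y assume xy: "x \<in> T p" "y \<in> T p" "l x = l y"
    then have "x - y \<in> perp p"
      using p by (simp add: perp_def l_def g.diff_left subspace_diff subspace_T)
    then show "x = y" using * by auto
  qed
  then have "dim (l ` T p) = dim (T p)"
    by (intro dim_image_eq[OF l]) (simp add: span_eq_iff[THEN iffD2, OF subspace_T[OF p]])
  moreover have "dim (l ` T p) \<le> DIM(real \<times> real \<times> real)" by (rule dim_subset_UNIV)
  ultimately show False using dim_T[OF p] card_n by simp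
qed

text \<open>By continuity, a function with finitely many values near \<open>p\<close> is constant
  near \<open>p\<close>.\<close>

lemma dd_finite_range:
  fixes f :: "_ \<Rightarrow> real"
  assumes f: "smooth_map M f" and p: "p \<in> M" and x: "x \<in> T p" and U: "open U" "p \<in> U"
    and S: "finite S" "\<And>q. q \<in> M \<Longrightarrow> q \<in> U \<Longrightarrow> f q \<in> S"
  shows "dd f p x = 0"
proof -
  have "open (- (S - {f p}))" by (rule open_Compl[OF finite_imp_closed]) (simp add: S(1))
  then obtain V where V: "open V" "p \<in> V" "\<forall>q\<in>M. q \<in> V \<longrightarrow> f q \<in> - (S - {f p})"
    using smooth_map_continuous_on[OF f] p unfolding continuous_on_topological by (metis ComplI Diff_iff insertI1)
  have "dd f p x = dd (\<lambda>q. f p) p x"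
    by (rule deriv_within_local_cong[OF smooth_map_const p x, of "U \<inter> V"]) (use U V S(2) in auto)
  then show ?thesis using x by (simp add: deriv_within_const)
qed

lemma dalpha_dd: "p \<in> M \<Longrightarrow> x \<in> T p \<Longrightarrow> dalpha p x = dd alpha p x"
  using extend_VF dd_alpha by metis

context
  fixes k :: real
  assumes K: "\<And>p. p \<in> M \<Longrightarrow> codazzi_jac k p"
begin

lemma njac_uu:
  assumes p: "p \<in> M" and x: "x \<in> T p"
  shows "njac p x (uu p) + jac p (nu p x) = (2 * k * c * dalpha p x) *\<^sub>R uu p + (2 * k * c * alpha p) *\<^sub>R nu p x"
proof -
  obtain X where X: "X \<in> VF" "X p = x" using extend_VF[OF p x] by blast
  have sm: "smooth_map M (\<lambda>q. 2 * k * c * alpha q)" by (intro smooth_map_mult smooth_map_const smooth_alpha)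
  have "D X (\<lambda>q. jac q (uu q)) p = D X (\<lambda>q. (2 * k * c * alpha q) *\<^sub>R uu q) p"
    by (rule D_cong[OF X(1) VF_scale[OF sm uu_VF] p]) (rule jac_u[OF _ K, symmetric])
  then show ?thesis
    using deriv_within_linear[OF bounded_linear_mult_right smooth_alpha p x, of "2 * k * c"]
    by (simp add: D_jac X uu_VF p D_uu D_scale[OF sm X(1) uu_VF p] dalpha_dd[OF p x])
qed

lemma njac_vv:
  assumes p: "p \<in> M" and x: "x \<in> T p"
  shows "njac p x (vv p) + jac p (phi p (nu p x)) = 0"
proof -
  obtain X where X: "X \<in> VF" "X p = x" using extend_VF[OF p x] by blast
  have "D X (\<lambda>q. jac q (vv q)) p = D X (\<lambda>q. 0) p"
    by (rule D_cong[OF X(1) _ p]) (use VF_scale[OF smooth_map_const xi_VF, of 0] in \<open>auto simp: jac_v[OF _ K]\<close>)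
  then show ?thesis
    using linear_diff[OF linear_jac[OF p]] linear_cmul[OF linear_jac[OF p]]
    by (simp add: D_jac X vv_VF p D_vv D_zero jac_xi)
qed

lemma nonhopf_cubic:
  assumes p: "p \<in> M" and u: "uu p \<noteq> 0"
  shows "2 * k * alpha p ^ 3 + (2 * k\<^sup>2 * c - 1) * (alpha p)\<^sup>2 - 3 * k * c * alpha p + c - k\<^sup>2 = 0"
  using ex_W[OF p] alpha_cubic[OF p K[OF p] u _ _ njac_uu[OF p]] by blast

lemma nonhopf_neighbourhood:
  assumes p: "p \<in> M" and u: "uu p \<noteq> 0"
  obtains U where "open U" "p \<in> U" "\<And>q. q \<in> M \<Longrightarrow> q \<in> U \<Longrightarrow> uu q \<noteq> 0"
    "\<And>q x. q \<in> M \<Longrightarrow> q \<in> U \<Longrightarrow> x \<in> T q \<Longrightarrow> dalpha q x = 0"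
proof -
  have "open (- {0 :: 'n cmat})" by (simp add: open_Compl)
  then obtain U where U: "open U" "p \<in> U" "\<forall>q\<in>M. q \<in> U \<longrightarrow> uu q \<in> - {0}"
    using smooth_map_continuous_on[OF VF_smooth[OF uu_VF]] p u unfolding continuous_on_topological by (metis ComplI singletonD)
  let ?P = "[:c - k\<^sup>2, - 3 * k * c, 2 * k\<^sup>2 * c - 1, 2 * k:]"
  \<comment> \<open>For k = 0 the quadratic coefficient is -1, otherwise the leading coefficient is
    nonzero.\<close>
  have P: "?P \<noteq> 0" by (cases "k = 0") auto
  have "alpha q \<in> {t. poly ?P t = 0}" if "q \<in> M" "q \<in> U" for q
    using nonhopf_cubic[OF that(1)] U(3) that by (simp add: algebra_simps power2_eq_square power3_eq_cube)
  then have "dalpha q x = 0" if "q \<in> M" "q \<in> U" "x \<in> T q" for q x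
    unfolding dalpha_dd[OF that(1,3)]
    by (intro dd_finite_range[OF smooth_alpha that(1,3) U(1) that(2) poly_roots_finite[OF P]]) auto
  then show thesis using that U by blast
qed

lemma identity_imp_hopf:
  assumes p: "p \<in> M"
  shows "uu p = 0"
proof (rule ccontr)
  assume u: "uu p \<noteq> 0"
  obtain U where U: "open U" "p \<in> U" "\<And>q. q \<in> M \<Longrightarrow> q \<in> U \<Longrightarrow> uu q \<noteq> 0"
    "\<And>q x. q \<in> M \<Longrightarrow> q \<in> U \<Longrightarrow> x \<in> T q \<Longrightarrow> dalpha q x = 0"
    using nonhopf_neighbourhood[OF p u] by blast
  have Du: "njac q x (uu q) + jac q (nu q x) = (2 * k * c * alpha q) *\<^sub>R nu q x"
    if "q \<in> M" "q \<in> U" "x \<in> T q" for q x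
    using njac_uu[OF that(1,3)] U(4)[OF that] by simp
  define a h where "a = alpha p" and "h = hh p"
  have h: "h > 0" unfolding h_def by (rule h_pos[OF p K[OF p] u])
  have cubic: "2 * k * a ^ 3 + (2 * k\<^sup>2 * c - 1) * a\<^sup>2 - 3 * k * c * a + c - k\<^sup>2 = 0"
    using nonhopf_cubic[OF p u] by (simp add: a_def)
  show False
  proof (cases "k = 0")
    case False
    have "k * (5 + 2 * c * a\<^sup>2) = 0"
      unfolding a_def by (rule alpha_quadratic[OF p K[OF p] u U(4)[OF p U(2)] njac_vv[OF p] njac_xi[OF p]])
    then have 1: "5 + 2 * c * a\<^sup>2 = 0" using False by simp
    moreover have "c \<noteq> 1" using 1 by (auto simp: add_nonneg_eq_0_iff)
    ultimately have c1: "c = -1" and a2: "a\<^sup>2 = 5 / 2" using c by auto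
    have a3: "k * a ^ 3 = 5 / 2 * (k * a)" using a2 by (simp add: power3_eq_cube power2_eq_square)
    have "h * (4 * c + a\<^sup>2) + 8 * k * a + 4 * k * c * a ^ 3 - 1 = 0"
      unfolding a_def h_def
      by (rule hh_alpha_relation[OF p K[OF p] u U(4)[OF p U(2)] Du[OF p U(2)] njac_vv[OF p] False])
    then have "h * (4 * c + a\<^sup>2) + 8 * (k * a) + 4 * c * (k * a ^ 3) - 1 = 0" by (simp add: mult_ac)
    then have "k * a = - (1 + 3 / 2 * h) / 2" unfolding a2 a3 c1 by (simp add: field_simps)
    \<comment> \<open>The sign is the point: with the same substitutions the cubic gives 8 k
      \<alpha> = 6 k^2 + 7/2, which is positive.\<close>
    then have "k * a < 0" using h by simp
    moreover have "8 * (k * a) - 6 * k\<^sup>2 - 7 / 2 = 0"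
    proof -
      have "2 * (k * a ^ 3) + (2 * k\<^sup>2 * c - 1) * a\<^sup>2 - 3 * c * (k * a) + c - k\<^sup>2 = 0"
        using cubic by (simp add: mult_ac)
      then show ?thesis unfolding a2 a3 c1 by (simp add: field_simps)
    qed
    ultimately show False using zero_le_power2[of k] by linarith
  next
    case k: True
    have c1: "c = 1" and a1: "\<And>q. q \<in> M \<Longrightarrow> q \<in> U \<Longrightarrow> alpha q * alpha q = 1"
    proof -
      have *: "alpha q * alpha q = c" if "q \<in> M" "q \<in> U" for q
        using nonhopf_cubic[OF that(1) U(3)[OF that]] k by (simp add: power2_eq_square)
      have "c \<noteq> -1" using *[OF p U(2)] by (smt (verit) zero_le_square)
      then show "c = 1" using c by auto
      then show "\<And>q. q \<in> M \<Longrightarrow> q \<in> U \<Longrightarrow> alpha q * alpha q = 1" using * by simp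
    qed
    have smh: "smooth_map M hh" unfolding hh_def[abs_def] by (intro smooth_g VF_smooth uu_VF)
    have grad: "dd hh q x = - 2 * (2 * hh q + 1) * g x (vv q)" if q: "q \<in> M" "q \<in> U" and x: "x \<in> T q" for q x
    proof -
      obtain X where X: "X \<in> VF" "X q = x" using extend_VF[OF q(1) x] by blast
      have "dd hh q x = 2 * g (nu q x) (uu q)"
        using D_metric[OF X(1) uu_VF uu_VF q(1)] D_uu[OF X(1) q(1)] X(2) g_sym[of "uu q"]
        unfolding hh_def[abs_def] by simp
      also have "g (nu q x) (uu q) = - (2 * hh q + 1) * g x (vv q)"
        by (rule nabla_uu_uu_of_k0[OF q(1) K[OF q(1)] U(3)[OF q] U(4)[OF q] Du[OF q] k c1 a1[OF q] x])
      finally show ?thesis by simp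
    qed
    \<comment> \<open>Near \<open>p\<close> the differential of \<open>hh\<close> kills every field
      orthogonal to v. Both \<xi> and u are such fields, so by \<open>dd_commute\<close> it kills
      their bracket too.\<close>
    have zero: "dd (\<lambda>q. dd hh q (Z q)) p x = 0"
      if Z: "Z \<in> VF" "\<And>q. q \<in> M \<Longrightarrow> g (Z q) (vv q) = 0" and x: "x \<in> T p" for Z x
    proof -
      have "dd (\<lambda>q. dd hh q (Z q)) p x = dd (\<lambda>q. 0) p x"
        by (rule deriv_within_local_cong[OF smooth_map_const p x U(1,2)]) (simp add: grad Z VF_in)
      then show ?thesis using x by (simp add: deriv_within_const)
    qed
    have z: "D xi uu p - D uu xi p \<in> T p"
      using VF_in[OF D_VF[OF xi_VF uu_VF] p] VF_in[OF D_VF[OF uu_VF xi_VF] p] subspace_T[OF p] by (simp add: subspace_diff)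
    have "dd hh p (D xi uu p - D uu xi p) = 0"
      using dd_commute[OF smh xi_VF uu_VF p] zero[OF uu_VF g_u_v(1) xi_in[OF p]] zero[OF xi_VF g_v_xi(2) u_in[OF p]] by simp
    then have "g (D xi uu p - D uu xi p) (vv p) = 0"
      using grad[OF p U(2) z] h h_def by simp
    then have eq: "g (nu p (xi p)) (vv p) = g (phi p (shp p (uu p))) (vv p)"
      using p by (simp add: D_uu[OF xi_VF p] D_xi[OF uu_VF p] g.diff_left)
    show False
      by (rule k0_contradiction[OF p K[OF p] u U(4)[OF p U(2)] Du[OF p U(2)] k c1 a1[OF p U(2)] eq])
  qed
qed

end

section \<open>Hopf hypersurfaces\<close>

context
  assumes H: "\<And>p. p \<in> M \<Longrightarrow> uu p = 0"
begin

lemma hopf_A_xi: "p \<in> M \<Longrightarrow> shp p (xi p) = alpha p *\<^sub>R xi p"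
  using A_xi[of p] H by simp

text \<open>The covariant derivative of \<open>uu = 0\<close>.\<close>

lemma hopf_C_xi:
  assumes p: "p \<in> M" and x: "x \<in> T p"
  shows "C p x (xi p) = dalpha p x *\<^sub>R xi p + alpha p *\<^sub>R phi p (shp p x) - shp p (phi p (shp p x))"
proof -
  obtain X where X: "X \<in> VF" "X p = x" using extend_VF[OF p x] by blast
  have "D X uu p = D X (\<lambda>q. 0) p"
    by (rule D_cong[OF X(1) _ p]) (use VF_scale[OF smooth_map_const xi_VF, of 0] H in auto)
  then show ?thesis using D_uu[OF X(1) p] D_zero[OF X(1) p] X(2) by (simp add: nabla_uu_def algebra_simps)
qed

context
  fixes p assumes p: "p \<in> M"
begin

lemma g_A_xi: "x \<in> T p \<Longrightarrow> g (shp p x) (xi p) = alpha p * g x (xi p)"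
  using A_sym[OF p _ xi_in[OF p]] by (simp add: hopf_A_xi[OF p] g.scaleR_right)

lemma g_F_A: "x \<in> T p \<Longrightarrow> y \<in> T p \<Longrightarrow> g (phi p (shp p y)) x = - g (shp p (phi p x)) y"
  using phi_skew[OF p shp_in[OF p], of x y] A_sym[OF p _ phi_in[OF p], of y x] g_sym[of y] by simp

lemma g_AFA: "x \<in> T p \<Longrightarrow> y \<in> T p \<Longrightarrow> g (shp p (phi p (shp p y))) x = - g (shp p (phi p (shp p x))) y"
  using A_sym[OF p phi_in[OF p], of x "shp p y"] phi_skew[OF p shp_in[OF p] shp_in[OF p], of y x]
    A_sym[OF p _ phi_in[OF p], of y "shp p x"] g_sym[of y] by simp

text \<open>The \<xi>-component of the Codazzi equation, with \<open>hopf_C_xi\<close> inserted.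
  Setting \<open>y = \<xi>\<close> shows that d\<alpha> is a multiple of \<eta>.\<close>

lemma hopf_codazzi:
  assumes x: "x \<in> T p" and y: "y \<in> T p"
  shows "dalpha p x * g y (xi p) - dalpha p y * g x (xi p) + alpha p * (g (phi p (shp p x)) y + g (shp p (phi p x)) y)
    - 2 * g (shp p (phi p (shp p x))) y = - 2 * c * g (phi p x) y"
proof -
  have "g (C p x (xi p)) y - g (C p y (xi p)) x = g (xi p) (C p x y - C p y x)"
    using C_sym[OF p x xi_in[OF p] y] C_sym[OF p y xi_in[OF p] x] by (simp add: g.diff_right)
  also have "\<dots> = - 2 * c * g (phi p x) y"
    unfolding C_codazzi[OF p x y] using g_F_xi[OF p x] g_F_xi[OF p y] by (simp add: lin[OF p] g_xi_xi[OF p])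
  finally show ?thesis
    unfolding hopf_C_xi[OF p x] hopf_C_xi[OF p y]
    using g_F_A[OF x y] g_AFA[OF x y] g_sym[of "xi p"] by (simp add: lin[OF p] algebra_simps)
qed

lemma hopf_dalpha:
  assumes x: "x \<in> T p" shows "dalpha p x = dalpha p (xi p) * g x (xi p)"
  using hopf_codazzi[OF x xi_in[OF p]] g_F_xi[OF p x] g_F_xi[OF p shp_in[OF p]]
    g_A_xi[OF phi_in[OF p]] by (simp add: g_xi_xi[OF p])

text \<open>The classical relation for Hopf hypersurfaces. The terms with d\<alpha> in
  \<open>hopf_codazzi\<close> cancel because d\<alpha> is proportional to \<eta>.\<close>

lemma hopf_AFA:
  assumes x: "x \<in> T p"
  shows "2 *\<^sub>R shp p (phi p (shp p x)) = alpha p *\<^sub>R (phi p (shp p x) + shp p (phi p x)) + (2 * c) *\<^sub>R phi p x"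
proof (rule T_eqI[OF p])
  show "2 *\<^sub>R shp p (phi p (shp p x)) \<in> T p" "alpha p *\<^sub>R (phi p (shp p x) + shp p (phi p x)) + (2 * c) *\<^sub>R phi p x \<in> T p"
    by (intro mem[OF p])+
  fix y assume y: "y \<in> T p"
  show "g (2 *\<^sub>R shp p (phi p (shp p x))) y = g (alpha p *\<^sub>R (phi p (shp p x) + shp p (phi p x)) + (2 * c) *\<^sub>R phi p x) y"
    using hopf_codazzi[OF x y] hopf_dalpha[OF x] hopf_dalpha[OF y] by (simp add: lin[OF p] algebra_simps)
qed

text \<open>Both summands have the shape of the right-hand side of the identity. The first carries
  the factor c + \<alpha>^2, and only it involves A; if that factor vanishes, the identity holds for
  every A, which is case (ii).\<close>

lemma hopf_njac:
  assumes x: "x \<in> T p" and y: "y \<in> T p" and da: "dalpha p (xi p) = 0"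
  shows "njac p x y - njac p y x =
    - (c + (alpha p)\<^sup>2) *\<^sub>R ((g (phi p (shp p x)) y + g (shp p (phi p x)) y) *\<^sub>R xi p + g y (xi p) *\<^sub>R phi p (shp p x) - g x (xi p) *\<^sub>R phi p (shp p y))
    - (c * alpha p) *\<^sub>R ((2 * g (phi p x) y) *\<^sub>R xi p + g y (xi p) *\<^sub>R phi p x - g x (xi p) *\<^sub>R phi p y)"
proof -
  define r s where "r = g (phi p (shp p x)) y + g (shp p (phi p x)) y" and "s = g (phi p x) y"
  have d0: "dalpha p z = 0" if "z \<in> T p" for z using hopf_dalpha[OF that] da by simp
  have n: "njac p x y = alpha p *\<^sub>R C p x y - c *\<^sub>R (g y (phi p (shp p x)) *\<^sub>R xi p + g y (xi p) *\<^sub>R phi p (shp p x))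
     - (alpha p * (g (C p x y) (xi p) + g (shp p (phi p (shp p x))) y)) *\<^sub>R xi p - ((alpha p)\<^sup>2 * g y (xi p)) *\<^sub>R phi p (shp p x)"
    if x: "x \<in> T p" and y: "y \<in> T p" for x y
    using A_sym[OF p phi_in[OF p] y, of "shp p x"] g_sym[of "shp p y" "phi p (shp p x)"]
    unfolding njac_def d0[OF x] hopf_C_xi[OF p x] hopf_A_xi[OF p]
    by (simp add: g_A_xi[OF y] algebra_simps power2_eq_square)
  have C: "C p x y = C p y x + c *\<^sub>R (g x (xi p) *\<^sub>R phi p y - g y (xi p) *\<^sub>R phi p x - (2 * s) *\<^sub>R xi p)"
    using C_codazzi[OF p x y] by (simp add: s_def algebra_simps)
  have "alpha p * r - 2 * g (shp p (phi p (shp p x))) y = - 2 * c * s"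
    using hopf_codazzi[OF x y] by (simp add: d0 x y r_def s_def)
  then have AFA: "g (shp p (phi p (shp p x))) y = (alpha p * r + 2 * c * s) / 2" by simp
  have f: "g (shp p (phi p (shp p y))) x = - ((alpha p * r + 2 * c * s) / 2)" "g x (phi p (shp p y)) = g y (phi p (shp p x)) - r"
    using g_AFA[OF x y] AFA g_F_A[OF x y] g_sym[of x "phi p (shp p y)"] g_sym[of y "phi p (shp p x)"] by (simp_all add: r_def)
  have Cxi: "g (C p x y) (xi p) = g (C p y x) (xi p) - 2 * c * s"
    unfolding C using g_F_xi[OF p x] g_F_xi[OF p y] by (simp add: lin[OF p] g_xi_xi[OF p])
  show ?thesis
    unfolding n[OF x y] n[OF y x] f AFA Cxi r_def[symmetric] s_def[symmetric]
    unfolding C by (simp add: algebra_simps power2_eq_square add_divide_distrib diff_divide_distrib numeral_mult_scaleR)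
qed

text \<open>The identity with second argument \<xi>. The derivative in direction \<open>x\<close>
  comes from \<open>njac_xi\<close>, the one in direction \<xi> from \<open>hopf_C_xi\<close> and
  the Codazzi equation; the terms with A\<phi>A cancel.\<close>

lemma hopf_identity_tensor:
  assumes K: "codazzi_jac k p" and x: "x \<in> T p" "g x (xi p) = 0"
  shows "(c + (alpha p)\<^sup>2) *\<^sub>R phi p (shp p x) + dalpha p (xi p) *\<^sub>R shp p x = - (k + alpha p * c) *\<^sub>R phi p x"
proof -
  define z where "z = phi p (shp p x)"
  have z: "z \<in> T p" "g z (xi p) = 0" unfolding z_def using phi_in[OF p] g_F_xi[OF p shp_in[OF p]] by auto
  have "njac p x (xi p) - njac p (xi p) x = k *\<^sub>R phi p x"
    using K[unfolded codazzi_jac_def, rule_format, OF x(1) xi_in[OF p]] x g_F_xi[OF p x(1)]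
    by (simp add: g_xi_xi[OF p] phi_xi[OF p])
  moreover have "njac p x (xi p) = - (c *\<^sub>R z + alpha p *\<^sub>R shp p z)"
  proof -
    have "jac p z = c *\<^sub>R z + alpha p *\<^sub>R shp p z" using z g_A_xi[OF z(1)] by (simp add: jac_def)
    moreover have "njac p x (xi p) = - jac p z"
      using njac_xi[OF p x(1)] unfolding z_def eq_neg_iff_add_eq_0 .
    ultimately show ?thesis by simp
  qed
  moreover have "njac p (xi p) x = dalpha p (xi p) *\<^sub>R shp p x + alpha p *\<^sub>R (alpha p *\<^sub>R z - shp p z + c *\<^sub>R phi p x)"
  proof -
    have "C p x (xi p) - C p (xi p) x = - c *\<^sub>R phi p x"
      using C_codazzi[OF p x(1) xi_in[OF p]] x g_F_xi[OF p x(1)] by (simp add: g_xi_xi[OF p])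
    then have Cx: "C p (xi p) x = alpha p *\<^sub>R z - shp p z + c *\<^sub>R phi p x"
      using hopf_C_xi[OF p x(1)] hopf_dalpha[OF x(1)] x(2) by (simp add: z_def algebra_simps)
    have AzX: "g (shp p z) (xi p) = 0" using g_A_xi[OF z(1)] z(2) by simp
    show ?thesis
      unfolding njac_def using x z g_A_xi[OF x(1)] g_F_xi[OF p x(1)] AzX
      by (simp add: Cx hopf_A_xi[OF p] lin[OF p] phi_xi[OF p])
  qed
  ultimately have "- (c *\<^sub>R z + alpha p *\<^sub>R shp p z) -
    (dalpha p (xi p) *\<^sub>R shp p x + alpha p *\<^sub>R (alpha p *\<^sub>R z - shp p z + c *\<^sub>R phi p x)) = k *\<^sub>R phi p x" by simp
  then have "- (c *\<^sub>R z + alpha p *\<^sub>R shp p z) -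
    (dalpha p (xi p) *\<^sub>R shp p x + alpha p *\<^sub>R (alpha p *\<^sub>R z - shp p z + c *\<^sub>R phi p x)) + (c + (alpha p)\<^sup>2) *\<^sub>R z + dalpha p (xi p) *\<^sub>R shp p x =
    k *\<^sub>R phi p x + (c + (alpha p)\<^sup>2) *\<^sub>R z + dalpha p (xi p) *\<^sub>R shp p x" by simp
  then have 1: "- (alpha p * c) *\<^sub>R phi p x - k *\<^sub>R phi p x = (c + (alpha p)\<^sup>2) *\<^sub>R z + dalpha p (xi p) *\<^sub>R shp p x"
    by (simp add: algebra_simps power2_eq_square)
  have "- (alpha p * c) *\<^sub>R phi p x - k *\<^sub>R phi p x = - (k + alpha p * c) *\<^sub>R phi p x"
    by (simp add: algebra_simps)
  then show ?thesis unfolding 1 z_def .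
qed

text \<open>Applying \<phi> to \<open>hopf_identity_tensor\<close> and eliminating \<phi>A expresses
  (b^2 + e^2) A on D through \<phi> and the identity map. A is symmetric and \<phi> is skew, so the
  coefficient of \<phi> vanishes; then A = 0 on D, contrary to \<open>hopf_AFA\<close>.\<close>

lemma hopf_dalpha_zero:
  assumes K: "codazzi_jac k p"
  shows "dalpha p (xi p) = 0"
proof (rule ccontr)
  define b e s where "b = dalpha p (xi p)" and "e = c + (alpha p)\<^sup>2" and "s = k + alpha p * c"
  assume "dalpha p (xi p) \<noteq> 0"
  then have b: "b \<noteq> 0" by (simp add: b_def)
  have eq: "(b\<^sup>2 + e\<^sup>2) *\<^sub>R shp p x = - (s * b) *\<^sub>R phi p x - (s * e) *\<^sub>R x"
    if x: "x \<in> T p" "g x (xi p) = 0" for x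
  proof -
    have 1: "e *\<^sub>R phi p (shp p x) = - s *\<^sub>R phi p x - b *\<^sub>R shp p x"
      using hopf_identity_tensor[OF K x] by (simp add: b_def e_def s_def algebra_simps)
    have "phi p (phi p (shp p x)) = - shp p x" "phi p (phi p x) = - x"
      using phi_phi[OF p shp_in[OF p], of x] phi_phi[OF p x(1)] g_A_xi[OF x(1)] x(2) by simp_all
    then have "- e *\<^sub>R shp p x = s *\<^sub>R x - b *\<^sub>R phi p (shp p x)"
      using arg_cong[OF 1, of "phi p"] by (simp add: lin[OF p])
    then have "e *\<^sub>R (- e *\<^sub>R shp p x) = e *\<^sub>R (s *\<^sub>R x) - b *\<^sub>R (e *\<^sub>R phi p (shp p x))"
      by (simp only: scaleR_diff_right scaleR_left_commute)
    note 2 = this[unfolded 1]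
    have "(b\<^sup>2 + e\<^sup>2) *\<^sub>R shp p x = (b * b) *\<^sub>R shp p x - e *\<^sub>R (- e *\<^sub>R shp p x)"
      by (simp add: algebra_simps power2_eq_square)
    also have "\<dots> = - (s * b) *\<^sub>R phi p x - (s * e) *\<^sub>R x"
      unfolding 2 by (simp add: algebra_simps)
    finally show ?thesis .
  qed
  obtain x where x: "x \<in> T p" "g x (xi p) = 0" "x \<noteq> 0" using ex_W[OF p] unfolding perp_def by blast
  have Fx: "phi p x \<in> T p" "g (phi p x) (xi p) = 0" using phi_in[OF p] g_F_xi[OF p x(1)] by auto
  have FFx: "phi p (phi p x) = - x" using phi_phi[OF p x(1)] x(2) by simp
  define n where "n = g x x"
  have n: "n > 0" unfolding n_def by (rule g_pos[OF p x(1,3)])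
  have gF: "g (phi p x) (phi p x) = n" "g x (phi p x) = 0" "g (phi p x) x = 0"
    using g_F_F[OF p x(1) x(1)] x(2) phi_skew[OF p x(1) x(1)] g_sym[of x "phi p x"] by (simp_all add: n_def)
  have "(b\<^sup>2 + e\<^sup>2) * g (shp p x) (phi p x) = - (s * b) * n"
    using arg_cong[OF eq[OF x(1,2)], of "\<lambda>z. g z (phi p x)"] gF by (simp add: lin[OF p])
  moreover have "(b\<^sup>2 + e\<^sup>2) * g (shp p (phi p x)) x = s * b * n"
    using arg_cong[OF eq[OF Fx], of "\<lambda>z. g z x"] gF FFx by (simp add: lin[OF p] n_def)
  moreover have "g (shp p (phi p x)) x = g (shp p x) (phi p x)"
    using A_sym[OF p Fx(1) x(1)] g_sym by simp
  ultimately have "s * b * n = 0" by simp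
  then have "s = 0" using b n by simp
  then have A0: "shp p y = 0" if "y \<in> T p" "g y (xi p) = 0" for y
    using eq[OF that] b by (simp add: sum_power2_eq_zero_iff)
  have "(2 * c) *\<^sub>R phi p x = 0"
    using hopf_AFA[OF x(1)] A0[OF x(1,2)] A0[OF Fx] by (simp add: lin[OF p])
  then have "phi p x = 0" using c by auto
  then show False using FFx x(3) by (simp add: lin[OF p])
qed

lemma eta_umbilical_relation:
  assumes l: "\<And>x. x \<in> T p \<Longrightarrow> g x (xi p) = 0 \<Longrightarrow> shp p x = l *\<^sub>R x"
  shows "l\<^sup>2 = alpha p * l + c"
proof -
  obtain x where x: "x \<in> T p" "g x (xi p) = 0" "x \<noteq> 0" using ex_W[OF p] unfolding perp_def by blast
  have Fx: "phi p x \<in> T p" "g (phi p x) (xi p) = 0" using phi_in[OF p] g_F_xi[OF p x(1)] by auto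
  have "phi p x \<noteq> 0" using phi_phi[OF p x(1)] x(2,3) by (auto simp: lin[OF p])
  moreover have "(2 * (l\<^sup>2 - (alpha p * l + c))) *\<^sub>R phi p x = 0"
    using hopf_AFA[OF x(1)] by (simp add: l x Fx lin[OF p] algebra_simps power2_eq_square numeral_mult_scaleR)
  ultimately show ?thesis by simp
qed

end

text \<open>If e = c + \<alpha>^2 is nonzero, the principal curvature -s/e on D is inserted into
  \<open>eta_umbilical_relation\<close>. If e = 0 then s = 0 as well, and the cleared equation
  \<open>s\<^sup>2 + alpha p * s * e - c * e\<^sup>2 = 0\<close> holds trivially; expanded, it is
  the cubic.\<close>

lemma hopf_cubic:
  assumes p: "p \<in> M" and K: "codazzi_jac k p"
  shows "k * alpha p ^ 3 + 3 * k * c * alpha p + k\<^sup>2 - c = 0"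
    "x \<in> T p \<Longrightarrow> g x (xi p) = 0 \<Longrightarrow> (c + (alpha p)\<^sup>2) *\<^sub>R shp p x = - (k + alpha p * c) *\<^sub>R x"
proof -
  define e s where "e = c + (alpha p)\<^sup>2" and "s = k + alpha p * c"
  have eA: "e *\<^sub>R shp p x = - s *\<^sub>R x" if x: "x \<in> T p" "g x (xi p) = 0" for x
  proof -
    have 1: "e *\<^sub>R phi p (shp p x) = - s *\<^sub>R phi p x"
      using hopf_identity_tensor[OF p K x] hopf_dalpha_zero[OF p K] by (simp add: e_def s_def)
    have "phi p (phi p (shp p x)) = - shp p x" "phi p (phi p x) = - x"
      using phi_phi[OF p shp_in[OF p], of x] phi_phi[OF p x(1)] g_A_xi[OF p x(1)] x(2) by simp_all
    then have 2: "- (e *\<^sub>R shp p x) = s *\<^sub>R x" using arg_cong[OF 1, of "phi p"] by (simp add: lin[OF p])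
    have "e *\<^sub>R shp p x = - (- (e *\<^sub>R shp p x))" by simp
    then show ?thesis unfolding 2 by simp
  qed
  then show "x \<in> T p \<Longrightarrow> g x (xi p) = 0 \<Longrightarrow> (c + (alpha p)\<^sup>2) *\<^sub>R shp p x = - (k + alpha p * c) *\<^sub>R x"
    unfolding e_def s_def by simp
  have "s\<^sup>2 + alpha p * s * e - c * e\<^sup>2 = 0"
  proof (cases "e = 0")
    case True
    obtain x where x: "x \<in> T p" "g x (xi p) = 0" "x \<noteq> 0" using ex_W[OF p] unfolding perp_def by blast
    then have "s = 0" using eA[OF x(1,2)] True by simp
    then show ?thesis using True by simp
  next
    case False
    have "shp p x = (- s / e) *\<^sub>R x" if "x \<in> T p" "g x (xi p) = 0" for x
    proof -
      have "(1 / e) *\<^sub>R (e *\<^sub>R shp p x) = (1 / e) *\<^sub>R (- s *\<^sub>R x)" using eA[OF that] by simp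
      then show ?thesis using False by simp
    qed
    from eta_umbilical_relation[OF p this] have "(- s / e)\<^sup>2 = alpha p * (- s / e) + c" .
    then show ?thesis using False by (simp add: field_simps power2_eq_square)
  qed
  then show "k * alpha p ^ 3 + 3 * k * c * alpha p + k\<^sup>2 - c = 0"
    unfolding e_def s_def using c by (elim disjE) (simp_all add: algebra_simps power2_eq_square power3_eq_cube)
qed

text \<open>The hypotheses are multiplied by c + \<alpha>^2 so as to serve both cases: with that
  factor zero they hold for \<open>l = 0\<close> and arbitrary A, otherwise \<open>l\<close> is the
  principal curvature on D.\<close>

lemma hopf_identityI:
  assumes p: "p \<in> M" and da: "dalpha p (xi p) = 0"
    and AF: "\<And>x. x \<in> T p \<Longrightarrow> (c + (alpha p)\<^sup>2) *\<^sub>R phi p (shp p x) = (c + (alpha p)\<^sup>2) *\<^sub>R (l *\<^sub>R phi p x)"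
      "\<And>x. x \<in> T p \<Longrightarrow> (c + (alpha p)\<^sup>2) *\<^sub>R shp p (phi p x) = (c + (alpha p)\<^sup>2) *\<^sub>R (l *\<^sub>R phi p x)"
  shows "codazzi_jac (- (c + (alpha p)\<^sup>2) * l - c * alpha p) p"
  unfolding codazzi_jac_def
proof (intro ballI)
  fix x y assume x: "x \<in> T p" and y: "y \<in> T p"
  define e where "e = c + (alpha p)\<^sup>2"
  have 1: "e * g (phi p (shp p x)) y = e * l * g (phi p x) y" "e * g (shp p (phi p x)) y = e * l * g (phi p x) y"
    using arg_cong[OF AF(1)[OF x], of "\<lambda>z. g z y"] arg_cong[OF AF(2)[OF x], of "\<lambda>z. g z y"]
    by (simp_all add: e_def[symmetric] g.scaleR_left)
  have "e *\<^sub>R ((g (phi p (shp p x)) y + g (shp p (phi p x)) y) *\<^sub>R xi p + g y (xi p) *\<^sub>R phi p (shp p x) - g x (xi p) *\<^sub>R phi p (shp p y))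
    = (e * g (phi p (shp p x)) y + e * g (shp p (phi p x)) y) *\<^sub>R xi p + g y (xi p) *\<^sub>R (e *\<^sub>R phi p (shp p x)) - g x (xi p) *\<^sub>R (e *\<^sub>R phi p (shp p y))"
    by (simp add: algebra_simps)
  also have "\<dots> = (e * l) *\<^sub>R ((2 * g (phi p x) y) *\<^sub>R xi p + g y (xi p) *\<^sub>R phi p x - g x (xi p) *\<^sub>R phi p y)"
    unfolding 1 using AF(1)[OF x] AF(1)[OF y] by (simp add: e_def[symmetric] algebra_simps)
  finally show "njac p x y - njac p y x = (- (c + (alpha p)\<^sup>2) * l - c * alpha p) *\<^sub>R
      ((2 * g (phi p x) y) *\<^sub>R xi p + g y (xi p) *\<^sub>R phi p x - g x (xi p) *\<^sub>R phi p y)"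
    unfolding hopf_njac[OF p x y da] e_def[symmetric] by (simp add: algebra_simps)
qed

end

section \<open>The two directions of the equivalence\<close>

lemma dalpha_const:
  assumes "\<And>p. p \<in> M \<Longrightarrow> alpha p = r" "p \<in> M" "x \<in> T p"
  shows "dalpha p x = 0"
  using deriv_within_cong[OF smooth_map_const[of M r] assms(2,3), of alpha] assms
  by (simp add: dalpha_dd deriv_within_const)

lemma identity_cases:
  assumes K: "\<And>p. p \<in> M \<Longrightarrow> codazzi_jac k p"
  shows "k \<noteq> 0"
    "(\<exists>l. \<forall>p\<in>M. \<forall>x\<in>T p. g x (xi p) = 0 \<longrightarrow> shp p x = l *\<^sub>R x) \<or>
     c = -1 \<and> (\<forall>p\<in>M. uu p = 0) \<and> ((\<forall>p\<in>M. alpha p = 1) \<or> (\<forall>p\<in>M. alpha p = -1))"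
proof -
  note H = identity_imp_hopf[OF K]
  have cubic: "k * alpha p ^ 3 + 3 * k * c * alpha p + k\<^sup>2 - c = 0" if "p \<in> M" for p
    by (rule hopf_cubic(1)[OF H that K[OF that]])
  obtain p0 where p0: "p0 \<in> M" using M_nonempty by blast
  \<comment> \<open>For k = 0 the cubic reads c = 0.\<close>
  show k0: "k \<noteq> 0" using cubic[OF p0] c by auto
  let ?P = "[:k\<^sup>2 - c, 3 * k * c, 0, k:]"
  have "?P \<noteq> 0" using k0 by auto
  then have "finite {t. poly ?P t = 0}" by (rule poly_roots_finite)
  moreover have "alpha ` M \<subseteq> {t. poly ?P t = 0}"
    using cubic by (auto simp: algebra_simps power2_eq_square power3_eq_cube)
  ultimately have "finite (alpha ` M)" by (rule finite_subset[rotated])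
  then have "alpha constant_on M"
    by (rule continuous_finite_range_constant[OF connected_M smooth_map_continuous_on[OF smooth_alpha]])
  then obtain r where r: "\<And>p. p \<in> M \<Longrightarrow> alpha p = r" unfolding constant_on_def by blast
  have eA: "(c + r\<^sup>2) *\<^sub>R shp p x = - (k + r * c) *\<^sub>R x" if "p \<in> M" "x \<in> T p" "g x (xi p) = 0" for p x
    using hopf_cubic(2)[OF H that(1) K[OF that(1)] that(2,3)] r[OF that(1)] by simp
  show "(\<exists>l. \<forall>p\<in>M. \<forall>x\<in>T p. g x (xi p) = 0 \<longrightarrow> shp p x = l *\<^sub>R x) \<or>
     c = -1 \<and> (\<forall>p\<in>M. uu p = 0) \<and> ((\<forall>p\<in>M. alpha p = 1) \<or> (\<forall>p\<in>M. alpha p = -1))"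
  proof (cases "c + r\<^sup>2 = 0")
    case True
    then have "c = -1" using c by (auto simp: add_nonneg_eq_0_iff)
    then have "r = 1 \<or> r = -1" using True by (simp add: power2_eq_1_iff)
    then show ?thesis using \<open>c = -1\<close> H r by auto
  next
    case False
    have "shp p x = (- (k + r * c) / (c + r\<^sup>2)) *\<^sub>R x" if "p \<in> M" "x \<in> T p" "g x (xi p) = 0" for p x
    proof -
      have "(1 / (c + r\<^sup>2)) *\<^sub>R ((c + r\<^sup>2) *\<^sub>R shp p x) = (1 / (c + r\<^sup>2)) *\<^sub>R (- (k + r * c) *\<^sub>R x)"
        unfolding eA[OF that] ..
      then show ?thesis using False by simp
    qed
    then show ?thesis by blast
  qed
qed

text \<open>For c = -1 the constant - c * r is \<open>r\<close> itself, whence k = 1 for \<alpha> =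
  1.\<close>

lemma identity_of_hopf:
  assumes H: "\<And>p. p \<in> M \<Longrightarrow> uu p = 0" and r: "\<And>p. p \<in> M \<Longrightarrow> alpha p = r" and c1: "c + r\<^sup>2 = 0"
    and p: "p \<in> M"
  shows "codazzi_jac (- c * r) p"
  using hopf_identityI[OF H p dalpha_const[OF r p xi_in[OF p]], of 0] r[OF p] c1 by simp

lemma extend_D_VF:
  assumes p: "p \<in> M" and x: "x \<in> T p" "g x (xi p) = 0"
  obtains X where "X \<in> VF" "X p = x" "\<And>q. q \<in> M \<Longrightarrow> g (X q) (xi q) = 0"
proof -
  obtain Y where Y: "Y \<in> VF" "Y p = x" using extend_VF[OF p x(1)] by blast
  show thesis
  proof (rule that)
    show "(\<lambda>q. Y q - g (Y q) (xi q) *\<^sub>R xi q) \<in> VF"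
      by (intro VF_diff VF_scale smooth_g VF_smooth Y xi_VF)
    show "Y p - g (Y p) (xi p) *\<^sub>R xi p = x" using x Y by simp
    show "g (Y q - g (Y q) (xi q) *\<^sub>R xi q) (xi q) = 0" if "q \<in> M" for q
      by (simp add: g.diff_left g.scaleR_left g_xi_xi[OF that])
  qed
qed

text \<open>Since \<open>k\<close> has to be one constant, both \<alpha> and the arbitrary function
  \<open>l\<close> must first be shown to be constant.\<close>

lemma identity_of_eta_umbilical:
  assumes l: "\<And>p x. p \<in> M \<Longrightarrow> x \<in> T p \<Longrightarrow> g x (xi p) = 0 \<Longrightarrow> shp p x = l p *\<^sub>R x"
  shows "\<exists>k. \<forall>p\<in>M. codazzi_jac k p"
proof -
  \<comment> \<open>If u is nonzero, Au is a multiple of u and so orthogonal to \<xi>, although its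
    \<xi>-component is \<open>hh p\<close>, which is positive.\<close>
  have H: "uu p = 0" if p: "p \<in> M" for p
  proof (rule ccontr)
    assume "uu p \<noteq> 0"
    then have "g (uu p) (uu p) > 0" by (rule g_pos[OF p u_in[OF p]])
    moreover have "g (shp p (uu p)) (xi p) = 0" using l[OF p u_in[OF p] g_u_xi(1)[OF p]] g_u_xi[OF p] by (simp add: g.scaleR_left)
    ultimately show False using g_A_u_xi[OF p] unfolding hh_def by simp
  qed
  have rel: "(l p)\<^sup>2 = alpha p * l p + c" if "p \<in> M" for p
    using eta_umbilical_relation[OF H that, of "l p"] l[OF that] by blast
  have l0: "l p \<noteq> 0" if "p \<in> M" for p using rel[OF that] c by auto
  \<comment> \<open>D is not integrable: for fields in D equal to x and \<phi>x at \<open>p\<close>,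
    the bracket has \<xi>-component -2 l g(\<phi>x, \<phi>x), which is nonzero. On the other hand
    d\<alpha> vanishes on D, hence on this bracket, and being a multiple of \<eta> it vanishes
    altogether.\<close>
  have da: "dalpha p (xi p) = 0" if p: "p \<in> M" for p
  proof -
    obtain x where x: "x \<in> T p" "g x (xi p) = 0" "x \<noteq> 0" using ex_W[OF p] unfolding perp_def by blast
    define y where "y = phi p x"
    have y: "y \<in> T p" "g y (xi p) = 0" unfolding y_def using phi_in[OF p] g_F_xi[OF p x(1)] by auto
    obtain X where X: "X \<in> VF" "X p = x" "\<And>q. q \<in> M \<Longrightarrow> g (X q) (xi q) = 0" using extend_D_VF[OF p x(1,2)] by blast
    obtain Y where Y: "Y \<in> VF" "Y p = y" "\<And>q. q \<in> M \<Longrightarrow> g (Y q) (xi q) = 0" using extend_D_VF[OF p y] by blast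
    have zero: "dd (\<lambda>q. dd alpha q (Z q)) p v = 0"
      if Z: "Z \<in> VF" "\<And>q. q \<in> M \<Longrightarrow> g (Z q) (xi q) = 0" and v: "v \<in> T p" for Z v
    proof -
      have "dd (\<lambda>q. dd alpha q (Z q)) p v = dd (\<lambda>q. 0) p v"
      proof (rule deriv_within_cong[OF smooth_map_const p v])
        fix q assume q: "q \<in> M"
        show "0 = dd alpha q (Z q)"
          using hopf_dalpha[OF H q VF_in[OF Z(1) q]] Z(2)[OF q] dd_alpha[OF Z(1) q] by simp
      qed
      then show ?thesis using v by (simp add: deriv_within_const)
    qed
    define z where "z = D X Y p - D Y X p"
    have z: "z \<in> T p" unfolding z_def using VF_in[OF D_VF p] X(1) Y(1) subspace_T[OF p] by (simp add: subspace_diff)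
    have "dd alpha p z = 0"
      using dd_commute[OF smooth_alpha X(1) Y(1) p] zero[OF Y(1,3) x(1)] zero[OF X(1,3) y(1)]
      unfolding z_def X(2) Y(2) by simp
    then have 1: "dalpha p (xi p) * g z (xi p) = 0" using hopf_dalpha[OF H p z] dalpha_dd[OF p z] by simp
    have der: "g (D V Z p) (xi p) = - l p * g (Z p) (phi p (V p))"
      if V: "V \<in> VF" "\<And>q. q \<in> M \<Longrightarrow> g (V q) (xi q) = 0" and Z: "Z \<in> VF" "\<And>q. q \<in> M \<Longrightarrow> g (Z q) (xi q) = 0" for V Z
    proof -
      have "dd (\<lambda>q. g (Z q) (xi q)) p (V p) = dd (\<lambda>q. 0) p (V p)"
        by (rule deriv_within_cong[OF smooth_map_const p VF_in[OF V(1) p]]) (simp add: Z)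
      then have "g (D V Z p) (xi p) + g (Z p) (phi p (shp p (V p))) = 0"
        using D_metric[OF V(1) Z(1) xi_VF p] VF_in[OF V(1) p] by (simp add: deriv_within_const D_xi[OF V(1) p])
      then show ?thesis unfolding l[OF p VF_in[OF V(1) p] V(2)[OF p]] by (simp add: lin[OF p])
    qed
    have "g z (xi p) = - 2 * l p * g y y"
      using der[OF X(1,3) Y(1,3)] der[OF Y(1,3) X(1,3)] phi_skew[OF p x(1) y(1)]
      unfolding z_def X(2) Y(2) by (simp add: g.diff_left y_def)
    moreover have "g y y > 0" using g_F_F[OF p x(1) x(1)] x(2) g_pos[OF p x(1,3)] by (simp add: y_def)
    ultimately show ?thesis using 1 l0[OF p] by simp
  qed
  have "dd alpha p x = 0" if "p \<in> M" "x \<in> T p" for p x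
    using hopf_dalpha[OF H that] da[OF that(1)] dalpha_dd[OF that] by simp
  then have const: "alpha p = alpha q" if "p \<in> M" "q \<in> M" for p q
    using smooth_map_zero_derivative_constant[OF _ connected_M smooth_alpha _ that] M
    unfolding real_hypersurface_def by blast
  obtain p0 where p0: "p0 \<in> M" using M_nonempty by blast
  define r where "r = alpha p0"
  have r: "alpha p = r" if "p \<in> M" for p using const[OF that p0] by (simp add: r_def)
  \<comment> \<open>Near \<open>p\<close> the function is the quotient of g(AX, X) by g(X, X) for a
    field X in D with X p nonzero. Continuity then selects one root of t^2 - r t - c on the
    connected set \<open>M\<close>.\<close>
  have "continuous_on M l"
    unfolding continuous_on_def
  proof
    fix p assume p: "p \<in> M"
    obtain x where x: "x \<in> T p" "g x (xi p) = 0" "x \<noteq> 0" using ex_W[OF p] unfolding perp_def by blast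
    obtain X where X: "X \<in> VF" "X p = x" "\<And>q. q \<in> M \<Longrightarrow> g (X q) (xi q) = 0" using extend_D_VF[OF p x(1,2)] by blast
    define n where "n q = g (X q) (X q)" for q
    have np: "n p \<noteq> 0" using g_pos[OF p x(1,3)] unfolding n_def X(2) by simp
    have num: "g (shp q (X q)) (X q) = l q * n q" if "q \<in> M" for q
      using l[OF that VF_in[OF X(1) that] X(3)[OF that]] by (simp add: n_def g.scaleR_left)
    have "((\<lambda>q. g (shp q (X q)) (X q)) \<longlongrightarrow> g (shp p (X p)) (X p)) (at p within M)"
      using smooth_map_continuous_on[OF smooth_g[OF VF_smooth[OF shp_VF[OF X(1)]] VF_smooth[OF X(1)]]] p
      unfolding continuous_on_def by blast
    moreover have nn: "(n \<longlongrightarrow> n p) (at p within M)"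
      using smooth_map_continuous_on[OF smooth_g[OF VF_smooth[OF X(1)] VF_smooth[OF X(1)]]] p
      unfolding continuous_on_def n_def by blast
    ultimately have "((\<lambda>q. g (shp q (X q)) (X q) / n q) \<longlongrightarrow> g (shp p (X p)) (X p) / n p) (at p within M)"
      using np by (rule tendsto_divide)
    moreover have "g (shp p (X p)) (X p) / n p = l p" using num[OF p] np by simp
    moreover have "\<forall>\<^sub>F q in at p within M. g (shp q (X q)) (X q) / n q = l q"
    proof -
      have "\<forall>\<^sub>F q in at p within M. q \<in> M" by (auto simp: eventually_at_filter)
      with tendsto_imp_eventually_ne[OF nn np] show ?thesis
        by eventually_elim (simp add: num)
    qed
    ultimately show "(l \<longlongrightarrow> l p) (at p within M)" using Lim_transform_eventually by fastforce
  qed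
  moreover have "finite (l ` M)"
  proof (rule finite_subset)
    show "l ` M \<subseteq> {t. poly [:- c, - r, 1:] t = 0}" using rel r by (auto simp: algebra_simps power2_eq_square)
    show "finite {t. poly [:- c, - r, 1:] t = 0}" by (rule poly_roots_finite) simp
  qed
  ultimately have "l constant_on M" by (intro continuous_finite_range_constant connected_M)
  then obtain m where m: "\<And>p. p \<in> M \<Longrightarrow> l p = m" unfolding constant_on_def by blast
  have "codazzi_jac (- (c + r\<^sup>2) * m - c * r) p" if p: "p \<in> M" for p
  proof -
    have "phi p (shp p x) = m *\<^sub>R phi p x" if x: "x \<in> T p" for x
    proof -
      have d: "x - g x (xi p) *\<^sub>R xi p \<in> T p" "g (x - g x (xi p) *\<^sub>R xi p) (xi p) = 0"
        using x xi_in[OF p] subspace_T[OF p] by (simp_all add: subspace_diff subspace_scale lin[OF p] g_xi_xi[OF p])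
      show ?thesis
        using arg_cong[OF l[OF p d], of "phi p"] m[OF p] by (simp add: lin[OF p] hopf_A_xi[OF H p] phi_xi[OF p])
    qed
    moreover have "shp p (phi p x) = m *\<^sub>R phi p x" if "x \<in> T p" for x
      using l[OF p phi_in[OF p] g_F_xi(1)[OF p that]] m[OF p] by simp
    ultimately show ?thesis
      using hopf_identityI[OF H p da[OF p], of m] r[OF p] by simp
  qed
  then show ?thesis by blast
qed

lemma totally_eta_umbilical_iff:
  assumes Db: "levi_civita (complex_space_form c) g Db"
  shows "totally_eta_umbilical c Db M N \<longleftrightarrow>
    (\<exists>l. \<forall>p\<in>M. \<forall>x\<in>T p. g x (xi p) = 0 \<longrightarrow> shp p x = l p *\<^sub>R x)"
proof
  assume "totally_eta_umbilical c Db M N"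
  then obtain l where l: "\<And>X p. X \<in> VF \<Longrightarrow> (\<forall>p\<in>M. g (X p) (xi p) = 0) \<Longrightarrow> p \<in> M \<Longrightarrow>
      shape_operator c Db M N X p = l p *\<^sub>R X p"
    unfolding totally_eta_umbilical_def xi_def by blast
  have "shp p x = l p *\<^sub>R x" if p: "p \<in> M" and x: "x \<in> T p" "g x (xi p) = 0" for p x
  proof -
    obtain X where X: "X \<in> VF" "X p = x" "\<And>q. q \<in> M \<Longrightarrow> g (X q) (xi q) = 0" using extend_D_VF[OF p x] by blast
    then show ?thesis using l[OF X(1) _ p] shape_operator_eq[OF Db p, of X] VF_in[OF X(1) p] by simp
  qed
  then show "\<exists>l. \<forall>p\<in>M. \<forall>x\<in>T p. g x (xi p) = 0 \<longrightarrow> shp p x = l p *\<^sub>R x" by blast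
next
  assume "\<exists>l. \<forall>p\<in>M. \<forall>x\<in>T p. g x (xi p) = 0 \<longrightarrow> shp p x = l p *\<^sub>R x"
  then obtain l where l: "\<And>p x. p \<in> M \<Longrightarrow> x \<in> T p \<Longrightarrow> g x (xi p) = 0 \<Longrightarrow> shp p x = l p *\<^sub>R x" by blast
  show "totally_eta_umbilical c Db M N"
    unfolding totally_eta_umbilical_def xi_def[symmetric]
    by (intro exI[of _ l] ballI impI) (simp add: shape_operator_eq[OF Db] VF_in l)
qed

lemma structure_alpha_eq:
  "levi_civita (complex_space_form c) g Db \<Longrightarrow> p \<in> M \<Longrightarrow> structure_alpha c Db M N p = alpha p"
  unfolding structure_alpha_def xi_def[symmetric] alpha_def
  by (simp add: shape_operator_eq xi_in)

lemma hopf_hypersurface_iff: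
  assumes Db: "levi_civita (complex_space_form c) g Db"
  shows "hopf_hypersurface c Db M N \<longleftrightarrow> (\<forall>p\<in>M. uu p = 0)"
  unfolding hopf_hypersurface_def xi_def[symmetric] uu_def
  by (simp add: shape_operator_eq[OF Db] xi_in structure_alpha_eq[OF Db])

section \<open>Reversal of the unit normal\<close>

lemma opposite_normal: "hypersurface c M (\<lambda>p. - N p) D"
proof unfold_locales
  have "- N p \<in> tangent_space (complex_space_form c) p" if "p \<in> M" for p
    unfolding tangent_space_csf[OF M_csf[OF that]] by (rule subspace_neg[OF subspace_csf_tangent N_csf[OF that]])
  then show "unit_normal c M (\<lambda>p. - N p)"
    using N unfolding unit_normal_def by (auto intro!: smooth_map_minus simp: g.minus_left g.minus_right)
qed (rule card_n M D)+

text \<open>Both A and \<xi> change sign, so A\<xi> is unchanged while \<alpha> is negated. The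
  product \<alpha>\<xi>, and with it \<open>uu\<close>, is therefore invariant.\<close>

lemma opposite_alpha:
  assumes p: "p \<in> M"
  shows "hypersurface.alpha c M (\<lambda>p. - N p) p = - alpha p"
    "hypersurface.uu c M (\<lambda>p. - N p) p = uu p"
proof -
  interpret o: hypersurface c M "\<lambda>p. - N p" D by (rule opposite_normal)
  have xi: "o.xi p = - xi p" using o.xi_eq[of p] xi_eq[of p] by (simp add: linear_neg[OF linear_csf_J])
  have shp: "o.shp p x = - shp p x" if "x \<in> T p" for x
    unfolding o.shp_def shp_def
    using deriv_within_minus[OF smooth_N p that] that p
    by (simp add: tproj_id o.tproj_id linear_neg[OF linear_csf_proj])
  show al: "o.alpha p = - alpha p"
    unfolding o.alpha_def alpha_def xi
    using shp[of "- xi p"] xi_in[OF p] subspace_T[OF p] by (simp add: subspace_neg lin[OF p])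
  show "o.uu p = uu p"
    unfolding o.uu_def uu_def xi al
    using shp[of "- xi p"] xi_in[OF p] subspace_T[OF p] by (simp add: subspace_neg lin[OF p])
qed

end

theorem theorem6:
  fixes c :: real
    and M :: "'n::finite cmat set"
    and Db D :: "'n cmat connection"
    and N :: "'n cmat \<Rightarrow> 'n cmat"
  assumes "CARD('n) > 2"
    and "c = 1 \<or> c = -1"
    and "levi_civita (complex_space_form c) (csf_metric c) Db"
    and "real_hypersurface c M"
    and "unit_normal c M N"
    and "levi_civita M (csf_metric c) D"
  shows "((\<exists>k. jacobi_codazzi_identity c D M N k) \<longleftrightarrow>
           totally_eta_umbilical c Db M N \<or>
           (c = -1 \<and> (\<exists>N'\<in>{N, \<lambda>p. - N p}.
              hopf_hypersurface c Db M N' \<and> (\<forall>p\<in>M. structure_alpha c Db M N' p = 1)))) \<and>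
         (c = -1 \<longrightarrow> (\<forall>N'\<in>{N, \<lambda>p. - N p}.
            hopf_hypersurface c Db M N' \<and> (\<forall>p\<in>M. structure_alpha c Db M N' p = 1) \<longrightarrow>
            jacobi_codazzi_identity c D M N' 1)) \<and>
         (\<forall>k. jacobi_codazzi_identity c D M N k \<longrightarrow> k \<noteq> 0)"
proof -
  interpret hypersurface c M N D
    using assms by unfold_locales
  interpret o: hypersurface c M "\<lambda>p. - N p" D by (rule opposite_normal)
  note Db = assms(3)
  have hopf: "hopf_hypersurface c Db M N \<and> (\<forall>p\<in>M. structure_alpha c Db M N p = 1) \<longleftrightarrow>
      (\<forall>p\<in>M. uu p = 0) \<and> (\<forall>p\<in>M. alpha p = 1)"
    by (simp add: hopf_hypersurface_iff[OF Db] structure_alpha_eq[OF Db])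
  \<comment> \<open>Expressed through the data of the original normal, the condition \<alpha> = 1
    for the opposite normal becomes \<alpha> = -1.\<close>
  have hopf_o: "hopf_hypersurface c Db M (\<lambda>p. - N p) \<and> (\<forall>p\<in>M. structure_alpha c Db M (\<lambda>p. - N p) p = 1) \<longleftrightarrow>
      (\<forall>p\<in>M. uu p = 0) \<and> (\<forall>p\<in>M. alpha p = - 1)"
    by (auto simp: o.hopf_hypersurface_iff[OF Db] o.structure_alpha_eq[OF Db] opposite_alpha)
  have fwd: "totally_eta_umbilical c Db M N \<or> c = -1 \<and> (\<forall>p\<in>M. uu p = 0) \<and> ((\<forall>p\<in>M. alpha p = 1) \<or> (\<forall>p\<in>M. alpha p = -1))"
    if "jacobi_codazzi_identity c D M N k" for k
  proof -
    have K: "codazzi_jac k p" if "p \<in> M" for p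
      using \<open>jacobi_codazzi_identity c D M N k\<close> that unfolding jacobi_codazzi_identity_iff by blast
    show ?thesis
    proof (rule disjE[OF identity_cases(2)[OF K]])
      assume "\<exists>l. \<forall>p\<in>M. \<forall>x\<in>T p. g x (xi p) = 0 \<longrightarrow> shp p x = l *\<^sub>R x"
      then obtain l where "\<forall>p\<in>M. \<forall>x\<in>T p. g x (xi p) = 0 \<longrightarrow> shp p x = l *\<^sub>R x" by blast
      then show ?thesis
        unfolding totally_eta_umbilical_iff[OF Db] by (intro disjI1 exI[of _ "\<lambda>p. l"])
    qed (assumption, rule disjI2)
  qed
  have bwd: "\<exists>k. jacobi_codazzi_identity c D M N k" if "totally_eta_umbilical c Db M N"
    using that identity_of_eta_umbilical unfolding totally_eta_umbilical_iff[OF Db] jacobi_codazzi_identity_iff by blast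
  have id: "jacobi_codazzi_identity c D M N r"
    if "c = -1" "\<forall>p\<in>M. uu p = 0" "\<forall>p\<in>M. alpha p = r" "r\<^sup>2 = 1" for r
    using identity_of_hopf[of r] that unfolding jacobi_codazzi_identity_iff by simp
  have id_o: "jacobi_codazzi_identity c D M (\<lambda>p. - N p) 1"
    if "c = -1" "\<forall>p\<in>M. uu p = 0" "\<forall>p\<in>M. alpha p = - 1"
    using o.identity_of_hopf[of 1] that opposite_alpha unfolding o.jacobi_codazzi_identity_iff by simp
  have nz: "k \<noteq> 0" if "jacobi_codazzi_identity c D M N k" for k
    using identity_cases(1)[of k] that[unfolded jacobi_codazzi_identity_iff] by blast
  have id1: "jacobi_codazzi_identity c D M N 1"
    if "c = -1" "\<forall>p\<in>M. uu p = 0" "\<forall>p\<in>M. alpha p = 1"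
    using id[OF that] by simp
  \<comment> \<open>When the suitable normal is the opposite one, the identity for \<open>N\<close>
    itself holds with -1; the existence of \<open>k\<close> in the equivalence refers to
    \<open>N\<close>.\<close>
  have idm1: "jacobi_codazzi_identity c D M N (- 1)"
    if "c = -1" "\<forall>p\<in>M. uu p = 0" "\<forall>p\<in>M. alpha p = - 1"
    using id[OF that] by simp
  show ?thesis
    unfolding bex_simps ball_simps hopf hopf_o
    using fwd bwd id1 idm1 id_o nz by blast
qed

end
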